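(* There exist universal constants $c, C > 0$ such that the following holds. Let $\Phi$ be an $m \times N$ (complex) sampling matrix with restricted isometry constant $\delta_{2s} \le c$. Let $u = \Phi x + e$ be a vector of samples of an arbitrary signal $x \in \mathbb{C}^N$, contaminated with arbitrary noise $e \in \mathbb{C}^m$. For a given precision parameter $\eta > 0$, the algorithm CoSaMP (run with sparsity parameter $2s$ and halted after a suitable fixed number of iterations) produces a $2s$-sparse approximation $a$ that satisfies $$\|x - a\|_2 \le C \cdot \max\left\{ \eta,\ \frac{1}{\sqrt{s}} \|x - x_s\|_1 + \|e\|_2 \right\},$$ where $x_s$ is a best $s$-sparse approximation to $x$. The running time is $O(\mathscr{L} \cdot \log(\|x\|_2/\eta))$, where $\mathscr{L}$ bounds the cost of a matrix--vector multiply with $\Phi$ or $\Phi^*$. The working storage use is $O(N)$.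
   Context: $\|x\|_0$ is the number of nonzero entries of $x$; $x$ is $r$-sparse if $\|x\|_0 \le r$. The restricted isometry constant $\delta_r$ of $\Phi$ is the least number such that $(1-\delta_r)\|x\|_2^2 \le \|\Phi x\|_2^2 \le (1+\delta_r)\|x\|_2^2$ for all $x\in\mathbb{C}^N$ with $\|x\|_0\le r$. For a vector $x$, $x_r$ is the vector obtained by keeping the $r$ largest-magnitude entries of $x$ (ties broken lexicographically) and setting the others to zero; it is a best $r$-sparse approximation in every $\ell_p$ norm. For an index set $T$, $x|_T$ agrees with $x$ on $T$ and is zero off $T$ (also viewed as an element of $\mathbb{C}^T$), $\Phi_T$ is the column submatrix of $\Phi$ with columns in $T$, and $A^\dagger = (A^*A)^{-1}A^*$ for a tall full-rank matrix $A$. CoSaMP with inputs $\Phi$, $u$ and sparsity parameter $\sigma$: set $a^0 = 0$, $v = u$. For $k = 1,2,3,\dots$ until halting: (1) $y = \Phi^* v$; (2) $\Omega = \operatorname{supp}(y_{2\sigma})$; (3) $T = \Omega\cup\operatorname{supp}(a^{k-1})$; (4) $b|_T = \Phi_T^\dagger u$, $b|_{T^c} = 0$; (5) $a^k = b_\sigma$; (6) $v = u - \Phi a^k$. The output is the final $a^k$. In the implementation to which the running-time and storage bounds refer, step (4) is replaced by three iterations of an iterative least-squares method initialized at $z^0=a^{k-1}$ (regarded as an element of $\mathbb{C}^T$), with $b|_T = z^3$: either Richardson's iteration $z^{\ell+1} = \Phi_T^*u - (\Phi_T^*\Phi_T - I)z^\ell$, or conjugate gradient applied to the normal equations $\Phi_T^*\Phi_T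 z = \Phi_T^* u$. Costs count arithmetic operations, with $\mathscr{L} \ge N$ and $m\le N$; storage excludes the storage of the sampling matrix. The factor $\log(\|x\|_2/\eta)$ is read as at least a positive constant. Big-O constants are universal. *)

theory Defs
  imports
    "HOL-Analysis.L2_Norm"
    "HOL-Library.Monad_Syntax"
    "Jordan_Normal_Form.Schur_Decomposition"
    "Jordan_Normal_Form.Gauss_Jordan_Elimination"
    "Jordan_Normal_Form.DL_Submatrix"
begin

section \<open>Sparsity, norms, restricted isometry constants\<close>

definition supp :: "complex vec \<Rightarrow> nat set" where
  "supp x = {i. i < dim_vec x \<and> x $ i \<noteq> 0}"

definition l0_norm :: "complex vec \<Rightarrow> nat" where
  "l0_norm x = card (supp x)"

definition l1_norm :: "complex vec \<Rightarrow> real" where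
  "l1_norm x = (\<Sum>i<dim_vec x. cmod (x $ i))"

definition l2_norm :: "complex vec \<Rightarrow> real" where
  "l2_norm x = L2_set (\<lambda>i. cmod (x $ i)) {..<dim_vec x}"

text \<open>The least such number exists as soon as the matrix has a column and \<open>r > 0\<close>.\<close>

definition ric :: "nat \<Rightarrow> complex mat \<Rightarrow> real" where
  "ric r \<Phi> = (LEAST \<delta>. \<forall>x\<in>carrier_vec (dim_col \<Phi>). l0_norm x \<le> r \<longrightarrow>
      (1 - \<delta>) * (l2_norm x)\<^sup>2 \<le> (l2_norm (\<Phi> *\<^sub>v x))\<^sup>2 \<and>
      (l2_norm (\<Phi> *\<^sub>v x))\<^sup>2 \<le> (1 + \<delta>) * (l2_norm x)\<^sup>2)"

text \<open>Entries are ranked by decreasing magnitude, ties by increasing index; \<open>largest r x\<close>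
  keeps the entries that have fewer than \<open>r\<close> entries ranked before them.\<close>

definition ranks_before :: "complex vec \<Rightarrow> nat \<Rightarrow> nat \<Rightarrow> bool" where
  "ranks_before x j i \<longleftrightarrow> cmod (x $ j) > cmod (x $ i) \<or> cmod (x $ j) = cmod (x $ i) \<and> j < i"

definition largest :: "nat \<Rightarrow> complex vec \<Rightarrow> complex vec" where
  "largest r x = vec (dim_vec x)
     (\<lambda>i. if card {j. j < dim_vec x \<and> ranks_before x j i} < r then x $ i else 0)"


section \<open>CoSaMP\<close>

definition columns :: "complex mat \<Rightarrow> nat set \<Rightarrow> complex mat" where
  "columns \<Phi> T = submatrix \<Phi> UNIV T"

text \<open>For \<open>T \<subseteq> {..<N}\<close>, passage between vectors of length \<open>N\<close> and vectors of length \<open>card T\<close>,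
  the elements of \<open>T\<close> being listed in increasing order, as in \<^const>\<open>submatrix\<close>.\<close>

definition restrict_vec :: "nat set \<Rightarrow> complex vec \<Rightarrow> complex vec" where
  "restrict_vec T x = vec (card T) (\<lambda>k. x $ pick T k)"

definition extend_vec :: "nat \<Rightarrow> nat set \<Rightarrow> complex vec \<Rightarrow> complex vec" where
  "extend_vec N T z = vec N (\<lambda>i. if i \<in> T then z $ card {j\<in>T. j < i} else 0)"

text \<open>A least-squares step maps a matrix \<open>A\<close>, samples \<open>u\<close> and a starting point \<open>z0\<close> to a vector
  that solves, exactly or approximately, the least-squares problem for \<open>A\<close> and \<open>u\<close>.\<close>

type_synonym ls_step = "complex mat \<Rightarrow> complex vec \<Rightarrow> complex vec \<Rightarrow> complex vec"

definition pseudo_inverse :: "complex mat \<Rightarrow> complex mat" where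
  "pseudo_inverse A = the (mat_inverse (mat_adjoint A * A)) * mat_adjoint A"

definition exact_ls :: ls_step where
  "exact_ls A u z0 = pseudo_inverse A *\<^sub>v u"

definition richardson :: "nat \<Rightarrow> ls_step" where
  "richardson l A u z0 =
     ((\<lambda>z. mat_adjoint A *\<^sub>v u - (mat_adjoint A * A - 1\<^sub>m (dim_col A)) *\<^sub>v z) ^^ l) z0"

text \<open>The state consists of the iterate, the residual and the search direction. Once the residual
  vanishes, the convention \<open>t / 0 = 0\<close> keeps the iterate constant.\<close>

definition cg_step ::
  "complex mat \<Rightarrow> complex vec \<times> complex vec \<times> complex vec \<Rightarrow>
   complex vec \<times> complex vec \<times> complex vec" where
  "cg_step G = (\<lambda>(z, r, p). let
      \<alpha> = (r \<bullet>c r) / ((G *\<^sub>v p) \<bullet>c p);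
      z' = z + \<alpha> \<cdot>\<^sub>v p;
      r' = r - \<alpha> \<cdot>\<^sub>v (G *\<^sub>v p);
      \<beta> = (r' \<bullet>c r') / (r \<bullet>c r)
    in (z', r', r' + \<beta> \<cdot>\<^sub>v p))"

definition conjugate_gradient :: "nat \<Rightarrow> ls_step" where
  "conjugate_gradient l A u z0 = (let
      G = mat_adjoint A * A;
      r = mat_adjoint A *\<^sub>v u - G *\<^sub>v z0
    in fst ((cg_step G ^^ l) (z0, r, r)))"

definition cosamp_step ::
  "ls_step \<Rightarrow> complex mat \<Rightarrow> complex vec \<Rightarrow> nat \<Rightarrow>
   complex vec \<times> complex vec \<Rightarrow> complex vec \<times> complex vec" where
  "cosamp_step ls \<Phi> u \<sigma> = (\<lambda>(a, v). let
      y = mat_adjoint \<Phi> *\<^sub>v v;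
      \<Omega> = supp (largest (2 * \<sigma>) y);
      T = \<Omega> \<union> supp a;
      b = extend_vec (dim_col \<Phi>) T (ls (columns \<Phi> T) u (restrict_vec T a));
      a' = largest \<sigma> b
    in (a', u - \<Phi> *\<^sub>v a'))"

text \<open>The approximation after \<open>k\<close> iterations.\<close>

definition cosamp :: "ls_step \<Rightarrow> complex mat \<Rightarrow> complex vec \<Rightarrow> nat \<Rightarrow> nat \<Rightarrow> complex vec" where
  "cosamp ls \<Phi> u \<sigma> k = fst ((cosamp_step ls \<Phi> u \<sigma> ^^ k) (0\<^sub>v (dim_col \<Phi>), u))"


section \<open>Operation counts and working storage\<close>

text \<open>The number of memory cells occupied by a value: one for each scalar.\<close>

class storable =
  fixes cells :: "'a \<Rightarrow> nat"

instantiation bool :: storable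
begin
definition cells_bool :: "bool \<Rightarrow> nat" where "cells_bool x = 1"
instance ..
end

instantiation nat :: storable
begin
definition cells_nat :: "nat \<Rightarrow> nat" where "cells_nat x = 1"
instance ..
end

instantiation real :: storable
begin
definition cells_real :: "real \<Rightarrow> nat" where "cells_real x = 1"
instance ..
end

instantiation complex :: storable
begin
definition cells_complex :: "complex \<Rightarrow> nat" where "cells_complex x = 1"
instance ..
end

instantiation prod :: (storable, storable) storable
begin
definition cells_prod :: "'a \<times> 'b \<Rightarrow> nat" where "cells_prod x = cells (fst x) + cells (snd x)"
instance ..
end

instantiation list :: (storable) storable
begin
definition cells_list :: "'a list \<Rightarrow> nat" where "cells_list xs = sum_list (map cells xs)"
instance ..
end

text \<open>A run of a procedure: its result, the number of elementary operations, and the peak number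
  of cells in use besides those of its arguments (the cells of the result are included).\<close>

datatype 'a run = Run (val: 'a) (ops: nat) (peak: nat)

text \<open>One elementary operation: a scalar arithmetic operation or comparison, a logical
  connective, or the assembling or copying of a data structure.\<close>

definition step :: "'a::storable \<Rightarrow> 'a run" where
  "step x = Run x 1 (cells x)"

text \<open>In a sequential composition the first result stays allocated to the end.\<close>

definition bind_run :: "'a::storable run \<Rightarrow> ('a \<Rightarrow> 'b run) \<Rightarrow> 'b run" where
  "bind_run r f = (let r' = f (val r) in
     Run (val r') (ops r + ops r') (max (peak r) (cells (val r) + peak r')))"

adhoc_overloading Monad_Syntax.bind \<rightleftharpoons> bind_run

text \<open>A loop, in contrast, overwrites its state.\<close>

primrec loop_run :: "nat \<Rightarrow> ('a::storable \<Rightarrow> 'a run) \<Rightarrow> 'a \<Rightarrow> 'a run" where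
  "loop_run 0 f z = step z"
| "loop_run (Suc n) f z = (let r = f z; r' = loop_run n f (val r) in
     Run (val r') (ops r + ops r') (max (cells z + peak r) (peak r')))"

text \<open>A call of a subroutine that multiplies by \<open>M\<close>, with operation count \<open>w\<close>. Its internal storage
  is attributed to the storage of \<open>M\<close>, but its result occupies working storage.\<close>

definition mult_run :: "complex mat \<Rightarrow> (complex vec \<Rightarrow> nat) \<Rightarrow> complex list \<Rightarrow> complex list run" where
  "mult_run M w xs = Run (list_of_vec (M *\<^sub>v vec_of_list xs)) (w (vec_of_list xs)) (dim_row M)"

fun map_run :: "('a \<Rightarrow> 'b::storable run) \<Rightarrow> 'a list \<Rightarrow> 'b list run" where
  "map_run f [] = step []"
| "map_run f (x # xs) = do { y \<leftarrow> f x; ys \<leftarrow> map_run f xs; step (y # ys) }"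

fun filter_run :: "('a::storable \<Rightarrow> bool run) \<Rightarrow> 'a list \<Rightarrow> 'a list run" where
  "filter_run p [] = step []"
| "filter_run p (x # xs) =
     do { b \<leftarrow> p x; ys \<leftarrow> filter_run p xs; if b then step (x # ys) else step ys }"

fun dot_run :: "complex list \<Rightarrow> complex list \<Rightarrow> complex run" where
  "dot_run (x # xs) (y # ys) =
     do { c \<leftarrow> step (cnj y); p \<leftarrow> step (x * c); t \<leftarrow> dot_run xs ys; step (p + t) }"
| "dot_run _ _ = step 0"

definition add_run :: "complex list \<Rightarrow> complex list \<Rightarrow> complex list run" where
  "add_run xs ys = map_run (\<lambda>(x, y). step (x + y)) (zip xs ys)"

definition sub_run :: "complex list \<Rightarrow> complex list \<Rightarrow> complex list run" where
  "sub_run xs ys = map_run (\<lambda>(x, y). step (x - y)) (zip xs ys)"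

definition scale_run :: "complex \<Rightarrow> complex list \<Rightarrow> complex list run" where
  "scale_run c xs = map_run (\<lambda>x. step (c * x)) xs"

definition mask_run :: "bool list \<Rightarrow> complex list \<Rightarrow> complex list run" where
  "mask_run ts xs = map_run (\<lambda>(t, x). if t then step x else step 0) (zip ts xs)"


subsection \<open>Selection of the largest entries in linear time\<close>

text \<open>A key is a squared magnitude together with an index.\<close>

type_synonym key = "real \<times> nat"

definition before_run :: "key \<Rightarrow> key \<Rightarrow> bool run" where
  "before_run k l = do {
     g \<leftarrow> step (fst k > fst l);
     if g then step True
     else do { q \<leftarrow> step (fst k = fst l); if q then step (snd k < snd l) else step False } }"

fun insert_run :: "key \<Rightarrow> key list \<Rightarrow> key list run" where
  "insert_run x [] = step [x]"
| "insert_run x (y # ys) =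
     do { b \<leftarrow> before_run x y;
          if b then step (x # y # ys) else do { zs \<leftarrow> insert_run x ys; step (y # zs) } }"

fun sort_run :: "key list \<Rightarrow> key list run" where
  "sort_run [] = step []"
| "sort_run (x # xs) = do { ys \<leftarrow> sort_run xs; insert_run x ys }"

definition median_run :: "key list \<Rightarrow> key run" where
  "median_run xs = do { ys \<leftarrow> sort_run xs; step (ys ! (length xs div 2)) }"

function medians_run :: "key list \<Rightarrow> key list run" where
  "medians_run [] = step []"
| "medians_run (x # xs) =
     do { m \<leftarrow> median_run (take 5 (x # xs)); ms \<leftarrow> medians_run (drop 5 (x # xs)); step (m # ms) }"
  by pat_completeness auto
termination by (relation "measure length") auto

text \<open>\<open>select_run d k xs\<close> finds the key with exactly \<open>k\<close> keys of \<open>xs\<close> ranked before it, by the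
  median-of-medians method. The parameter \<open>d\<close> only makes the recursion well-founded: every
  recursive call is on a shorter list, so \<open>d = length xs\<close> is never exhausted.\<close>

primrec select_run :: "nat \<Rightarrow> nat \<Rightarrow> key list \<Rightarrow> key run" where
  "select_run 0 k xs = step (xs ! k)"
| "select_run (Suc d) k xs =
     (if length xs < 140 then do { ys \<leftarrow> sort_run xs; step (ys ! k) }
      else do {
        ms \<leftarrow> medians_run xs;
        p \<leftarrow> select_run d (length ms div 2) ms;
        lo \<leftarrow> filter_run (\<lambda>x. before_run x p) xs;
        hi \<leftarrow> filter_run (\<lambda>x. before_run p x) xs;
        if k < length lo then select_run d k lo
        else if k = length lo then step p
        else select_run d (k - length lo - 1) hi })"

definition key_run :: "nat \<times> complex \<Rightarrow> key run" where
  "key_run = (\<lambda>(i, y). do {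
     p \<leftarrow> step (Re y * Re y); q \<leftarrow> step (Im y * Im y); t \<leftarrow> step (p + q); step (t, i) })"

text \<open>Implements \<^const>\<open>largest\<close> for \<open>r > 0\<close>.\<close>

definition largest_run :: "nat \<Rightarrow> complex list \<Rightarrow> complex list run" where
  "largest_run r ys = (if length ys \<le> r then step ys else do {
     ks \<leftarrow> map_run key_run (zip [0..<length ys] ys);
     t \<leftarrow> select_run (length ys) (r - 1) ks;
     map_run (\<lambda>(y, k). do { b \<leftarrow> before_run t k; if b then step 0 else step y }) (zip ys ks) })"


subsection \<open>The implementation of CoSaMP\<close>

text \<open>Vectors indexed by \<open>T\<close> are represented by vectors of length \<open>N\<close> vanishing off \<open>T\<close>, and \<open>T\<close>
  by a list \<open>ts\<close> of \<open>N\<close> truth values. The arguments \<open>mul\<close> and \<open>mul_adj\<close> are the subroutines that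
  multiply by the sampling matrix and by its adjoint.\<close>

type_synonym mul = "complex list \<Rightarrow> complex list run"

type_synonym ls_run =
  "mul \<Rightarrow> mul \<Rightarrow> bool list \<Rightarrow> complex list \<Rightarrow> complex list \<Rightarrow> complex list run"

definition rhs_run :: "mul \<Rightarrow> bool list \<Rightarrow> complex list \<Rightarrow> complex list run" where
  "rhs_run mul_adj ts u = do { q \<leftarrow> mul_adj u; mask_run ts q }"

definition gram_run :: "mul \<Rightarrow> mul \<Rightarrow> bool list \<Rightarrow> complex list \<Rightarrow> complex list run" where
  "gram_run mul mul_adj ts z = do { p \<leftarrow> mul z; q \<leftarrow> mul_adj p; mask_run ts q }"

definition richardson_run :: "nat \<Rightarrow> ls_run" where
  "richardson_run l mul mul_adj ts u z0 = do {
     h \<leftarrow> rhs_run mul_adj ts u;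
     loop_run l (\<lambda>z. do {
       g \<leftarrow> gram_run mul mul_adj ts z;
       d \<leftarrow> sub_run g z;
       sub_run h d }) z0 }"

definition cg_step_run ::
  "mul \<Rightarrow> mul \<Rightarrow> bool list \<Rightarrow> complex list \<times> complex list \<times> complex list \<times> complex \<Rightarrow>
   (complex list \<times> complex list \<times> complex list \<times> complex) run" where
  "cg_step_run mul mul_adj ts = (\<lambda>(z, r, p, \<rho>). do {
     q \<leftarrow> gram_run mul mul_adj ts p;
     d \<leftarrow> dot_run q p;
     \<alpha> \<leftarrow> step (\<rho> / d);
     \<alpha>p \<leftarrow> scale_run \<alpha> p;
     z' \<leftarrow> add_run z \<alpha>p;
     \<alpha>q \<leftarrow> scale_run \<alpha> q;
     r' \<leftarrow> sub_run r \<alpha>q;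
     \<rho>' \<leftarrow> dot_run r' r';
     \<beta> \<leftarrow> step (\<rho>' / \<rho>);
     \<beta>p \<leftarrow> scale_run \<beta> p;
     p' \<leftarrow> add_run r' \<beta>p;
     step (z', r', p', \<rho>') })"

definition conjugate_gradient_run :: "nat \<Rightarrow> ls_run" where
  "conjugate_gradient_run l mul mul_adj ts u z0 = do {
     h \<leftarrow> rhs_run mul_adj ts u;
     g \<leftarrow> gram_run mul mul_adj ts z0;
     r \<leftarrow> sub_run h g;
     \<rho> \<leftarrow> dot_run r r;
     st \<leftarrow> loop_run l (cg_step_run mul mul_adj ts) (z0, r, r, \<rho>);
     step (fst st) }"

definition cosamp_step_run ::
  "ls_run \<Rightarrow> mul \<Rightarrow> mul \<Rightarrow> complex list \<Rightarrow> nat \<Rightarrow>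
   complex list \<times> complex list \<Rightarrow> (complex list \<times> complex list) run" where
  "cosamp_step_run ls mul mul_adj u \<sigma> = (\<lambda>(a, v). do {
     y \<leftarrow> mul_adj v;
     y' \<leftarrow> largest_run (2 * \<sigma>) y;
     ts \<leftarrow> map_run (\<lambda>(y, a). do { p \<leftarrow> step (y \<noteq> 0); q \<leftarrow> step (a \<noteq> 0); step (p \<or> q) }) (zip y' a);
     b \<leftarrow> ls mul mul_adj ts u a;
     a' \<leftarrow> largest_run \<sigma> b;
     w \<leftarrow> mul a';
     v' \<leftarrow> sub_run u w;
     step (a', v') })"

definition cosamp_run ::
  "ls_run \<Rightarrow> nat \<Rightarrow> mul \<Rightarrow> mul \<Rightarrow> complex list \<Rightarrow> nat \<Rightarrow> nat \<Rightarrow> complex list run" where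
  "cosamp_run ls N mul mul_adj u \<sigma> k = do {
     a \<leftarrow> map_run (\<lambda>i. step 0) [0..<N];
     st \<leftarrow> loop_run k (cosamp_step_run ls mul mul_adj u \<sigma>) (a, u);
     step (fst st) }"

end

theory Submission
  imports Defs
begin

text \<open>
  Polarization and splitting into \<open>s\<close>-sparse pieces turn \<open>\<delta>\<^sub>2\<^sub>s \<le> c\<close> into the bound
  \<open>\<bar>\<langle>\<Phi>f, \<Phi>g\<rangle> - \<langle>f, g\<rangle>\<bar> \<le> D \<parallel>f\<parallel> \<parallel>g\<parallel>\<close> with \<open>D = 256 c\<close> for all
  \<open>8s\<close>-sparse \<open>f\<close> and \<open>g\<close>, so \<open>\<Phi>\<^sup>*\<Phi>\<close> is nearly
  the identity on small index sets. With \<open>D = 1/64\<close> one iteration of CoSaMP halves the error up to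
  a multiple of the noise. The least-squares step costs little: Richardson's iteration contracts by
  \<open>D\<close>, and so does the first step of conjugate gradient, being an exact line search that does at
  least as well as a step of length one, while the later steps cannot increase \<open>\<parallel>\<Phi>\<^sub>T e\<parallel>\<close>. The part
  of the signal outside its \<open>2s\<close> largest entries is treated as noise, and comparing consecutive
  blocks of \<open>s\<close> entries bounds it by the \<open>\<ell>\<^sub>1\<close> tail. Apart from selection every operation of the
  implementation is visibly linear, and selection is linear by the median-of-medians argument
  \<open>T(n) \<le> T(n/5 + 1) + T(7n/10 + 2) + O(n)\<close>.
\<close>

section \<open>Runs and linear-time selection\<close>

text \<open>The hypothesis controls order 2s only, while an iteration with parameter \<sigma> = 2s
  meets supports of size up to 4 \<sigma> = 8s: at most 2 \<sigma> newly identified indices,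
  \<sigma> kept ones and \<sigma> of the signal. Hence \<open>defect\<close> is bounded with a
  separate sparsity level for each argument, so that each level can be doubled on its own. The
  parameter 2s in turn serves the error term: the signal is cut after 2s entries but the l1 tail
  starts after s, so every block cut off has a preceding block of s entries to average over, and no
  l2 tail survives. Accuracy and cost are proved independently and meet only in the theorem. The
  implementation never forms the submatrix on \<open>T\<close>: padding by zeros embeds vectors
  indexed by \<open>T\<close> isometrically into length N and turns the submatrix into the full
  matrix and its adjoint into the full adjoint followed by a mask, so the programs compute exactly
  what the specifications define. The accuracy argument sees a solver only through its contraction,
  by 1/16, towards the exact least-squares solution. \<open>ric\<close> is a \<open>LEAST\<close>
  over the reals, which says nothing until a least element is known to exist.\<close>

lemma step_simps [simp]:
  "val (step x) = x" "ops (step x) = 1" "peak (step x) = cells x"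
  by (simp_all add: step_def)

lemma bind_run_simps [simp]:
  "val (bind_run r f) = val (f (val r))"
  "ops (bind_run r f) = ops r + ops (f (val r))"
  "peak (bind_run r f) = max (peak r) (cells (val r) + peak (f (val r)))"
  by (simp_all add: bind_run_def Let_def)

lemma cells_simps [simp]:
  "cells (b::bool) = 1" "cells (i::nat) = 1" "cells (t::real) = 1" "cells (z::complex) = 1"
  "cells (p, q) = cells p + cells q"
  "cells ([]::'a::storable list) = 0" "cells (y # ys) = cells y + cells ys"
  by (simp_all add: cells_bool_def cells_nat_def cells_real_def cells_complex_def cells_prod_def
      cells_list_def)

lemma cells_key [simp]: "cells (k::key) = 2"
  by (cases k) simp

lemma cells_list_const: "(\<And>y. y \<in> set ys \<Longrightarrow> cells y = c) \<Longrightarrow> cells ys = c * length ys"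
  by (induction ys) auto

lemma cells_scalar_list [simp]:
  "cells (zs::complex list) = length zs" "cells (bs::bool list) = length bs"
  "cells (ks::key list) = 2 * length ks"
  using cells_list_const[of zs 1] cells_list_const[of bs 1] cells_list_const[of ks 2] by auto

text \<open>The order that \<open>before_run\<close> decides. The index in a key makes it a strict
  total order even when magnitudes coincide, so sorting and selection need no treatment of
  ties.\<close>

definition before :: "key \<Rightarrow> key \<Rightarrow> bool" where
  "before k l \<longleftrightarrow> fst k > fst l \<or> fst k = fst l \<and> snd k < snd l"

lemma before_irrefl [simp]: "\<not> before k k"
  and before_trans: "before k l \<Longrightarrow> before l m \<Longrightarrow> before k m"
  and before_total: "k \<noteq> l \<Longrightarrow> before k l \<or> before l k"
  and before_asym: "before k l \<Longrightarrow> \<not> before l k"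
  by (auto simp: before_def prod_eq_iff)

lemma before_run_simps [simp]:
  "val (before_run k l) = before k l"
  by (auto simp: before_run_def before_def)

lemma before_run_ops: "ops (before_run k l) \<le> 3"
  and before_run_peak: "peak (before_run k l) \<le> 3"
  by (auto simp: before_run_def)

section \<open>Insertion sort, filtering and the medians of groups of five\<close>

lemma insert_run_mset: "mset (val (insert_run x ys)) = add_mset x (mset ys)"
  by (induction ys) auto

lemma insert_run_length [simp]: "length (val (insert_run x ys)) = Suc (length ys)"
  using insert_run_mset[of x ys] by (metis size_add_mset size_mset)

lemma insert_run_set [simp]: "set (val (insert_run x ys)) = insert x (set ys)"
  using insert_run_mset[of x ys] by (metis set_mset_add_mset_insert set_mset_mset)

lemma insert_run_sorted:
  "sorted_wrt before ys \<Longrightarrow> x \<notin> set ys \<Longrightarrow> sorted_wrt before (val (insert_run x ys))"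
proof (induction ys)
  case (Cons y ys)
  then show ?case using before_total[of x y] by (auto intro: before_trans)
qed simp

lemma insert_run_ops: "ops (insert_run x ys) \<le> 4 * length ys + 1"
proof (induction ys)
  case (Cons y ys)
  then show ?case using before_run_ops[of x y] by auto
qed simp

lemma insert_run_peak: "peak (insert_run x ys) \<le> 5 * length ys + 7"
proof (induction ys)
  case (Cons y ys)
  then show ?case using before_run_peak[of x y] by auto
qed simp

lemma sort_run_mset [simp]: "mset (val (sort_run xs)) = mset xs"
  by (induction xs) (auto simp: insert_run_mset)

lemma sort_run_length [simp]: "length (val (sort_run xs)) = length xs"
  by (metis size_mset sort_run_mset)

lemma sort_run_set [simp]: "set (val (sort_run xs)) = set xs"
  by (metis set_mset_mset sort_run_mset)

lemma sort_run_sorted: "distinct xs \<Longrightarrow> sorted_wrt before (val (sort_run xs))"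
  by (induction xs) (auto intro: insert_run_sorted)

lemma sort_run_ops: "ops (sort_run xs) \<le> 4 * (length xs)\<^sup>2 + length xs + 1"
proof (induction xs)
  case (Cons x xs)
  then show ?case using insert_run_ops[of x "val (sort_run xs)"]
    by (auto simp: power2_eq_square)
qed simp

lemma sort_run_peak: "peak (sort_run xs) \<le> 7 * length xs + 7"
proof (induction xs)
  case (Cons x xs)
  then show ?case using insert_run_peak[of x "val (sort_run xs)"] by auto
qed simp

lemma filter_run_val [simp]: "val (filter_run p xs) = filter (\<lambda>x. val (p x)) xs"
  by (induction xs) auto

lemma filter_run_ops:
  assumes "\<And>x. ops (p x) \<le> 3"
  shows "ops (filter_run p xs) \<le> 4 * length xs + 1"
proof (induction xs)
  case (Cons x xs)
  then show ?case using assms[of x] by auto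
qed simp

lemma filter_run_peak:
  fixes xs :: "key list"
  assumes "\<And>x. peak (p x) \<le> 3"
  shows "peak (filter_run p xs) \<le> 5 * length xs + 3"
proof (induction xs)
  case (Cons x xs)
  have "length (filter (\<lambda>x. val (p x)) xs) \<le> length xs" by simp
  with Cons assms[of x] show ?case by (cases "val (p x)") (simp_all del: length_filter_le)
qed simp

lemma median_run_ops: "length xs \<le> 5 \<Longrightarrow> ops (median_run xs) \<le> 107"
proof -
  assume "length xs \<le> 5"
  moreover from this have "(length xs)\<^sup>2 \<le> 5\<^sup>2" by (rule power_mono) simp
  ultimately show ?thesis using sort_run_ops[of xs] by (auto simp: median_run_def)
qed

lemma median_run_peak: "length xs \<le> 5 \<Longrightarrow> peak (median_run xs) \<le> 42"
  using sort_run_peak[of xs] by (auto simp: median_run_def)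

text \<open>Together the bounds say that the number of groups is n/5 rounded up. The upper one
  limits the recursive call on the medians, the lower one guarantees enough medians on each side of
  the pivot.\<close>

lemma medians_run_length: "5 * length (val (medians_run xs)) \<le> length xs + 4"
  "length xs \<le> 5 * length (val (medians_run xs))"
proof (induction xs rule: medians_run.induct)
  case (2 x xs)
  {
    case 1
    have "val (medians_run (drop 4 xs)) = []" if "length xs \<le> 4" using that by simp
    with 2 show ?case by (cases "length xs \<le> 4") auto
  next
    case 2
    from \<open>length (drop 5 (x # xs)) \<le> _\<close> show ?case by auto
  }
qed simp_all

lemma medians_run_ops: "ops (medians_run xs) \<le> 108 * length (val (medians_run xs)) + 1"
proof (induction xs rule: medians_run.induct)
  case (2 x xs)
  then show ?case using median_run_ops[of "take 5 (x # xs)"] by (auto simp del: take_Suc_Cons)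
qed simp

lemma medians_run_peak: "peak (medians_run xs) \<le> 42 + 4 * length (val (medians_run xs))"
proof (induction xs rule: medians_run.induct)
  case (2 x xs)
  then show ?case using median_run_peak[of "take 5 (x # xs)"] by (auto simp del: take_Suc_Cons)
qed simp

section \<open>Balance of the median-of-medians pivot\<close>

lemma length_filter_upward:
  assumes "sorted_wrt before ys" "j < length ys" "Q (ys ! j)"
    and "\<And>x y. Q x \<Longrightarrow> before x y \<Longrightarrow> Q y"
  shows "length ys - j \<le> length (filter Q ys)"
proof -
  have "filter Q (drop j ys) = drop j ys"
  proof (intro filter_id_conv[THEN iffD2] ballI)
    fix y assume "y \<in> set (drop j ys)"
    then obtain i where "j \<le> i" "i < length ys" "y = ys ! i"
      by (auto simp: in_set_conv_nth) (metis add.commute le_add1 less_diff_conv)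
    then show "Q y"
      using assms(1,2,3) assms(4)[of "ys ! j" "ys ! i"]
        by (cases "i = j") (auto simp: sorted_wrt_iff_nth_less)
  qed
  then have "length ys - j = length (filter Q (drop j ys))" by simp
  also have "\<dots> \<le> length (filter Q (take j ys @ drop j ys))" by (simp only: filter_append) simp
  finally show ?thesis by simp
qed

lemma length_filter_downward:
  assumes "sorted_wrt before ys" "j < length ys" "Q (ys ! j)"
    and "\<And>x y. Q y \<Longrightarrow> before x y \<Longrightarrow> Q x"
  shows "Suc j \<le> length (filter Q ys)"
proof -
  have "filter Q (take (Suc j) ys) = take (Suc j) ys"
  proof (intro filter_id_conv[THEN iffD2] ballI)
    fix y assume "y \<in> set (take (Suc j) ys)"
    then obtain i where "i \<le> j" "y = ys ! i"
      using assms(2) by (auto simp: in_set_conv_nth less_Suc_eq_le)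
    then show "Q y"
      using assms(1,2,3) assms(4)[of "ys ! j" "ys ! i"]
        by (cases "i = j") (auto simp: sorted_wrt_iff_nth_less)
  qed
  then have "Suc j = length (filter Q (take (Suc j) ys))" using assms(2) by simp
  also have "\<dots> \<le> length (filter Q (take (Suc j) ys @ drop (Suc j) ys))"
    by (simp only: filter_append) simp
  finally show ?thesis by simp
qed

lemma length_filter_mset_cong:
  "mset xs = mset ys \<Longrightarrow> length (filter Q xs) = length (filter Q ys)"
  by (metis mset_filter size_mset)

lemma median_run_in: "xs \<noteq> [] \<Longrightarrow> val (median_run xs) \<in> set xs"
  using nth_mem[of "length xs div 2" "val (sort_run xs)"] by (simp add: median_run_def)

text \<open>The median of n elements has index \<open>n div 2\<close>, so at least half of the
  elements lie at or behind it and, as the mirror image states, at least half at or before it. A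
  property of the median that is closed in one direction therefore holds for half of the
  group.\<close>

lemma median_run_upward:
  assumes "distinct xs" "xs \<noteq> []" "Q (val (median_run xs))"
    and "\<And>x y. Q x \<Longrightarrow> before x y \<Longrightarrow> Q y"
  shows "length xs - length xs div 2 \<le> length (filter Q xs)"
proof -
  have "length (val (sort_run xs)) - length xs div 2 \<le> length (filter Q (val (sort_run xs)))"
    using assms by (intro length_filter_upward sort_run_sorted) (auto simp: median_run_def)
  then show ?thesis
    using length_filter_mset_cong[OF sort_run_mset[of xs], of Q] by simp
qed

lemma median_run_downward:
  assumes "distinct xs" "xs \<noteq> []" "Q (val (median_run xs))"
    and "\<And>x y. Q y \<Longrightarrow> before x y \<Longrightarrow> Q x"
  shows "Suc (length xs div 2) \<le> length (filter Q xs)"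
proof -
  have "Suc (length xs div 2) \<le> length (filter Q (val (sort_run xs)))"
    using assms by (intro length_filter_downward sort_run_sorted) (auto simp: median_run_def)
  then show ?thesis
    using length_filter_mset_cong[OF sort_run_mset[of xs], of Q] by simp
qed

lemma medians_run_set: "set (val (medians_run xs)) \<subseteq> set xs"
proof (induction xs rule: medians_run.induct)
  case (2 x xs)
  have "val (median_run (take 5 (x # xs))) \<in> set (take 5 (x # xs))" by (rule median_run_in) simp
  with 2 show ?case using set_take_subset[of 5 "x # xs"] set_drop_subset[of 5 "x # xs"]
    by (auto simp del: take_Suc_Cons drop_Suc_Cons)
qed simp

lemma medians_run_distinct: "distinct xs \<Longrightarrow> distinct (val (medians_run xs))"
proof (induction xs rule: medians_run.induct)
  case (2 x xs)
  have "val (median_run (take 5 (x # xs))) \<in> set (take 5 (x # xs))" by (rule median_run_in) simp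
  moreover have "set (take 5 (x # xs)) \<inter> set (drop 5 (x # xs)) = {}"
    using 2 by (intro set_take_disj_set_drop_if_distinct) auto
  ultimately have "val (median_run (take 5 (x # xs))) \<notin> set (val (medians_run (drop 5 (x # xs))))"
    using medians_run_set by blast
  then show ?case using 2 distinct_drop[of "x # xs" 5] by (simp del: take_Suc_Cons drop_Suc_Cons)
qed simp

text \<open>A full group has three elements on the same side of a threshold as its median, and the
  last group has at least one.\<close>

lemma medians_run_count:
  assumes "distinct xs"
    and "\<And>ys. distinct ys \<Longrightarrow> ys \<noteq> [] \<Longrightarrow> Q (val (median_run ys)) \<Longrightarrow>
      length ys \<le> 2 * length (filter Q ys)"
  shows "3 * length (filter Q (val (medians_run xs))) \<le> length (filter Q xs) + 2"
  using assms(1)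
proof (induction xs rule: medians_run.induct)
  case (2 x xs)
  let ?t = "take 5 (x # xs)" and ?d = "drop 5 (x # xs)"
  have d: "distinct ?t" "distinct ?d" using 2(2) distinct_take distinct_drop by blast+
  have split: "length (filter Q (x # xs)) = length (filter Q ?t) + length (filter Q ?d)"
    by (metis append_take_drop_id filter_append length_append)
  have IH: "3 * length (filter Q (val (medians_run ?d))) \<le> length (filter Q ?d) + 2"
    using 2(1) d by blast
  let ?m = "val (median_run ?t)" and ?ms = "val (medians_run ?d)"
  \<comment> \<open>One group of size \<open>l\<close> with \<open>b\<close> elements satisfying
    \<open>Q\<close>; \<open>q\<close> says that its median satisfies \<open>Q\<close>,
    \<open>e\<close> that it is the last one. If \<open>l = 5\<close>, then
    \<open>l \<le> 2 * b\<close> forces \<open>3 \<le> b\<close>; a last group only gives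
    \<open>1 \<le> b\<close>, and the slack 2 covers the difference.\<close>
  have arith: "3 * f \<le> b + b' + 2" if "f = (if q then 1 else 0) + a" "q \<Longrightarrow> l \<le> 2 * b"
    "e \<or> l = 5" "0 < l" "e \<Longrightarrow> a = 0" "3 * a \<le> b' + 2" for f a b b' l :: nat and q e :: bool
    using that by (cases q; cases e) auto
  have "3 * length (filter Q (val (medians_run (x # xs)))) \<le>
      length (filter Q ?t) + length (filter Q ?d) + 2"
  proof (rule arith)
    show "length (filter Q (val (medians_run (x # xs)))) = (if Q ?m then 1 else 0) +
        length (filter Q ?ms)"
      by simp
    show "Q ?m \<Longrightarrow> length ?t \<le> 2 * length (filter Q ?t)"
      by (rule assms(2)) (use d in auto)
    show "?d = [] \<or> length ?t = 5" by auto
    show "length (filter Q ?ms) = 0" if "?d = []" by (simp only: that) simp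
  qed (use IH in auto)
  then show ?case using split by simp
qed simp

abbreviation rank :: "key \<Rightarrow> key list \<Rightarrow> nat" where
  "rank v xs \<equiv> length (filter (\<lambda>x. before x v) xs)"

lemma mset_pivot:
  assumes "distinct xs" "p \<in> set xs"
  shows "mset xs = mset (filter (\<lambda>x. before x p) xs @ p # filter (\<lambda>x. before p x) xs)"
  using assms before_total[of _ p]
  by (subst set_eq_iff_mset_eq_distinct[symmetric]) (auto dest: before_asym)

lemma length_filter_pivot:
  assumes "distinct xs" "p \<in> set xs"
  shows "length (filter Q xs) = length (filter Q (filter (\<lambda>x. before x p) xs)) +
    (if Q p then 1 else 0) + length (filter Q (filter (\<lambda>x. before p x) xs))"
  using length_filter_mset_cong[OF mset_pivot[OF assms], of Q] by simp

lemma rank_sorted: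
  assumes "sorted_wrt before ys" "k < length ys"
  shows "rank (ys ! k) ys = k"
proof -
  have "{i. i < length ys \<and> before (ys ! i) (ys ! k)} = {..<k}"
  proof (intro equalityI subsetI; clarsimp)
    fix i assume i: "i < length ys" "before (ys ! i) (ys ! k)"
    show "i < k"
    proof (rule ccontr)
      assume "\<not> i < k"
      then have "i = k \<or> before (ys ! k) (ys ! i)"
        using assms(1) i(1) nat_neq_iff[of i k] by (auto simp: sorted_wrt_iff_nth_less)
      then show False using i before_asym by auto
    qed
  qed (use assms in \<open>auto simp: sorted_wrt_iff_nth_less\<close>)
  then show ?thesis by (simp add: length_filter_conv_card)
qed

lemma select_run_small:
  assumes "length xs < 140" "k < length xs" "distinct xs"
  shows "val (select_run (Suc d) k xs) \<in> set xs \<and> rank (val (select_run (Suc d) k xs)) xs = k \<and>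
    ops (select_run (Suc d) k xs) \<le> 80000 * length xs \<and>
    peak (select_run (Suc d) k xs) \<le> 20 * length xs"
proof -
  let ?ys = "val (sort_run xs)"
  have "?ys ! k \<in> set xs" using nth_mem[of k ?ys] assms by simp
  moreover have "rank (?ys ! k) xs = k"
    using rank_sorted[OF sort_run_sorted[OF assms(3)], of k] assms
      length_filter_mset_cong[OF sort_run_mset[of xs], of "\<lambda>x. before x (?ys ! k)"] by simp
  moreover have "(length xs)\<^sup>2 \<le> 139 * length xs"
    using assms(1) by (simp add: power2_eq_square)
  ultimately show ?thesis
    using assms(1,2) sort_run_ops[of xs] sort_run_peak[of xs] by auto
qed

text \<open>At least half of the medians, hence at least n/10 of them, are not before
  \<open>p\<close>, and each accounts for three elements not before \<open>p\<close>, up to a total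
  loss of 2. So at most 7n/10 + 2 elements are before \<open>p\<close>; symmetrically for the
  elements behind it.\<close>

lemma pivot_balance:
  assumes "distinct xs" and "p \<in> set xs"
    and p: "rank p (val (medians_run xs)) = length (val (medians_run xs)) div 2"
    and pm: "p \<in> set (val (medians_run xs))"
  shows "10 * length (filter (\<lambda>x. before x p) xs) \<le> 7 * length xs + 20"
    and "10 * length (filter (\<lambda>x. before p x) xs) \<le> 7 * length xs + 20"
proof -
  let ?ms = "val (medians_run xs)"
  have n: "length (filter (\<lambda>x. \<not> Q x) ys) = length ys - length (filter Q ys)" for Q and ys :: "key list"
    using sum_length_filter_compl[of Q ys] by simp
  have "3 * length (filter (\<lambda>x. \<not> before x p) ?ms) \<le> length (filter (\<lambda>x. \<not> before x p) xs) + 2"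
  proof (rule medians_run_count[OF assms(1)])
    fix ys assume "distinct ys" "ys \<noteq> []" "\<not> before (val (median_run ys)) p"
    then have "length ys - length ys div 2 \<le> length (filter (\<lambda>x. \<not> before x p) ys)"
      by (rule median_run_upward) (blast intro: before_trans)
    then show "length ys \<le> 2 * length (filter (\<lambda>x. \<not> before x p) ys)" by linarith
  qed
  moreover have "3 * length (filter (\<lambda>x. \<not> before p x) ?ms) \<le> length (filter (\<lambda>x. \<not> before p x) xs) + 2"
  proof (rule medians_run_count[OF assms(1)])
    fix ys assume "distinct ys" "ys \<noteq> []" "\<not> before p (val (median_run ys))"
    then have "Suc (length ys div 2) \<le> length (filter (\<lambda>x. \<not> before p x) ys)"
      by (rule median_run_downward) (blast intro: before_trans)
    then show "length ys \<le> 2 * length (filter (\<lambda>x. \<not> before p x) ys)" by linarith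
  qed
  moreover have "length ?ms = rank p ?ms + 1 + length (filter (\<lambda>x. before p x) ?ms)"
    using length_filter_mset_cong[OF mset_pivot[OF medians_run_distinct[OF assms(1)] pm], of "\<lambda>_. True"]
    by simp
  moreover have "length (filter (\<lambda>x. before x p) xs) \<le> length xs"
    "length (filter (\<lambda>x. before p x) xs) \<le> length xs" by simp_all
  ultimately show "10 * length (filter (\<lambda>x. before x p) xs) \<le> 7 * length xs + 20"
    and "10 * length (filter (\<lambda>x. before p x) xs) \<le> 7 * length xs + 20"
    unfolding n p using medians_run_length(2)[of xs] by linarith+
qed

text \<open>The fractions 1/5 and 7/10 leave a tenth of the bound 80000 n for the linear work, and
  from length 140 on also for the additive constants. The premise on \<open>d\<close> makes the
  exhausted case \<open>d = 0\<close> vacuous and is inherited because all recursive calls are on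
  shorter lists.\<close>

lemma select_run_correct:
  "length xs \<le> d \<Longrightarrow> k < length xs \<Longrightarrow> distinct xs \<Longrightarrow>
    val (select_run d k xs) \<in> set xs \<and> rank (val (select_run d k xs)) xs = k \<and>
    ops (select_run d k xs) \<le> 80000 * length xs \<and> peak (select_run d k xs) \<le> 20 * length xs"
proof (induction d arbitrary: k xs)
  case (Suc d)
  show ?case
  proof (cases "length xs < 140")
    case True
    then show ?thesis by (intro select_run_small Suc.prems)
  next
    case False
    define n where "n = length xs"
    have n: "140 \<le> n" using False n_def by simp
    let ?ms = "val (medians_run xs)"
    define q where "q = length ?ms"
    have q: "5 * q \<le> n + 4" "n \<le> 5 * q" using medians_run_length[of xs] by (simp_all add: q_def n_def)
    let ?P = "select_run d (length ?ms div 2) ?ms"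
    define p where "p = val ?P"
    have P: "p \<in> set ?ms" "rank p ?ms = length ?ms div 2" "ops ?P \<le> 80000 * q" "peak ?P \<le> 20 * q"
      using Suc.IH[of ?ms "length ?ms div 2"] q n medians_run_distinct[OF Suc.prems(3)] Suc.prems(1)
      by (auto simp: q_def n_def p_def)
    have p: "p \<in> set xs" using P(1) medians_run_set by blast
    define lo where "lo = filter (\<lambda>x. before x p) xs"
    define hi where "hi = filter (\<lambda>x. before p x) xs"
    have lohi: "n = length lo + 1 + length hi"
      using length_filter_pivot[OF Suc.prems(3) p, of "\<lambda>_. True"] by (simp add: lo_def hi_def n_def)
    have bal: "10 * length lo \<le> 7 * n + 20" "10 * length hi \<le> 7 * n + 20"
      using pivot_balance[OF Suc.prems(3) p P(2,1)] by (simp_all add: lo_def hi_def n_def)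
    have dist: "distinct lo" "distinct hi" using Suc.prems(3) by (simp_all add: lo_def hi_def)
    \<comment> \<open>Converts a rank within \<open>lo\<close> or \<open>hi\<close>, which is what
      the induction hypothesis delivers, into a rank within \<open>xs\<close>.\<close>
    have rank_split: "rank v xs = rank v lo + (if before p v then 1 else 0) + rank v hi" for v
      using length_filter_pivot[OF Suc.prems(3) p, of "\<lambda>x. before x v"] by (simp add: lo_def hi_def)
    define R where "R = (if k < length lo then select_run d k lo
        else if k = length lo then step p else select_run d (k - length lo - 1) hi)"
    \<comment> \<open>The bounds are 80000 and 20 times the maximal length 7n/10 + 2 of either
      part.\<close>
    have R: "val R \<in> set xs \<and> rank (val R) xs = k \<and> ops R \<le> 56000 * n + 160000 \<and> peak R \<le> 14 * n + 40"
    proof -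
      consider "k < length lo" | "k = length lo" | "length lo < k" by linarith
      then show ?thesis
      proof cases
        case 1
        have H: "val R \<in> set lo" "rank (val R) lo = k" "ops R \<le>
            80000 * length lo" "peak R \<le> 20 * length lo"
          using Suc.IH[of lo k] 1 dist lohi Suc.prems(1) by (auto simp: R_def n_def)
        then have "before (val R) p" by (simp add: lo_def)
        then have "\<not> before p (val R)" by (rule before_asym)
        moreover from this have "rank (val R) hi = 0"
          unfolding hi_def length_0_conv filter_empty_conv by (auto intro: before_trans)
        moreover have "val R \<in> set xs" using H(1) by (simp add: lo_def)
        ultimately show ?thesis using H(2-) bal rank_split[of "val R"] by simp
      next
        case 2
        have "rank p lo = length lo" "rank p hi = 0"
          by (auto simp: lo_def hi_def filter_empty_conv dest: before_asym)
        moreover have "R = step p" using 2 by (simp add: R_def)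
        ultimately show ?thesis using 2 rank_split[of p] p by simp
      next
        case 3
        have H: "val R \<in> set hi" "rank (val R) hi = k - length lo - 1" "ops R \<le> 80000 * length hi"
            "peak R \<le> 20 * length hi"
          using Suc.IH[of hi "k - length lo - 1"] 3 dist lohi Suc.prems(1,2) by (auto simp: R_def n_def)
        then have b: "before p (val R)" by (simp add: hi_def)
        then have "filter (\<lambda>x. before x (val R)) lo = lo"
          by (auto simp: lo_def filter_id_conv simp del: filter_filter intro: before_trans)
        moreover have "val R \<in> set xs" using H(1) by (simp add: hi_def)
        ultimately show ?thesis using H(2-) b bal 3 rank_split[of "val R"] by simp
      qed
    qed
    from R have Rb: "ops R \<le> 56000 * n + 160000" "peak R \<le> 14 * n + 40" by auto
    let ?L = "filter_run (\<lambda>x. before_run x p) xs" and ?H = "filter_run (\<lambda>x. before_run p x) xs"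
    have filter_ops: "ops ?L \<le> 4 * n + 1" "ops ?H \<le> 4 * n + 1"
      unfolding n_def by (intro filter_run_ops before_run_ops)+
    have filter_peak: "peak ?L \<le> 5 * n + 3" "peak ?H \<le> 5 * n + 3"
      unfolding n_def by (intro filter_run_peak before_run_peak)+
    have val: "val (select_run (Suc d) k xs) = val R"
      by (simp only: select_run.simps(2) False if_False bind_run_simps filter_run_val before_run_simps
          flip: p_def lo_def hi_def R_def)
    have "ops (select_run (Suc d) k xs) = ops (medians_run xs) + (ops ?P + (ops ?L + (ops ?H + ops R)))"
      by (simp only: select_run.simps(2) False if_False bind_run_simps filter_run_val before_run_simps
          flip: p_def lo_def hi_def R_def)
    also have "\<dots> \<le> 80000 * n"
      using medians_run_ops[of xs, folded q_def] P(3) Rb q n filter_ops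
      by linarith
    finally have ops: "ops (select_run (Suc d) k xs) \<le> 80000 * n" .
    \<comment> \<open>Medians, pivot and both parts stay allocated during the last recursive call.
      Since \<open>lo\<close> and \<open>hi\<close> together have n - 1 keys, they take fewer than
      2n cells, and the shrinking factor 7/10 makes the nested allocations a geometric
      series.\<close>
    have "peak (select_run (Suc d) k xs) = max (peak (medians_run xs)) (2 * q + max (peak ?P)
        (2 + max (peak ?L) (2 * length lo + max (peak ?H) (2 * length hi + peak R))))"
      by (simp only: select_run.simps(2) False if_False bind_run_simps filter_run_val before_run_simps
          cells_key cells_scalar_list q_def flip: p_def lo_def hi_def R_def)
    also have "\<dots> \<le> 20 * n"
      unfolding nat_add_max_right max.bounded_iff
      using medians_run_peak[of xs, folded q_def] P(4) Rb q n lohi filter_peak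
      by (intro conjI) linarith+
    finally have "peak (select_run (Suc d) k xs) \<le> 20 * n" .
    then show ?thesis using val ops R by (simp add: n_def)
  qed
qed simp

section \<open>Runs on vectors\<close>

lemma map_run_val [simp]: "val (map_run f xs) = map (\<lambda>x. val (f x)) xs"
  by (induction xs) auto

lemma map_run_ops: "(\<And>x. ops (f x) \<le> k) \<Longrightarrow> ops (map_run f xs) \<le> (k + 1) * length xs + 1"
proof (induction xs)
  case (Cons x xs)
  from Cons(1)[OF Cons(2)] Cons(2)[of x] show ?case by simp
qed simp

lemma map_run_cells:
  "(\<And>x. cells (val (f x)) \<le> c) \<Longrightarrow> cells (map (\<lambda>x. val (f x)) xs) \<le> c * length xs"
proof (induction xs)
  case (Cons x xs)
  from Cons(1)[OF Cons(2)] Cons(2)[of x] show ?case by simp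
qed simp

lemma map_run_peak:
  assumes "\<And>x. cells (val (f x)) \<le> c" "\<And>x. peak (f x) \<le> p"
  shows "peak (map_run f xs) \<le> 3 * c * length xs + p"
proof (induction xs)
  case (Cons x xs)
  then show ?case using assms[of x] map_run_cells[of f c xs, OF assms(1)] by simp
qed simp

text \<open>A specification triple: the value is exact, the two costs are upper bounds. This lets
  the cost of a program be assembled along its text.\<close>

definition runs :: "'a::storable run \<Rightarrow> 'a \<Rightarrow> nat \<Rightarrow> nat \<Rightarrow> bool" where
  "runs r v t p \<longleftrightarrow> val r = v \<and> ops r \<le> t \<and> peak r \<le> p"

lemma runs_weaken: "runs r v t p \<Longrightarrow> v = v' \<Longrightarrow> t \<le> t' \<Longrightarrow> p \<le> p' \<Longrightarrow> runs r v' t' p'"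
  by (auto simp: runs_def)

lemma runs_step: "runs (step x) x 1 (cells x)"
  by (simp add: runs_def)

text \<open>The true peak is a maximum; the sum is cruder but keeps all bounds linear expressions
  free of \<open>max\<close>, at the price of constants only.\<close>

lemma runs_bind:
  "runs r v t p \<Longrightarrow> runs (f v) v' t' p' \<Longrightarrow> runs (bind_run r f) v' (t + t') (p + (cells v + p'))"
  by (auto simp: runs_def)

lemma runs_map:
  assumes "\<And>x. ops (f x) \<le> k" "\<And>x. cells (val (f x)) \<le> c" "\<And>x. peak (f x) \<le> p"
    and "map (\<lambda>x. val (f x)) xs = ys" "length xs = n"
  shows "runs (map_run f xs) ys ((k + 1) * n + 1) (3 * c * n + p)"
  using assms(4,5) map_run_ops[of f k xs, OF assms(1)] map_run_peak[of f c p xs, OF assms(2,3)]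
  by (auto simp: runs_def)

text \<open>A simulation principle: \<open>z\<close> is the abstract state, \<open>h z\<close> its
  representation in memory, \<open>I\<close> an invariant. As a loop overwrites its state, the
  storage bound is independent of \<open>k\<close>; this is what keeps the working storage linear
  for any number of iterations.\<close>

lemma runs_loop:
  assumes step: "\<And>z. I z \<Longrightarrow> runs (f (h z)) (h (g z)) t p \<and> I (g z) \<and> cells (h z) \<le> c"
    and "I z"
  shows "runs (loop_run k f (h z)) (h ((g ^^ k) z)) (k * t + 1) (c + p)"
  using \<open>I z\<close>
proof (induction k arbitrary: z)
  case 0
  then show ?case using step[of z] by (auto simp: runs_def)
next
  case (Suc k)
  have r: "runs (f (h z)) (h (g z)) t p" "I (g z)" "cells (h z) \<le> c" using step[OF Suc.prems] by auto
  then show ?case using Suc.IH[OF r(2)]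
    by (auto simp: runs_def Let_def funpow_swap1)
qed

lemma list_of_vec_eqI:
  "length xs = dim_vec v \<Longrightarrow> (\<And>i. i < dim_vec v \<Longrightarrow> xs ! i = v $ i) \<Longrightarrow> xs = list_of_vec v"
  by (rule nth_equalityI) auto

lemma runs_add:
  assumes "v \<in> carrier_vec n" "w \<in> carrier_vec n"
  shows "runs (add_run (list_of_vec v) (list_of_vec w)) (list_of_vec (v + w)) (2 * n + 1) (3 * n + 1)"
proof -
  have "runs (add_run (list_of_vec v) (list_of_vec w)) (list_of_vec (v + w))
      ((1 + 1) * n + 1) (3 * 1 * n + 1)"
    unfolding add_run_def using assms
    by (intro runs_map) (auto split: prod.splits intro!: list_of_vec_eqI)
  then show ?thesis by (simp add: mult_2)
qed

lemma runs_sub: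
  assumes "v \<in> carrier_vec n" "w \<in> carrier_vec n"
  shows "runs (sub_run (list_of_vec v) (list_of_vec w)) (list_of_vec (v - w)) (2 * n + 1) (3 * n + 1)"
proof -
  have "runs (sub_run (list_of_vec v) (list_of_vec w)) (list_of_vec (v - w))
      ((1 + 1) * n + 1) (3 * 1 * n + 1)"
    unfolding sub_run_def using assms
    by (intro runs_map) (auto split: prod.splits intro!: list_of_vec_eqI)
  then show ?thesis by (simp add: mult_2)
qed

lemma runs_scale:
  assumes "v \<in> carrier_vec n"
  shows "runs (scale_run c (list_of_vec v)) (list_of_vec (c \<cdot>\<^sub>v v)) (2 * n + 1) (3 * n + 1)"
proof -
  have "runs (scale_run c (list_of_vec v)) (list_of_vec (c \<cdot>\<^sub>v v)) ((1 + 1) * n + 1) (3 * 1 * n + 1)"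
    unfolding scale_run_def using assms
    by (intro runs_map) (auto intro!: list_of_vec_eqI)
  then show ?thesis by (simp add: mult_2)
qed

definition mask_vec :: "nat set \<Rightarrow> complex vec \<Rightarrow> complex vec" where
  "mask_vec T x = vec (dim_vec x) (\<lambda>i. if i \<in> T then x $ i else 0)"

lemma mask_vec_dim [simp]: "dim_vec (mask_vec T x) = dim_vec x"
  and mask_vec_carrier [simp]: "x \<in> carrier_vec n \<Longrightarrow> mask_vec T x \<in> carrier_vec n"
  and mask_vec_index [simp]: "i < dim_vec x \<Longrightarrow> mask_vec T x $ i = (if i \<in> T then x $ i else 0)"
  by (auto simp: mask_vec_def)

definition flags :: "nat \<Rightarrow> nat set \<Rightarrow> bool list" where
  "flags n T = map (\<lambda>i. i \<in> T) [0..<n]"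

lemma runs_mask:
  assumes "v \<in> carrier_vec n"
  shows "runs (mask_run (flags n T) (list_of_vec v)) (list_of_vec (mask_vec T v))
      (2 * n + 1) (3 * n + 1)"
proof -
  have "runs (mask_run (flags n T) (list_of_vec v)) (list_of_vec (mask_vec T v))
      ((1 + 1) * n + 1) (3 * 1 * n + 1)"
    unfolding mask_run_def using assms
    by (intro runs_map) (auto split: prod.splits simp: flags_def intro!: list_of_vec_eqI)
  then show ?thesis by (simp add: mult_2)
qed

lemma dot_run_val:
  "length xs = length ys \<Longrightarrow> val (dot_run xs ys) = (\<Sum>i<length xs. xs ! i * cnj (ys ! i))"
  by (induction xs ys rule: dot_run.induct) (auto simp del: sum.lessThan_Suc simp:
    sum.lessThan_Suc_shift)

lemma dot_run_ops: "ops (dot_run xs ys) \<le> 4 * length xs + 1"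
  by (induction xs ys rule: dot_run.induct) auto

lemma dot_run_peak: "peak (dot_run xs ys) \<le> 2 * length xs + 4"
  by (induction xs ys rule: dot_run.induct) auto

lemma runs_dot:
  assumes "v \<in> carrier_vec n" "w \<in> carrier_vec n"
  shows "runs (dot_run (list_of_vec v) (list_of_vec w)) (v \<bullet>c w) (4 * n + 1) (2 * n + 4)"
  using assms dot_run_ops[of "list_of_vec v" "list_of_vec w"] dot_run_peak[of "list_of_vec v"
    "list_of_vec w"]
  by (auto simp: runs_def dot_run_val scalar_prod_def lessThan_atLeast0 intro!: sum.cong)

lemma runs_mult:
  assumes "M \<in> carrier_mat k n" "w v \<le> L"
  shows "runs (mult_run M w (list_of_vec v)) (list_of_vec (M *\<^sub>v v)) L k"
  using assms by (simp add: runs_def mult_run_def vec_list)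

section \<open>Ranks of entries and the cost of keeping the largest ones\<close>

definition entry_rank :: "complex vec \<Rightarrow> nat \<Rightarrow> nat" where
  "entry_rank x i = card {j. j < dim_vec x \<and> ranks_before x j i}"

lemma entry_rank_less: "i < dim_vec x \<Longrightarrow> entry_rank x i < dim_vec x"
  unfolding entry_rank_def
  by (rule order_less_le_trans[OF psubset_card_mono[of "{..<dim_vec x}"]])
    (auto simp: ranks_before_def)

lemma largest_eq: "largest r x = vec (dim_vec x) (\<lambda>i. if entry_rank x i < r then x $ i else 0)"
  by (simp add: largest_def entry_rank_def)

lemma largest_dim [simp]: "dim_vec (largest r x) = dim_vec x"
  and largest_carrier [simp]: "x \<in> carrier_vec n \<Longrightarrow> largest r x \<in> carrier_vec n"
  and largest_index [simp]:
    "i < dim_vec x \<Longrightarrow> largest r x $ i = (if entry_rank x i < r then x $ i else 0)"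
  by (auto simp: largest_eq)

lemma largest_id: "dim_vec x \<le> r \<Longrightarrow> largest r x = x"
  using entry_rank_less[of _ x] by (intro eq_vecI) fastforce+

definition key :: "nat \<Rightarrow> complex \<Rightarrow> key" where
  "key i y = (Re y * Re y + Im y * Im y, i)"

text \<open>Squaring is strictly increasing on magnitudes, so squared magnitudes, which need no
  square root, rank the entries in the same way, ties included.\<close>

lemma before_key: "before (key j (x $ j)) (key i (x $ i)) \<longleftrightarrow> ranks_before x j i"
proof -
  have eq: "Re y * Re y + Im y * Im y = (cmod y)\<^sup>2" for y
    by (metis cmod_power2 power2_eq_square)
  show ?thesis
    by (simp add: before_def ranks_before_def key_def eq power2_eq_iff_nonneg power_mono_iff
        flip: not_le)
qed

lemma rank_strict_mono:
  assumes "distinct xs" "a \<in> set xs" "before a b"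
  shows "rank a xs < rank b xs"
proof -
  have "{x \<in> set xs. before x a} \<subset> {x \<in> set xs. before x b}"
    using assms(2) before_trans[OF _ assms(3)] assms(3) before_irrefl[of a] by blast
  then show ?thesis
    using assms(1) by (simp add: distinct_length_filter Int_def psubset_card_mono conj_commute)
qed

text \<open>Distinct keys have distinct ranks, so the key \<open>t\<close> of rank
  \<open>r - 1\<close> is the last one to be kept, and the entries to erase are exactly those behind
  it. A vector with at most \<open>r\<close> entries is returned without any selection.\<close>

lemma runs_largest:
  assumes y: "y \<in> carrier_vec n" and r: "0 < r"
  shows "runs (largest_run r (list_of_vec y)) (list_of_vec (largest r y)) (80011 * n + 2) (31 * n + 10)"
proof (cases "n \<le> r")
  case True
  then show ?thesis using y by (simp add: largest_run_def runs_def largest_id)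
next
  case False
  define ks where "ks = map (\<lambda>i. key i (y $ i)) [0..<n]"
  have ks: "length ks = n" "\<And>i. i < n \<Longrightarrow> ks ! i = key i (y $ i)" "distinct ks"
    by (auto simp: ks_def distinct_map key_def intro!: inj_onI)
  have rank: "rank (ks ! i) ks = entry_rank y i" if "i < n" for i
  proof -
    have "{j. j < length ks \<and> before (ks ! j) (ks ! i)} = {j. j < dim_vec y \<and> ranks_before y j i}"
      using that y by (auto simp: ks before_key)
    then show ?thesis by (simp add: length_filter_conv_card entry_rank_def)
  qed
  let ?S = "select_run n (r - 1) ks"
  define t where "t = val ?S"
  have S: "t \<in> set ks" "rank t ks = r - 1" "ops ?S \<le> 80000 * n" "peak ?S \<le> 20 * n"
    using select_run_correct[of ks n "r - 1"] ks False r by (auto simp: t_def)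
  have small: "before t (ks ! i) \<longleftrightarrow> \<not> entry_rank y i < r" if "i < n" for i
  proof
    assume "before t (ks ! i)"
    from rank_strict_mono[OF ks(3) S(1) this] show "\<not> entry_rank y i < r"
      using rank[OF that] S(2) by simp
  next
    assume *: "\<not> entry_rank y i < r"
    then have "\<not> before (ks ! i) t" "ks ! i \<noteq> t"
      using rank_strict_mono[OF ks(3), of "ks ! i" t] rank[OF that] S(2) that ks(1) r by auto
    then show "before t (ks ! i)" using before_total by blast
  qed
  have k: "ops (key_run z) = 4" "peak (key_run z) = 5" "val (key_run z) = key (fst z) (snd z)" for z
    by (auto simp: key_run_def key_def split: prod.splits)
  have b: "ops (bind_run (before_run t k) (\<lambda>b. if b then step 0 else step y)) \<le> 4"
      "peak (bind_run (before_run t k) (\<lambda>b. if b then step 0 else step y)) \<le> 3"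
    for k and y :: complex using before_run_ops[of t k] before_run_peak[of t k] by auto
  have "\<not> length (list_of_vec y) \<le> r" using y False by simp
  have "runs (largest_run r (list_of_vec y)) (list_of_vec (largest r y))
    ((4 + 1) * n + 1 + (80000 * n + ((4 + 1) * n + 1)))
    (3 * 2 * n + 5 + (cells ks + (20 * n + (cells t + (3 * 1 * n + 3)))))"
    unfolding largest_run_def if_not_P[OF \<open>\<not> length (list_of_vec y) \<le> r\<close>]
  proof (intro runs_bind runs_map)
    show "map (\<lambda>x. val (key_run x)) (zip [0..<length (list_of_vec y)] (list_of_vec y)) = ks"
      using y by (intro nth_equalityI) (auto simp: ks k)
    show "runs (select_run (length (list_of_vec y)) (r - 1) ks) t (80000 * n) (20 * n)"
      using S y by (simp add: runs_def t_def)
    show "map (\<lambda>x. val (case x of (y, k) \<Rightarrow> before_run t k \<bind> (\<lambda>b. if b then step 0 else step y)))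
      (zip (list_of_vec y) ks) = list_of_vec (largest r y)"
      using y by (intro list_of_vec_eqI) (auto simp: ks(1) small)
  qed (use y b k ks in \<open>auto split: prod.splits simp: key_def\<close>)
  then show ?thesis by (rule runs_weaken) (use False ks(1) in auto)
qed

section \<open>Simulation of CoSaMP by its implementation\<close>

lemma card_below_less:
  fixes i :: nat
  assumes "finite T" "i \<in> T"
  shows "card {a\<in>T. a < i} < card T"
proof (rule psubset_card_mono)
  have "i \<notin> {a\<in>T. a < i}" by simp
  then show "{a\<in>T. a < i} \<subset> T" using assms(2) by blast
qed fact

text \<open>The index maps behind \<open>restrict_vec\<close> and \<open>extend_vec\<close>, picking
  the k-th element and counting the elements below, are mutually inverse.\<close>

lemma bij_betw_pick:
  assumes "finite T"
  shows "bij_betw (pick T) {..<card T} T"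
proof (rule bij_betw_byWitness[where f' = "\<lambda>i. card {a\<in>T. a < i}"])
  show "\<forall>k\<in>{..<card T}. card {a\<in>T. a < pick T k} = k" by (simp add: card_pick_le)
  show "\<forall>i\<in>T. pick T (card {a\<in>T. a < i}) = i" by (simp add: pick_card_in_set)
  show "pick T ` {..<card T} \<subseteq> T" using pick_in_set_le by blast
  show "(\<lambda>i. card {a\<in>T. a < i}) ` T \<subseteq> {..<card T}" using card_below_less[OF assms] by blast
qed

lemma sum_pick: "finite T \<Longrightarrow> (\<Sum>k<card T. g (pick T k)) = (\<Sum>i\<in>T. g i)"
  by (rule sum.reindex_bij_betw[OF bij_betw_pick])

lemma extend_vec_dim [simp]: "dim_vec (extend_vec N T z) = N"
  and extend_vec_carrier [simp]: "extend_vec N T z \<in> carrier_vec N"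
  and extend_vec_index: "i < N \<Longrightarrow> extend_vec N T z $ i = (if i \<in> T then z $ card {j\<in>T. j < i} else 0)"
  by (auto simp: extend_vec_def)

lemma restrict_vec_dim [simp]: "dim_vec (restrict_vec T x) = card T"
  and restrict_vec_carrier [simp]: "restrict_vec T x \<in> carrier_vec (card T)"
  and restrict_vec_index [simp]: "k < card T \<Longrightarrow> restrict_vec T x $ k = x $ pick T k"
  by (auto simp: restrict_vec_def)

lemma mat_adjoint_carrier [simp]:
  "(A :: complex mat) \<in> carrier_mat m n \<Longrightarrow> mat_adjoint A \<in> carrier_mat n m"
  by (auto simp: mat_adjoint_def mat_of_rows_def)

lemma mat_adjoint_dim [simp]:
  "dim_row (mat_adjoint (A :: complex mat)) = dim_col A" "dim_col (mat_adjoint A) = dim_row A"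
  by (simp_all add: mat_adjoint_def mat_of_rows_def)

lemma mat_adjoint_index [simp]:
  "(A :: complex mat) \<in> carrier_mat m n \<Longrightarrow> i < n \<Longrightarrow> j < m \<Longrightarrow> mat_adjoint A $$ (i, j) = cnj (A $$ (j, i))"
  by (auto simp: mat_adjoint_def mat_of_rows_def)

context
  fixes N :: nat and T :: "nat set"
  assumes T: "T \<subseteq> {..<N}"
begin

lemma finite_index_set: "finite T"
  using T finite_subset by blast

lemma pick_index_set: "k < card T \<Longrightarrow> pick T k \<in> T \<and> pick T k < N \<and> card {j\<in>T. j < pick T k} = k"
  using pick_in_set_le[of k T] card_pick_le[of k T] T by blast

lemma extend_vec_add:
  "z \<in> carrier_vec (card T) \<Longrightarrow> z' \<in> carrier_vec (card T) \<Longrightarrow>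
    extend_vec N T (z + z') = extend_vec N T z + extend_vec N T z'"
  using card_below_less[OF finite_index_set] by (intro eq_vecI) (auto simp: extend_vec_index)

lemma extend_vec_minus:
  "z \<in> carrier_vec (card T) \<Longrightarrow> z' \<in> carrier_vec (card T) \<Longrightarrow>
    extend_vec N T (z - z') = extend_vec N T z - extend_vec N T z'"
  using card_below_less[OF finite_index_set] by (intro eq_vecI) (auto simp: extend_vec_index)

lemma extend_vec_smult:
  "z \<in> carrier_vec (card T) \<Longrightarrow> extend_vec N T (c \<cdot>\<^sub>v z) = c \<cdot>\<^sub>v extend_vec N T z"
  using card_below_less[OF finite_index_set] by (intro eq_vecI) (auto simp: extend_vec_index)

lemma extend_restrict_vec: "x \<in> carrier_vec N \<Longrightarrow> extend_vec N T (restrict_vec T x) = mask_vec T x"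
  using card_below_less[OF finite_index_set] T
  by (intro eq_vecI) (auto simp: extend_vec_index pick_card_in_set)

text \<open>The premise removes the padded positions. The instances are inner products and the
  entries of matrix-vector products.\<close>

lemma sum_extend_vec:
  assumes "\<And>j. g j 0 = 0"
  shows "(\<Sum>j<N. g j (extend_vec N T z $ j)) = (\<Sum>k<card T. g (pick T k) (z $ k))"
proof -
  have "(\<Sum>j<N. g j (extend_vec N T z $ j)) = (\<Sum>j\<in>T. g j (extend_vec N T z $ j))"
    using T assms by (intro sum.mono_neutral_right) (auto simp: extend_vec_index)
  also have "\<dots> = (\<Sum>k<card T. g (pick T k) (extend_vec N T z $ pick T k))"
    by (rule sum_pick[OF finite_index_set, symmetric])
  also have "\<dots> = (\<Sum>k<card T. g (pick T k) (z $ k))"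
    using pick_index_set by (intro sum.cong) (auto simp: extend_vec_index)
  finally show ?thesis .
qed

text \<open>Padding is isometric. Hence the inner products that conjugate gradient computes on
  vectors of length \<open>N\<close> are the ones of its specification on \<open>T\<close>, and so
  are its step lengths.\<close>

lemma extend_vec_cscalar_prod:
  assumes "z \<in> carrier_vec (card T)" "z' \<in> carrier_vec (card T)"
  shows "extend_vec N T z \<bullet>c extend_vec N T z' = z \<bullet>c z'"
proof -
  have "extend_vec N T z \<bullet>c extend_vec N T z' =
      (\<Sum>j<N. extend_vec N T z $ j * cnj (extend_vec N T z' $ j))"
    by (simp add: scalar_prod_def lessThan_atLeast0)
  also have "\<dots> = (\<Sum>k<card T. z $ k * cnj (extend_vec N T z' $ pick T k))"
    by (rule sum_extend_vec[where g = "\<lambda>j t. t * cnj (extend_vec N T z' $ j)"]) simp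
  also have "\<dots> = (\<Sum>k<card T. z $ k * cnj (z' $ k))"
    using pick_index_set by (intro sum.cong) (auto simp: extend_vec_index)
  finally show ?thesis using assms by (simp add: scalar_prod_def lessThan_atLeast0)
qed

context
  fixes \<Phi> :: "complex mat" and m :: nat
  assumes \<Phi>: "\<Phi> \<in> carrier_mat m N"
begin

lemma columns_carrier: "columns \<Phi> T \<in> carrier_mat m (card T)"
proof -
  have "{j. j < N \<and> j \<in> T} = T" using T by auto
  then show ?thesis using carrier_matD[OF \<Phi>] unfolding carrier_mat_def columns_def
    by (simp add: dim_submatrix)
qed

lemma columns_index: "i < m \<Longrightarrow> k < card T \<Longrightarrow> columns \<Phi> T $$ (i, k) = \<Phi> $$ (i, pick T k)"
proof -
  assume "i < m" "k < card T"
  moreover have "{j. j < N \<and> j \<in> T} = T" using T by auto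
  ultimately show ?thesis using \<Phi> by (simp add: columns_def submatrix_index pick_UNIV)
qed

text \<open>Padding intertwines the submatrix with the full matrix. This is what allows the
  implementation to call only the given multiplication subroutines.\<close>

lemma columns_mult_vec:
  assumes "z \<in> carrier_vec (card T)"
  shows "columns \<Phi> T *\<^sub>v z = \<Phi> *\<^sub>v extend_vec N T z"
proof (rule eq_vecI)
  fix i assume "i < dim_vec (\<Phi> *\<^sub>v extend_vec N T z)"
  then have i: "i < m" using \<Phi> by simp
  have "(\<Phi> *\<^sub>v extend_vec N T z) $ i = (\<Sum>j<N. \<Phi> $$ (i, j) * extend_vec N T z $ j)"
    using i \<Phi> by (simp add: scalar_prod_def lessThan_atLeast0)
  also have "\<dots> = (\<Sum>k<card T. \<Phi> $$ (i, pick T k) * z $ k)"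
    by (rule sum_extend_vec[where g = "\<lambda>j t. \<Phi> $$ (i, j) * t"]) simp
  also have "\<dots> = (columns \<Phi> T *\<^sub>v z) $ i"
    using i columns_carrier assms by (simp add: scalar_prod_def lessThan_atLeast0 columns_index)
  finally show "(columns \<Phi> T *\<^sub>v z) $ i = (\<Phi> *\<^sub>v extend_vec N T z) $ i" by simp
qed (use columns_carrier \<Phi> in auto)

lemma columns_adjoint_mult_vec:
  assumes "v \<in> carrier_vec m"
  shows "mat_adjoint (columns \<Phi> T) *\<^sub>v v = restrict_vec T (mat_adjoint \<Phi> *\<^sub>v v)"
proof (rule eq_vecI)
  note A = mat_adjoint_carrier[OF columns_carrier] mat_adjoint_carrier[OF \<Phi>]
  fix k assume "k < dim_vec (restrict_vec T (mat_adjoint \<Phi> *\<^sub>v v))"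
  then have "k < card T" by simp
  then show "(mat_adjoint (columns \<Phi> T) *\<^sub>v v) $ k = restrict_vec T (mat_adjoint \<Phi> *\<^sub>v v) $ k"
    using A \<Phi> columns_carrier pick_index_set[of k] assms
    by (auto simp: scalar_prod_def columns_index intro!: sum.cong)
qed (use mat_adjoint_carrier[OF columns_carrier] in auto)

lemma extend_adjoint:
  assumes "v \<in> carrier_vec m"
  shows "extend_vec N T (mat_adjoint (columns \<Phi> T) *\<^sub>v v) = mask_vec T (mat_adjoint \<Phi> *\<^sub>v v)"
proof -
  have "mat_adjoint \<Phi> *\<^sub>v v \<in> carrier_vec N"
    using mat_adjoint_carrier[OF \<Phi>] assms by auto
  then show ?thesis using assms by (simp add: columns_adjoint_mult_vec extend_restrict_vec)
qed

private abbreviation (input) A where "A \<equiv> columns \<Phi> T"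
private abbreviation (input) E where "E \<equiv> extend_vec N T"
private abbreviation (input) gram where "gram \<equiv> mat_adjoint A * A"

lemma gram_carrier: "gram \<in> carrier_mat (card T) (card T)"
  using columns_carrier mat_adjoint_carrier by auto

lemma gram_mult_vec:
  assumes "z \<in> carrier_vec (card T)"
  shows "gram *\<^sub>v z = mat_adjoint A *\<^sub>v (A *\<^sub>v z)"
  using mat_adjoint_carrier[OF columns_carrier] columns_carrier assms by (rule assoc_mult_mat_vec)

text \<open>In padded form the Gram matrix of the submatrix is one multiplication by
  \<open>\<Phi>\<close>, one by its adjoint and a mask, which is what \<open>gram_run\<close>
  does.\<close>

lemma extend_gram:
  assumes "z \<in> carrier_vec (card T)"
  shows "E (gram *\<^sub>v z) = mask_vec T (mat_adjoint \<Phi> *\<^sub>v (\<Phi> *\<^sub>v E z))"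
proof -
  have "A *\<^sub>v z \<in> carrier_vec m" using columns_carrier assms by auto
  then show ?thesis using assms by (simp add: gram_mult_vec extend_adjoint columns_mult_vec)
qed

section \<open>Cost of the least-squares solvers\<close>

context
  fixes w w' :: "complex vec \<Rightarrow> nat" and L :: nat
  assumes w: "\<And>z. z \<in> carrier_vec N \<Longrightarrow> w z \<le> L" and w': "\<And>z. z \<in> carrier_vec m \<Longrightarrow> w' z \<le> L"
    and mN: "m \<le> N"
begin

private abbreviation (input) "mul \<equiv> mult_run \<Phi> w"
private abbreviation (input) "mul' \<equiv> mult_run (mat_adjoint \<Phi>) w'"

lemma runs_mul: "x \<in> carrier_vec N \<Longrightarrow> runs (mul (list_of_vec x)) (list_of_vec (\<Phi> *\<^sub>v x)) L m"
  using \<Phi> w by (intro runs_mult) auto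

lemma runs_mul': "v \<in> carrier_vec m \<Longrightarrow> runs (mul' (list_of_vec v))
    (list_of_vec (mat_adjoint \<Phi> *\<^sub>v v)) L N"
  using \<Phi> w' by (intro runs_mult) auto

lemma runs_rhs:
  assumes u: "u \<in> carrier_vec m"
  shows "runs (rhs_run mul' (flags N T) (list_of_vec u)) (list_of_vec (E (mat_adjoint A *\<^sub>v u)))
    (L + 2 * N + 1) (5 * N + 1)"
proof (rule runs_weaken)
  have c: "mat_adjoint \<Phi> *\<^sub>v u \<in> carrier_vec N" using mat_adjoint_carrier[OF \<Phi>] u by auto
  show "runs (rhs_run mul' (flags N T) (list_of_vec u))
     (list_of_vec (mask_vec T (mat_adjoint \<Phi> *\<^sub>v u))) (L + (2 * N + 1))
     (N + (cells (list_of_vec (mat_adjoint \<Phi> *\<^sub>v u)) + (3 * N + 1)))"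
    unfolding rhs_run_def by (rule runs_mul'[OF u, THEN runs_bind], rule runs_mask[OF c])
qed (use \<Phi> in \<open>simp_all add: extend_adjoint[OF u]\<close>)

lemma runs_gram:
  assumes z: "z \<in> carrier_vec (card T)"
  shows "runs (gram_run mul mul' (flags N T) (list_of_vec (E z))) (list_of_vec (E (gram *\<^sub>v z)))
    (2 * L + 2 * N + 1) (7 * N + 1)"
proof (rule runs_weaken)
  let ?p = "\<Phi> *\<^sub>v E z"
  have p: "?p \<in> carrier_vec m" using \<Phi> by auto
  have c: "mat_adjoint \<Phi> *\<^sub>v ?p \<in> carrier_vec N" using mat_adjoint_carrier[OF \<Phi>] p by auto
  show "runs (gram_run mul mul' (flags N T) (list_of_vec (E z)))
     (list_of_vec (mask_vec T (mat_adjoint \<Phi> *\<^sub>v ?p))) (L + (L + (2 * N + 1)))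
     (m + (cells (list_of_vec ?p) + (N + (cells (list_of_vec (mat_adjoint \<Phi> *\<^sub>v ?p)) + (3 * N + 1)))))"
    unfolding gram_run_def
    by (rule runs_mul[THEN runs_bind], simp, rule runs_mul'[OF p, THEN runs_bind], rule runs_mask[OF c])
qed (use \<Phi> mN in \<open>simp_all add: extend_gram[OF z]\<close>)

lemma runs_richardson:
  assumes u: "u \<in> carrier_vec m" and z0: "z0 \<in> carrier_vec (card T)"
  shows "runs (richardson_run 3 mul mul' (flags N T) (list_of_vec u) (list_of_vec (E z0)))
    (list_of_vec (E (richardson 3 A u z0))) (7 * L + 20 * N + 20) (40 * N + 40)"
proof (rule runs_weaken)
  define h where "h = mat_adjoint A *\<^sub>v u"
  have h: "h \<in> carrier_vec (card T)"
    using mat_adjoint_carrier[OF columns_carrier] u by (auto simp: h_def)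
  let ?g = "\<lambda>z. h - (gram - 1\<^sub>m (dim_col A)) *\<^sub>v z"
  \<comment> \<open>The specification multiplies by the Gram matrix minus the identity, the program
    subtracts \<open>z\<close> from the product.\<close>
  have g: "?g z = h - (gram *\<^sub>v z - z)" if "z \<in> carrier_vec (card T)" for z :: "complex vec"
    using that gram_carrier columns_carrier
    by (subst minus_mult_distrib_mat_vec[where nr = "card T" and nc = "card T"]) auto
  have loop: "runs (loop_run 3 (\<lambda>z. do {
       g \<leftarrow> gram_run mul mul' (flags N T) z; d \<leftarrow> sub_run g z; sub_run (list_of_vec (E h)) d })
       (list_of_vec (E z0)))
     (list_of_vec (E ((?g ^^ 3) z0)))
     (3 * (2 * L + 2 * N + 1 + (2 * N + 1 + (2 * N + 1))) + 1)
     (N + (7 * N + 1 + (N + (3 * N + 1 + (N + (3 * N + 1))))))"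
  proof (rule runs_loop[where h = "\<lambda>z. list_of_vec (E z)" and I = "\<lambda>z. z \<in> carrier_vec (card T)"])
    fix z :: "complex vec" assume z: "z \<in> carrier_vec (card T)"
    have Gz: "gram *\<^sub>v z \<in> carrier_vec (card T)" using gram_carrier z by auto
    have sub: "runs (sub_run (list_of_vec (E x)) (list_of_vec v)) (list_of_vec (E x - v))
        (2 * N + 1) (3 * N + 1)"
      if "v \<in> carrier_vec N" for x v using that by (intro runs_sub) simp_all
    have "runs (do { g \<leftarrow> gram_run mul mul' (flags N T) (list_of_vec (E z));
        d \<leftarrow> sub_run g (list_of_vec (E z));
         sub_run (list_of_vec (E h)) d })
       (list_of_vec (E h - (E (gram *\<^sub>v z) - E z)))
       (2 * L + 2 * N + 1 + (2 * N + 1 + (2 * N + 1)))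
       (7 * N + 1 + (cells (list_of_vec (E (gram *\<^sub>v z))) +
         (3 * N + 1 + (cells (list_of_vec (E (gram *\<^sub>v z) - E z)) + (3 * N + 1)))))"
      by (rule runs_gram[OF z, THEN runs_bind], rule sub[THEN runs_bind], simp, rule sub) simp
    moreover have "E (?g z) = E h - (E (gram *\<^sub>v z) - E z)"
      using z h Gz by (simp add: g extend_vec_minus)
    ultimately show "runs (do { g \<leftarrow> gram_run mul mul' (flags N T) (list_of_vec (E z));
          d \<leftarrow> sub_run g (list_of_vec (E z)); sub_run (list_of_vec (E h)) d })
        (list_of_vec (E (?g z))) (2 * L + 2 * N + 1 + (2 * N + 1 + (2 * N + 1)))
        (7 * N + 1 + (N + (3 * N + 1 + (N + (3 * N + 1))))) \<and>
      ?g z \<in> carrier_vec (card T) \<and> cells (list_of_vec (E z)) \<le> N"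
      using z h Gz by (simp add: g)
  qed (rule z0)
  show "runs (richardson_run 3 mul mul' (flags N T) (list_of_vec u) (list_of_vec (E z0)))
    (list_of_vec (E ((?g ^^ 3) z0)))
    (L + 2 * N + 1 + (3 * (2 * L + 2 * N + 1 + (2 * N + 1 + (2 * N + 1))) + 1))
    (5 * N + 1 + (cells (list_of_vec (E h)) + (N + (7 * N + 1 +
        (N + (3 * N + 1 + (N + (3 * N + 1))))))))"
    unfolding richardson_run_def
    by (rule runs_bind[OF runs_rhs[OF u, folded h_def]], rule loop)
  show "list_of_vec (E ((?g ^^ 3) z0)) = list_of_vec (E (richardson 3 A u z0))"
    by (simp add: richardson_def h_def)
qed auto

lemma cg_step_carrier:
  assumes "z \<in> carrier_vec (card T)" "r \<in> carrier_vec (card T)" "p \<in> carrier_vec (card T)"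
    and "cg_step gram (z, r, p) = (z', r', p')"
  shows "z' \<in> carrier_vec (card T)" "r' \<in> carrier_vec (card T)" "p' \<in> carrier_vec (card T)"
  using assms gram_carrier by (auto simp: cg_step_def Let_def)

text \<open>The state in memory has a fourth component, the squared norm of the residual, which the
  program carries along instead of recomputing it.\<close>

definition cg_cells where
  "cg_cells = (\<lambda>(z, r, p). (list_of_vec (E z), list_of_vec (E r), list_of_vec (E p), r \<bullet>c r))"

lemma runs_cg_step:
  assumes c: "z \<in> carrier_vec (card T)" "r \<in> carrier_vec (card T)" "p \<in> carrier_vec (card T)"
  shows "runs (cg_step_run mul mul' (flags N T) (cg_cells (z, r, p)))
      (cg_cells (cg_step gram (z, r, p)))
    (2 * L + 30 * N + 20) (50 * N + 50)"
proof -
  define q where "q = gram *\<^sub>v p"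
  define \<alpha> where "\<alpha> = (r \<bullet>c r) / (q \<bullet>c p)"
  define z' where "z' = z + \<alpha> \<cdot>\<^sub>v p"
  define r' where "r' = r - \<alpha> \<cdot>\<^sub>v q"
  define \<beta> where "\<beta> = (r' \<bullet>c r') / (r \<bullet>c r)"
  define p' where "p' = r' + \<beta> \<cdot>\<^sub>v p"
  have q: "q \<in> carrier_vec (card T)" using gram_carrier c by (auto simp: q_def)
  have c': "z' \<in> carrier_vec (card T)" "r' \<in> carrier_vec (card T)" "p' \<in> carrier_vec (card T)"
    using c q by (auto simp: z'_def r'_def p'_def)
  have ext: "E z' = E z + \<alpha> \<cdot>\<^sub>v E p" "E r' = E r - \<alpha> \<cdot>\<^sub>v E q" "E p' = E r' + \<beta> \<cdot>\<^sub>v E p"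
    unfolding z'_def r'_def p'_def using c c' q
    by (simp_all add: extend_vec_add extend_vec_minus extend_vec_smult)
  have G: "runs (gram_run mul mul' (flags N T) (list_of_vec (E p))) (list_of_vec (E q)) (2 * L +
      2 * N + 1) (7 * N + 1)"
    unfolding q_def by (rule runs_gram[OF c(3)])
  have d: "runs (dot_run (list_of_vec (E q)) (list_of_vec (E p))) (q \<bullet>c p) (4 * N + 1) (2 * N + 4)"
    "runs (dot_run (list_of_vec (E r')) (list_of_vec (E r'))) (r' \<bullet>c r') (4 * N + 1) (2 * N + 4)"
    using runs_dot[of "E q" N "E p"] runs_dot[of "E r'" N "E r'"] c c' q
    by (simp_all add: extend_vec_cscalar_prod)
  have a: "runs (step ((r \<bullet>c r) / (q \<bullet>c p))) \<alpha> 1 1" "runs (step ((r' \<bullet>c r') / (r \<bullet>c r))) \<beta> 1 1"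
    by (simp_all add: runs_def \<alpha>_def \<beta>_def)
  have s: "runs (scale_run t (list_of_vec (E v))) (list_of_vec (t \<cdot>\<^sub>v E v)) (2 * N + 1) (3 * N + 1)"
      for t v
    by (rule runs_scale) simp
  have z: "runs (add_run (list_of_vec (E z)) (list_of_vec (\<alpha> \<cdot>\<^sub>v E p))) (list_of_vec (E z'))
      (2 * N + 1) (3 * N + 1)"
    unfolding ext by (rule runs_add) simp_all
  have r: "runs (sub_run (list_of_vec (E r)) (list_of_vec (\<alpha> \<cdot>\<^sub>v E q))) (list_of_vec (E r'))
      (2 * N + 1) (3 * N + 1)"
    unfolding ext by (rule runs_sub) simp_all
  have p: "runs (add_run (list_of_vec (E r')) (list_of_vec (\<beta> \<cdot>\<^sub>v E p))) (list_of_vec (E p'))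
      (2 * N + 1) (3 * N + 1)"
    unfolding ext(3) by (rule runs_add) simp_all
  have cg: "cg_step gram (z, r, p) = (z', r', p')"
    unfolding cg_step_def prod.case Let_def p'_def \<beta>_def r'_def z'_def \<alpha>_def q_def by (rule refl)
  show ?thesis
    unfolding cg_step_run_def cg cg_cells_def prod.case
    apply (rule runs_weaken)
       apply (rule G[THEN runs_bind], rule d(1)[THEN runs_bind], rule a(1)[THEN runs_bind],
        rule s[THEN runs_bind], rule z[THEN runs_bind], rule s[THEN runs_bind], rule r[THEN runs_bind],
        rule d(2)[THEN runs_bind], rule a(2)[THEN runs_bind], rule s[THEN runs_bind],
        rule p[THEN runs_bind], rule runs_step)
    by auto
qed

lemma runs_conjugate_gradient:
  assumes u: "u \<in> carrier_vec m" and z0: "z0 \<in> carrier_vec (card T)"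
  shows "runs (conjugate_gradient_run 3 mul mul' (flags N T) (list_of_vec u) (list_of_vec (E z0)))
    (list_of_vec (E (conjugate_gradient 3 A u z0))) (10 * L + 110 * N + 80) (90 * N + 90)"
proof -
  define h where "h = mat_adjoint A *\<^sub>v u"
  define r where "r = h - gram *\<^sub>v z0"
  have h: "h \<in> carrier_vec (card T)"
    using mat_adjoint_carrier[OF columns_carrier] u by (auto simp: h_def)
  have Gz: "gram *\<^sub>v z0 \<in> carrier_vec (card T)" using gram_carrier z0 by auto
  have r: "r \<in> carrier_vec (card T)" using h Gz by (auto simp: r_def)
  have H: "runs (rhs_run mul' (flags N T) (list_of_vec u)) (list_of_vec (E h)) (L +
      2 * N + 1) (5 * N + 1)"
    unfolding h_def by (rule runs_rhs[OF u])
  have S: "runs (sub_run (list_of_vec (E h)) (list_of_vec (E (gram *\<^sub>v z0)))) (list_of_vec (E r))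
      (2 * N + 1) (3 * N + 1)"
    unfolding r_def extend_vec_minus[OF h Gz] by (rule runs_sub) simp_all
  have d: "runs (dot_run (list_of_vec (E r)) (list_of_vec (E r))) (r \<bullet>c r) (4 * N + 1) (2 * N + 4)"
    using runs_dot[of "E r" N "E r"] r by (simp add: extend_vec_cscalar_prod)
  have loop: "runs (loop_run 3 (cg_step_run mul mul' (flags N T)) (cg_cells (z0, r, r)))
    (cg_cells ((cg_step gram ^^ 3) (z0, r, r))) (3 * (2 * L + 30 * N + 20) + 1) (3 * N +
        1 + (50 * N + 50))"
  proof (rule runs_loop[where I = "\<lambda>(z, r, p). z \<in> carrier_vec (card T) \<and> r \<in> carrier_vec (card T) \<and>
      p \<in> carrier_vec (card T)"])
    fix st :: "complex vec \<times> complex vec \<times> complex vec"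
    assume "case st of (z, r, p) \<Rightarrow> z \<in> carrier_vec (card T) \<and> r \<in> carrier_vec (card T) \<and>
        p \<in> carrier_vec (card T)"
    then obtain z r p where st: "st = (z, r, p)" and c: "z \<in> carrier_vec (card T)" "r \<in>
        carrier_vec (card T)"
      "p \<in> carrier_vec (card T)" by (cases st) auto
    obtain z' r' p' where st': "cg_step gram (z, r, p) = (z', r', p')"
        by (cases "cg_step gram (z, r, p)") auto
    show "runs (cg_step_run mul mul' (flags N T) (cg_cells st)) (cg_cells (cg_step gram st))
        (2 * L + 30 * N + 20) (50 * N + 50) \<and>
      (case cg_step gram st of (z, r, p) \<Rightarrow> z \<in> carrier_vec (card T) \<and> r \<in> carrier_vec (card T) \<and>
        p \<in> carrier_vec (card T)) \<and> cells (cg_cells st) \<le> 3 * N + 1"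
      using runs_cg_step[OF c] cg_step_carrier[OF c st'] by (simp add: st st') (simp add: cg_cells_def)
  qed (use z0 r in auto)
  have loop': "runs (loop_run 3 (cg_step_run mul mul' (flags N T)) (list_of_vec (E z0),
      list_of_vec (E r), list_of_vec (E r), r \<bullet>c r))
    (cg_cells ((cg_step gram ^^ 3) (z0, r, r))) (3 * (2 * L + 30 * N + 20) + 1) (3 * N +
        1 + (50 * N + 50))"
    using loop by (simp only: cg_cells_def prod.case)
  obtain z' r' p' where st': "(cg_step gram ^^ 3) (z0, r, r) = (z', r', p')"
    by (cases "(cg_step gram ^^ 3) (z0, r, r)") auto
  then have cg: "conjugate_gradient 3 A u z0 = z'"
    by (simp add: conjugate_gradient_def Let_def flip: h_def r_def)
  show ?thesis
    unfolding conjugate_gradient_run_def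
    apply (rule runs_weaken)
       apply (rule H[THEN runs_bind], rule runs_gram[OF z0, THEN runs_bind], rule S[THEN runs_bind],
        rule d[THEN runs_bind], rule loop'[THEN runs_bind], rule runs_step)
    by (auto simp: st' cg cg_cells_def)
qed

end
end
end

section \<open>Cost of one iteration and of the whole run\<close>

lemma supp_subset: "x \<in> carrier_vec n \<Longrightarrow> supp x \<subseteq> {..<n}"
  by (auto simp: supp_def)

lemma mask_vec_id: "x \<in> carrier_vec n \<Longrightarrow> supp x \<subseteq> T \<Longrightarrow> mask_vec T x = x"
  by (intro eq_vecI) (auto simp: supp_def)

context
  fixes N m :: nat and \<Phi> :: "complex mat" and u :: "complex vec" and L :: nat
    and w w' :: "complex vec \<Rightarrow> nat" and ls :: ls_step and ls' :: ls_run
  assumes \<Phi>: "\<Phi> \<in> carrier_mat m N" and u: "u \<in> carrier_vec m"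
    and w: "\<And>z. z \<in> carrier_vec N \<Longrightarrow> w z \<le> L" and w': "\<And>z. z \<in> carrier_vec m \<Longrightarrow> w' z \<le> L"
    and mN: "m \<le> N" and NL: "N \<le> L" and N: "0 < N"
    and ls: "\<And>T z0. T \<subseteq> {..<N} \<Longrightarrow> z0 \<in> carrier_vec (card T) \<Longrightarrow>
      runs (ls' (mult_run \<Phi> w) (mult_run (mat_adjoint \<Phi>) w') (flags N T) (list_of_vec u)
          (list_of_vec (extend_vec N T z0)))
        (list_of_vec (extend_vec N T (ls (columns \<Phi> T) u z0))) (10 * L + 110 * N + 80) (90 * N + 90)"
begin

private abbreviation (input) "mult_phi \<equiv> mult_run \<Phi> w"
private abbreviation (input) "mult_adj \<equiv> mult_run (mat_adjoint \<Phi>) w'"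

lemma cosamp_step_carrier:
  assumes "cosamp_step ls \<Phi> u \<sigma> (a, v) = (a', v')"
  shows "a' \<in> carrier_vec N" "v' \<in> carrier_vec m"
  using assms \<Phi> u by (auto simp: cosamp_step_def Let_def)

text \<open>The two selections cost 80011 N each up to constants; everything else fits into the
  remainder of 161000 L because 1 \<le> N \<le> L.\<close>

lemma runs_cosamp_step:
  assumes a: "a \<in> carrier_vec N" and v: "v \<in> carrier_vec m" and \<sigma>: "0 < \<sigma>"
    and step: "cosamp_step ls \<Phi> u \<sigma> (a, v) = (a', v')"
  shows "runs (cosamp_step_run ls' mult_phi mult_adj (list_of_vec u) \<sigma> (list_of_vec a, list_of_vec v))
    (list_of_vec a', list_of_vec v') (161000 * L) (400 * N)"
proof -
  define y where "y = mat_adjoint \<Phi> *\<^sub>v v"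
  define y' where "y' = largest (2 * \<sigma>) y"
  define T where "T = supp y' \<union> supp a"
  define b where "b = extend_vec N T (ls (columns \<Phi> T) u (restrict_vec T a))"
  have y: "y \<in> carrier_vec N" using mat_adjoint_carrier[OF \<Phi>] v by (auto simp: y_def)
  have y': "y' \<in> carrier_vec N" using y by (simp add: y'_def)
  have T: "T \<subseteq> {..<N}" using supp_subset[OF y'] supp_subset[OF a] by (simp add: T_def)
  have b: "b \<in> carrier_vec N" by (simp add: b_def)
  have N': "dim_col \<Phi> = N" using \<Phi> by simp
  have a'_eq: "a' = largest \<sigma> b" and v'_eq: "v' = u - \<Phi> *\<^sub>v a'"
    using step by (auto simp: cosamp_step_def Let_def b_def T_def y'_def y_def N')
  have a': "a' \<in> carrier_vec N" using b by (simp add: a'_eq)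
  have Y: "runs (mult_adj (list_of_vec v)) (list_of_vec y) L N"
    unfolding y_def by (rule runs_mult, rule mat_adjoint_carrier[OF \<Phi>], rule w'[OF v])
  have Y': "runs (largest_run (2 * \<sigma>) (list_of_vec y)) (list_of_vec y') (80011 * N + 2) (31 * N + 10)"
    unfolding y'_def by (rule runs_largest[OF y]) (use \<sigma> in simp)
  have ts: "runs (map_run (\<lambda>(y, a). do { p \<leftarrow> step (y \<noteq> 0); q \<leftarrow> step (a \<noteq> 0); step (p \<or> q) })
      (zip (list_of_vec y') (list_of_vec a))) (flags N T) ((3 + 1) * N + 1) (3 * 1 * N + 3)"
    using a y' by (intro runs_map nth_equalityI) (auto simp: flags_def T_def supp_def
      split: prod.splits)
  \<comment> \<open>The support of \<open>a\<close> is contained in \<open>T\<close>, so restricting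
    and padding give \<open>a\<close> back: the program passes \<open>a\<close> itself as starting
    point.\<close>
  have aE: "list_of_vec a = list_of_vec (extend_vec N T (restrict_vec T a))"
    using a T by (subst extend_restrict_vec) (simp_all add: mask_vec_id T_def)
  have B: "runs (ls' mult_phi mult_adj (flags N T) (list_of_vec u) (list_of_vec a)) (list_of_vec b)
      (10 * L + 110 * N + 80) (90 * N + 90)"
    unfolding aE b_def by (rule ls[OF T]) simp
  have A': "runs (largest_run \<sigma> (list_of_vec b)) (list_of_vec a') (80011 * N + 2) (31 * N + 10)"
    unfolding a'_eq by (rule runs_largest[OF b \<sigma>])
  have W: "runs (mult_phi (list_of_vec a')) (list_of_vec (\<Phi> *\<^sub>v a')) L m"
    by (rule runs_mult, rule \<Phi>, rule w[OF a'])
  have V: "runs (sub_run (list_of_vec u) (list_of_vec (\<Phi> *\<^sub>v a'))) (list_of_vec v')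
      (2 * m + 1) (3 * m + 1)"
    unfolding v'_eq using u \<Phi> a' by (intro runs_sub) auto
  have dims: "dim_vec y = N" "dim_vec y' = N" "dim_vec b = N" "dim_vec a' = N" "dim_vec v' = m"
      "dim_vec (\<Phi> *\<^sub>v a') = m" "length (flags N T) = N"
    using y y' b a' \<Phi> by (auto simp: v'_eq flags_def)
  show ?thesis
    unfolding cosamp_step_run_def prod.case
    apply (rule runs_weaken)
       apply (rule Y[THEN runs_bind], rule Y'[THEN runs_bind], rule ts[THEN runs_bind],
        rule B[THEN runs_bind], rule A'[THEN runs_bind], rule W[THEN runs_bind], rule V[THEN runs_bind],
        rule runs_step)
      apply (rule refl)
    subgoal using mN NL N by simp
    subgoal unfolding cells_simps cells_scalar_list length_list_of_vec dims using mN N by linarith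
    done
qed

lemma runs_cosamp:
  assumes \<sigma>: "0 < \<sigma>"
  shows "runs (cosamp_run ls' N mult_phi mult_adj (list_of_vec u) \<sigma> k) (list_of_vec (cosamp ls \<Phi> u \<sigma> k))
    (161000 * L * k + 5 * L) (500 * N)"
proof -
  let ?h = "\<lambda>(a, v). (list_of_vec a, list_of_vec v)" and ?st = "(cosamp_step ls \<Phi> u \<sigma> ^^ k) (0\<^sub>v N, u)"
  have Z: "runs (map_run (\<lambda>i. step (0::complex)) [0..<N]) (list_of_vec (0\<^sub>v N)) ((1 + 1) * N +
      1) (3 * 1 * N + 1)"
    by (rule runs_map) (auto intro: nth_equalityI)
  have "runs (loop_run k (cosamp_step_run ls' mult_phi mult_adj (list_of_vec u) \<sigma>) (?h (0\<^sub>v N, u)))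
      (?h ?st) (k * (161000 * L) + 1) (2 * N + 400 * N)"
  proof (rule runs_loop[where I = "\<lambda>(a, v). a \<in> carrier_vec N \<and> v \<in> carrier_vec m"])
    fix st :: "complex vec \<times> complex vec"
    assume "case st of (a, v) \<Rightarrow> a \<in> carrier_vec N \<and> v \<in> carrier_vec m"
    then obtain a v where st: "st = (a, v)" "a \<in> carrier_vec N" "v \<in> carrier_vec m" by (cases st) auto
    obtain a' v' where st': "cosamp_step ls \<Phi> u \<sigma> (a, v) = (a', v')"
      by (cases "cosamp_step ls \<Phi> u \<sigma> (a, v)") auto
    show "runs (cosamp_step_run ls' mult_phi mult_adj (list_of_vec u) \<sigma> (?h st))
        (?h (cosamp_step ls \<Phi> u \<sigma> st))
        (161000 * L) (400 * N) \<and>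
      (case cosamp_step ls \<Phi> u \<sigma> st of (a, v) \<Rightarrow> a \<in> carrier_vec N \<and> v \<in> carrier_vec m) \<and>
      cells (?h st) \<le> 2 * N"
      using runs_cosamp_step[OF st(2,3) \<sigma> st'] cosamp_step_carrier[OF st'] st mN by (simp add: st')
  qed (use u in simp)
  then have loop: "runs (loop_run k (cosamp_step_run ls' mult_phi mult_adj (list_of_vec u) \<sigma>)
      (list_of_vec (0\<^sub>v N), list_of_vec u))
      (?h ?st) (k * (161000 * L) + 1) (2 * N + 400 * N)" by simp
  have st: "?st = (fst ?st, snd ?st)" by simp
  have "fst ?st \<in> carrier_vec N \<and> snd ?st \<in> carrier_vec m"
  proof (induction k)
    case (Suc k)
    then show ?case
      using cosamp_step_carrier[of \<sigma> "fst st" "snd st" for st]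
        by (metis comp_apply funpow.simps(2) prod.collapse)
  qed (use u in simp)
  then have dims: "dim_vec (fst ?st) = N" "dim_vec (snd ?st) = m" by auto
  have cells: "cells (?h ?st) = N + m" by (simp add: case_prod_beta dims)
  have fst: "fst (?h ?st) = list_of_vec (fst ?st)" by (simp add: case_prod_beta)
  have N': "dim_col \<Phi> = N" using \<Phi> by simp
  show ?thesis
    unfolding cosamp_run_def
    apply (rule runs_weaken)
       apply (rule Z[THEN runs_bind], rule loop[THEN runs_bind], rule runs_step)
    subgoal unfolding fst by (simp add: cosamp_def N')
    subgoal using NL N by (simp add: algebra_simps)
    subgoal unfolding cells fst using mN N by (simp add: dims)
    done
qed

end

lemma runs_cosamp_richardson_cg:
  assumes \<Phi>: "\<Phi> \<in> carrier_mat m N" and u: "u \<in> carrier_vec m"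
    and w: "\<And>z. z \<in> carrier_vec N \<Longrightarrow> w z \<le> L" and w': "\<And>z. z \<in> carrier_vec m \<Longrightarrow> w' z \<le> L"
    and "m \<le> N" "N \<le> L" "0 < N" "0 < \<sigma>"
    and ls: "(ls, ls') \<in> {(richardson 3, richardson_run 3), (conjugate_gradient 3,
        conjugate_gradient_run 3)}"
  shows "runs (cosamp_run ls' N (mult_run \<Phi> w) (mult_run (mat_adjoint \<Phi>) w') (list_of_vec u) \<sigma> k)
    (list_of_vec (cosamp ls \<Phi> u \<sigma> k)) (161000 * L * k + 5 * L) (500 * N)"
proof (rule runs_cosamp[OF \<Phi> u w w' \<open>m \<le> N\<close> \<open>N \<le> L\<close> \<open>0 < N\<close> _ \<open>0 < \<sigma>\<close>])
  fix T and z0 :: "complex vec" assume T: "T \<subseteq> {..<N}" and z0: "z0 \<in> carrier_vec (card T)"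
  note R = runs_richardson[OF T \<Phi> w w' \<open>m \<le> N\<close> u z0] runs_conjugate_gradient[OF T \<Phi> w w' \<open>m \<le> N\<close> u z0]
  from ls show "runs (ls' (mult_run \<Phi> w) (mult_run (mat_adjoint \<Phi>) w') (flags N T) (list_of_vec u)
          (list_of_vec (extend_vec N T z0)))
        (list_of_vec (extend_vec N T (ls (columns \<Phi> T) u z0))) (10 * L + 110 * N + 80) (90 * N + 90)"
  proof (elim insertE emptyE)
    assume "(ls, ls') = (richardson 3, richardson_run 3)"
    then show ?thesis by (auto intro!: runs_weaken[OF R(1)])
  next
    assume "(ls, ls') = (conjugate_gradient 3, conjugate_gradient_run 3)"
    then show ?thesis by (auto intro!: runs_weaken[OF R(2)])
  qed
qed auto

section \<open>Restricted isometry\<close>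

lemma l2_norm_nonneg [simp]: "0 \<le> l2_norm x"
  by (simp add: l2_norm_def L2_set_nonneg)

lemma l2_norm_sq: "x \<in> carrier_vec n \<Longrightarrow> (l2_norm x)\<^sup>2 = (\<Sum>i<n. (cmod (x $ i))\<^sup>2)"
  by (auto simp: l2_norm_def L2_set_def intro!: real_sqrt_pow2 sum_nonneg)

lemma l2_norm_zero [simp]: "l2_norm (0\<^sub>v n) = 0"
  by (simp add: l2_norm_def L2_set_eq_0_iff)

lemma l2_norm_eq_0: "x \<in> carrier_vec n \<Longrightarrow> l2_norm x = 0 \<longleftrightarrow> x = 0\<^sub>v n"
  by (auto simp: l2_norm_def L2_set_eq_0_iff intro!: eq_vecI)

lemma l2_norm_triangle:
  fixes x :: "complex vec"
  assumes "x \<in> carrier_vec n" "y \<in> carrier_vec n"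
  shows "l2_norm (x + y) \<le> l2_norm x + l2_norm y"
proof -
  have "l2_norm (x + y) \<le> L2_set (\<lambda>i. cmod (x $ i) + cmod (y $ i)) {..<n}"
    using assms by (auto simp: l2_norm_def intro!: L2_set_mono norm_triangle_ineq)
  also have "\<dots> \<le> l2_norm x + l2_norm y"
    using assms L2_set_triangle_ineq by (auto simp: l2_norm_def)
  finally show ?thesis .
qed

lemma l2_norm_smult: "l2_norm (c \<cdot>\<^sub>v x) = cmod c * l2_norm x"
  by (auto simp: l2_norm_def norm_mult L2_set_right_distrib intro!: L2_set_cong)

lemma l2_norm_minus_commute:
  fixes x :: "complex vec"
  assumes "x \<in> carrier_vec n" "y \<in> carrier_vec n"
  shows "l2_norm (x - y) = l2_norm (y - x)"
  using assms by (auto simp: l2_norm_def norm_minus_commute intro!: L2_set_cong)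

lemma l2_norm_triangle_minus:
  assumes "x \<in> carrier_vec n" "y \<in> carrier_vec n"
  shows "l2_norm (x - y) \<le> l2_norm x + l2_norm y"
proof -
  have "x - y = x + (- 1) \<cdot>\<^sub>v y" using assms by (intro eq_vecI) auto
  then show ?thesis using l2_norm_triangle[of x n "(- 1) \<cdot>\<^sub>v y"] assms by (simp add: l2_norm_smult)
qed

lemma l2_norm_triangle_diff:
  assumes "x \<in> carrier_vec n" "y \<in> carrier_vec n" "z \<in> carrier_vec n"
  shows "l2_norm (x - z) \<le> l2_norm (x - y) + l2_norm (y - z)"
proof -
  have "x - z = (x - y) + (y - z)" using assms by (intro eq_vecI) auto
  then show ?thesis using l2_norm_triangle[of "x - y" n "y - z"] assms by simp
qed

lemma cscalar_prod_sum:
  "x \<in> carrier_vec n \<Longrightarrow> y \<in> carrier_vec n \<Longrightarrow> x \<bullet>c y = (\<Sum>i<n. x $ i * cnj (y $ i))"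
  by (auto simp: scalar_prod_def lessThan_atLeast0)

lemma cscalar_prod_self: "x \<in> carrier_vec n \<Longrightarrow> x \<bullet>c x = of_real ((l2_norm x)\<^sup>2)"
  by (simp add: cscalar_prod_sum l2_norm_sq complex_norm_square del: of_real_power)

lemma cauchy_schwarz:
  fixes x :: "complex vec"
  assumes "x \<in> carrier_vec n" "y \<in> carrier_vec n"
  shows "cmod (x \<bullet>c y) \<le> l2_norm x * l2_norm y"
proof -
  have "cmod (x \<bullet>c y) \<le> (\<Sum>i<n. cmod (x $ i) * cmod (y $ i))"
    using norm_sum[of "\<lambda>i. x $ i * cnj (y $ i)" "{..<n}"] assms
    by (simp add: cscalar_prod_sum norm_mult)
  also have "\<dots> \<le> l2_norm x * l2_norm y"
    using L2_set_mult_ineq[of "\<lambda>i. cmod (x $ i)" "\<lambda>i. cmod (y $ i)" "{..<n}"] assms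
    by (simp add: l2_norm_def)
  finally show ?thesis .
qed

lemma cscalar_prod_add_left:
  fixes x :: "complex vec"
  assumes "x \<in> carrier_vec n" "y \<in> carrier_vec n" "z \<in> carrier_vec n"
  shows "(x + y) \<bullet>c z = x \<bullet>c z + y \<bullet>c z"
  using assms by (simp add: cscalar_prod_sum[where n = n] algebra_simps sum.distrib)

lemma cscalar_prod_add_right:
  fixes x :: "complex vec"
  assumes "x \<in> carrier_vec n" "y \<in> carrier_vec n" "z \<in> carrier_vec n"
  shows "z \<bullet>c (x + y) = z \<bullet>c x + z \<bullet>c y"
  using assms by (simp add: cscalar_prod_sum[where n = n] algebra_simps sum.distrib)

lemma cscalar_prod_minus_left:
  fixes x :: "complex vec"
  assumes "x \<in> carrier_vec n" "y \<in> carrier_vec n" "z \<in> carrier_vec n"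
  shows "(x - y) \<bullet>c z = x \<bullet>c z - y \<bullet>c z"
  using assms by (simp add: cscalar_prod_sum[where n = n] algebra_simps sum_subtractf)

lemma cscalar_prod_smult_left:
  fixes x :: "complex vec"
  assumes "x \<in> carrier_vec n" "z \<in> carrier_vec n"
  shows "(c \<cdot>\<^sub>v x) \<bullet>c z = c * (x \<bullet>c z)"
  using assms by (simp add: cscalar_prod_sum[where n = n] algebra_simps sum_distrib_left)

lemma cscalar_prod_smult_right:
  fixes x :: "complex vec"
  assumes "x \<in> carrier_vec n" "z \<in> carrier_vec n"
  shows "z \<bullet>c (c \<cdot>\<^sub>v x) = cnj c * (z \<bullet>c x)"
  using assms by (simp add: cscalar_prod_sum[where n = n] algebra_simps sum_distrib_left)

lemma cscalar_prod_commute: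
  fixes x :: "complex vec"
  assumes "x \<in> carrier_vec n" "y \<in> carrier_vec n"
  shows "y \<bullet>c x = cnj (x \<bullet>c y)"
  using assms by (simp add: cscalar_prod_sum[where n = n] algebra_simps)

lemma pythagoras:
  fixes x :: "complex vec"
  assumes "x \<in> carrier_vec n" "y \<in> carrier_vec n" "x \<bullet>c y = 0"
  shows "(l2_norm (x + y))\<^sup>2 = (l2_norm x)\<^sup>2 + (l2_norm y)\<^sup>2"
proof -
  have "complex_of_real ((l2_norm (x + y))\<^sup>2) = (x + y) \<bullet>c (x + y)"
    using assms cscalar_prod_self[of "x + y" n] by simp
  also have "\<dots> = x \<bullet>c x + y \<bullet>c y"
    using assms cscalar_prod_commute[of x n y]
    by (simp add: cscalar_prod_add_left[where n = n] cscalar_prod_add_right[where n = n])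
  also have "\<dots> = complex_of_real ((l2_norm x)\<^sup>2 + (l2_norm y)\<^sup>2)"
    using assms by (simp add: cscalar_prod_self[where n = n])
  finally show ?thesis by (simp only: of_real_eq_iff)
qed

lemma adjoint_cscalar_prod:
  fixes A :: "complex mat"
  assumes "A \<in> carrier_mat m n" "v \<in> carrier_vec m" "x \<in> carrier_vec n"
  shows "(mat_adjoint A *\<^sub>v v) \<bullet>c x = v \<bullet>c (A *\<^sub>v x)"
proof -
  have "(mat_adjoint A *\<^sub>v v) \<bullet>c x = (\<Sum>j<n. \<Sum>i<m. cnj (A $$ (i, j)) * v $ i * cnj (x $ j))"
    using assms mat_adjoint_carrier[OF assms(1)]
    by (auto simp: scalar_prod_def lessThan_atLeast0 sum_distrib_right intro!: sum.cong)
  also have "\<dots> = (\<Sum>i<m. \<Sum>j<n. cnj (A $$ (i, j)) * v $ i * cnj (x $ j))"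
    by (rule sum.swap)
  also have "\<dots> = v \<bullet>c (A *\<^sub>v x)"
    using assms by (auto simp: scalar_prod_def lessThan_atLeast0 sum_distrib_left mult_ac
      intro!: sum.cong)
  finally show ?thesis .
qed

lemma mask_vec_split: "x \<in> carrier_vec n \<Longrightarrow> x = mask_vec S x + mask_vec (- S) x"
  by (intro eq_vecI) auto

lemma supp_mask [simp]: "supp (mask_vec S x) = supp x \<inter> S"
  by (auto simp: supp_def split: if_splits)

lemma l2_norm_mask_sq:
  "x \<in> carrier_vec n \<Longrightarrow> (l2_norm (mask_vec S x))\<^sup>2 = (\<Sum>i\<in>{..<n} \<inter> S. (cmod (x $ i))\<^sup>2)"
  by (auto simp: l2_norm_sq[where n = n] sum.inter_restrict intro!: sum.cong)

lemma l2_norm_mask_mono: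
  assumes "x \<in> carrier_vec n" "\<And>i. i \<in> S \<Longrightarrow> i < n \<Longrightarrow> i \<notin> S' \<Longrightarrow> x $ i = 0"
  shows "l2_norm (mask_vec S x) \<le> l2_norm (mask_vec S' x)"
proof -
  have "(l2_norm (mask_vec S x))\<^sup>2 \<le> (l2_norm (mask_vec S' x))\<^sup>2"
    unfolding l2_norm_sq[OF mask_vec_carrier[OF assms(1)]] using assms by (intro sum_mono) auto
  then show ?thesis by (rule power2_le_imp_le) simp
qed

lemma l2_norm_mask_le: "x \<in> carrier_vec n \<Longrightarrow> l2_norm (mask_vec S x) \<le> l2_norm x"
  using l2_norm_mask_mono[of x n S UNIV] mask_vec_id[of x n UNIV] by simp

text \<open>Testing a vector against its own restriction yields the squared norm of the restriction.
  In this way bounds on a sesquilinear form become norm bounds on restricted vectors.\<close>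

lemma cscalar_prod_mask:
  "x \<in> carrier_vec n \<Longrightarrow> x \<bullet>c mask_vec S x = of_real ((l2_norm (mask_vec S x))\<^sup>2)"
  by (auto simp: cscalar_prod_sum[where n = n] l2_norm_sq[where n = n] complex_norm_square[symmetric]
      intro!: sum.cong simp flip: of_real_power)

lemma finite_supp [simp]: "finite (supp x)"
  by (simp add: supp_def)

text \<open>Cauchy-Schwarz in each row, that is, the Frobenius norm as a bound. Any finite bound
  suffices: it makes the relative errors bounded above, so that the least constant exists.\<close>

lemma l2_norm_mult_bounded:
  assumes "\<Phi> \<in> carrier_mat m n"
  shows "\<exists>K\<ge>0. \<forall>x\<in>carrier_vec n. (l2_norm (\<Phi> *\<^sub>v x))\<^sup>2 \<le> K * (l2_norm x)\<^sup>2"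
proof (intro exI conjI ballI)
  let ?r = "\<lambda>i. l2_norm (conjugate (row \<Phi> i))"
  show "0 \<le> (\<Sum>i<m. (?r i)\<^sup>2)" by (intro sum_nonneg) simp
  fix x :: "complex vec" assume x: "x \<in> carrier_vec n"
  have "(l2_norm (\<Phi> *\<^sub>v x))\<^sup>2 = (\<Sum>i<m. (cmod ((\<Phi> *\<^sub>v x) $ i))\<^sup>2)"
    by (rule l2_norm_sq[OF mult_mat_vec_carrier[OF assms x]])
  also have "\<dots> \<le> (\<Sum>i<m. (?r i * l2_norm x)\<^sup>2)"
  proof (rule sum_mono, rule power_mono)
    fix i assume "i \<in> {..<m}"
    have row: "conjugate (row \<Phi> i) \<in> carrier_vec n"
      using row_carrier[of \<Phi> i] assms by (simp del: row_carrier)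
    from \<open>i \<in> {..<m}\<close> have "(\<Phi> *\<^sub>v x) $ i = x \<bullet>c conjugate (row \<Phi> i)"
      using assms x by (auto simp: comm_scalar_prod[where n = n])
    then show "cmod ((\<Phi> *\<^sub>v x) $ i) \<le> ?r i * l2_norm x"
      using cauchy_schwarz[OF x row] by (simp add: mult.commute)
  qed simp
  also have "\<dots> = (\<Sum>i<m. (?r i)\<^sup>2) * (l2_norm x)\<^sup>2"
    by (simp add: power_mult_distrib sum_distrib_right)
  finally show "(l2_norm (\<Phi> *\<^sub>v x))\<^sup>2 \<le> (\<Sum>i<m. (?r i)\<^sup>2) * (l2_norm x)\<^sup>2" .
qed

definition rip :: "nat \<Rightarrow> real \<Rightarrow> complex mat \<Rightarrow> bool" where
  "rip r \<delta> \<Phi> \<longleftrightarrow> (\<forall>x\<in>carrier_vec (dim_col \<Phi>). l0_norm x \<le> r \<longrightarrow>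
      \<bar>(l2_norm (\<Phi> *\<^sub>v x))\<^sup>2 - (l2_norm x)\<^sup>2\<bar> \<le> \<delta> * (l2_norm x)\<^sup>2)"

lemma rip_alt: "rip r \<delta> \<Phi> \<longleftrightarrow> (\<forall>x\<in>carrier_vec (dim_col \<Phi>). l0_norm x \<le> r \<longrightarrow>
      (1 - \<delta>) * (l2_norm x)\<^sup>2 \<le> (l2_norm (\<Phi> *\<^sub>v x))\<^sup>2 \<and>
      (l2_norm (\<Phi> *\<^sub>v x))\<^sup>2 \<le> (1 + \<delta>) * (l2_norm x)\<^sup>2)"
  unfolding rip_def by (intro ball_cong refl imp_cong) (auto simp: abs_le_iff algebra_simps)

text \<open>The least constant is the supremum of the relative errors of the squared norm.\<close>

lemma rip_of_ric:
  assumes \<Phi>: "\<Phi> \<in> carrier_mat m N" and "0 < N" "0 < r" and ric: "ric r \<Phi> \<le> \<delta>"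
  shows "rip r \<delta> \<Phi>"
proof -
  define X where "X = {x \<in> carrier_vec N. l0_norm x \<le> r \<and> l2_norm x \<noteq> 0}"
  define err where "err x = \<bar>(l2_norm (\<Phi> *\<^sub>v x))\<^sup>2 - (l2_norm x)\<^sup>2\<bar> / (l2_norm x)\<^sup>2" for x
  \<comment> \<open>Relative errors leave out vectors of norm zero; for these both sides of the
    isometry inequality vanish.\<close>
  have zero: "(l2_norm (\<Phi> *\<^sub>v x))\<^sup>2 = 0" if "x \<in> carrier_vec N" "l2_norm x = 0" for x
  proof -
    obtain K where "(l2_norm (\<Phi> *\<^sub>v x))\<^sup>2 \<le> K * (l2_norm x)\<^sup>2"
      using l2_norm_mult_bounded[OF \<Phi>] \<open>x \<in> carrier_vec N\<close> by blast
    then show ?thesis using \<open>l2_norm x = 0\<close> by simp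
  qed
  have rip_iff: "rip r d \<Phi> \<longleftrightarrow> (\<forall>x\<in>X. err x \<le> d)" for d
  proof -
    have "\<bar>(l2_norm (\<Phi> *\<^sub>v x))\<^sup>2 - (l2_norm x)\<^sup>2\<bar> \<le> d * (l2_norm x)\<^sup>2 \<longleftrightarrow> l2_norm x \<noteq> 0 \<longrightarrow> err x \<le> d"
      if "x \<in> carrier_vec N" for x
      using zero[OF that] by (cases "l2_norm x = 0") (simp_all add: err_def divide_le_eq)
    then show ?thesis using \<Phi> by (auto simp: rip_def X_def)
  qed
  obtain K where K: "K \<ge> 0" "\<And>x. x \<in> carrier_vec N \<Longrightarrow> (l2_norm (\<Phi> *\<^sub>v x))\<^sup>2 \<le> K * (l2_norm x)\<^sup>2"
    using l2_norm_mult_bounded[OF \<Phi>] by blast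
  have "err x \<le> K + 1" if "x \<in> X" for x
  proof -
    have "\<bar>(l2_norm (\<Phi> *\<^sub>v x))\<^sup>2 - (l2_norm x)\<^sup>2\<bar> \<le> (l2_norm (\<Phi> *\<^sub>v x))\<^sup>2 + (l2_norm x)\<^sup>2"
      by (simp add: abs_le_iff)
    also have "\<dots> \<le> (K + 1) * (l2_norm x)\<^sup>2"
      using K(2)[of x] that by (simp add: X_def algebra_simps)
    finally show ?thesis using that by (simp add: err_def X_def divide_le_eq)
  qed
  then have bdd: "bdd_above (err ` X)" by (intro bdd_aboveI2)
  \<comment> \<open>The supremum is meaningful only over a nonempty set. A unit vector is a witness;
    here the existence of a column and the positive sparsity level enter.\<close>
  have "unit_vec N 0 \<in> X"
  proof -
    have "supp (unit_vec N 0) \<subseteq> {0}" by (auto simp: supp_def unit_vec_def split: if_splits)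
    then have "l0_norm (unit_vec N 0) \<le> card {0::nat}"
      unfolding l0_norm_def by (rule card_mono[rotated]) simp
    then have "l0_norm (unit_vec N 0) \<le> 1" by simp
    moreover have "unit_vec N 0 \<noteq> (0\<^sub>v N :: complex vec)"
    proof
      assume "unit_vec N 0 = (0\<^sub>v N :: complex vec)"
      then have "unit_vec N 0 $ 0 = (0\<^sub>v N :: complex vec) $ 0" by simp
      then show False using \<open>0 < N\<close> by simp
    qed
    ultimately show ?thesis using \<open>0 < r\<close> by (simp add: X_def l2_norm_eq_0[where n = N])
  qed
  then have ne: "X \<noteq> {}" by blast
  have Sup: "ric r \<Phi> = (SUP x\<in>X. err x)"
    unfolding ric_def rip_alt[symmetric]
  proof (rule Least_equality)
    show "rip r (SUP x\<in>X. err x) \<Phi>" unfolding rip_iff by (intro ballI cSUP_upper[OF _ bdd])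
    show "(SUP x\<in>X. err x) \<le> d" if "rip r d \<Phi>" for d
      using that unfolding rip_iff by (intro cSUP_least[OF ne]) blast
  qed
  show ?thesis
    unfolding rip_iff
  proof
    fix x assume "x \<in> X"
    then have "err x \<le> (SUP x\<in>X. err x)" by (rule cSUP_upper[OF _ bdd])
    then show "err x \<le> \<delta>" using ric Sup by simp
  qed
qed

text \<open>The sesquilinear form of the Gram matrix minus the identity. The isometry constant
  bounds its diagonal only; the algorithm needs it off the diagonal.\<close>

definition defect :: "complex mat \<Rightarrow> complex vec \<Rightarrow> complex vec \<Rightarrow> complex" where
  "defect \<Phi> x y = (\<Phi> *\<^sub>v x) \<bullet>c (\<Phi> *\<^sub>v y) - x \<bullet>c y"

context
  fixes \<Phi> :: "complex mat" and m N :: nat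
  assumes \<Phi>: "\<Phi> \<in> carrier_mat m N"
begin

lemma mult_carrier: "x \<in> carrier_vec N \<Longrightarrow> \<Phi> *\<^sub>v x \<in> carrier_vec m"
  using \<Phi> by auto

lemma defect_add_left:
  assumes "x \<in> carrier_vec N" "y \<in> carrier_vec N" "z \<in> carrier_vec N"
  shows "defect \<Phi> (x + y) z = defect \<Phi> x z + defect \<Phi> y z"
  using assms mult_carrier \<Phi>
  by (simp add: defect_def mult_add_distrib_mat_vec[OF \<Phi>] cscalar_prod_add_left[where n = m]
      cscalar_prod_add_left[where n = N])

lemma defect_add_right:
  assumes "x \<in> carrier_vec N" "y \<in> carrier_vec N" "z \<in> carrier_vec N"
  shows "defect \<Phi> z (x + y) = defect \<Phi> z x + defect \<Phi> z y"
  using assms mult_carrier \<Phi>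
  by (simp add: defect_def mult_add_distrib_mat_vec[OF \<Phi>] cscalar_prod_add_right[where n = m]
      cscalar_prod_add_right[where n = N])

lemma defect_smult_left:
  assumes "x \<in> carrier_vec N" "z \<in> carrier_vec N"
  shows "defect \<Phi> (c \<cdot>\<^sub>v x) z = c * defect \<Phi> x z"
  using assms mult_carrier \<Phi>
  by (simp add: defect_def mult_mat_vec[OF \<Phi>] cscalar_prod_smult_left[where n = m]
      cscalar_prod_smult_left[where n = N] algebra_simps)

lemma defect_smult_right:
  assumes "x \<in> carrier_vec N" "z \<in> carrier_vec N"
  shows "defect \<Phi> z (c \<cdot>\<^sub>v x) = cnj c * defect \<Phi> z x"
  using assms mult_carrier \<Phi>
  by (simp add: defect_def mult_mat_vec[OF \<Phi>] cscalar_prod_smult_right[where n = m]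
      cscalar_prod_smult_right[where n = N] algebra_simps)

lemma defect_commute:
  assumes "x \<in> carrier_vec N" "y \<in> carrier_vec N"
  shows "defect \<Phi> y x = cnj (defect \<Phi> x y)"
  using assms mult_carrier
  by (simp add: defect_def cscalar_prod_commute[of x N y] cscalar_prod_commute[of "\<Phi>
    *\<^sub>v x" m "\<Phi> *\<^sub>v y"])

lemma defect_self:
  "x \<in> carrier_vec N \<Longrightarrow> defect \<Phi> x x = of_real ((l2_norm (\<Phi> *\<^sub>v x))\<^sup>2 - (l2_norm x)\<^sup>2)"
  using mult_carrier by (simp add: defect_def cscalar_prod_self[where n =
    N] cscalar_prod_self[where n = m])

lemma supp_add_smult:
  assumes "x \<in> carrier_vec N" "y \<in> carrier_vec N"
  shows "supp (x + c \<cdot>\<^sub>v y) \<subseteq> supp x \<union> supp y"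
  using assms by (auto simp: supp_def)

lemma supp_smult: "supp (c \<cdot>\<^sub>v y) \<subseteq> supp y"
  by (auto simp: supp_def)

text \<open>The form is conjugate-linear in its second argument, so the weight \<open>c\<close>
  turns the coefficient of \<open>defect \<Phi> x y\<close> into 1, while the sums of
  \<open>c\<close> and of its square over the fourth roots of unity vanish.\<close>

lemma defect_polarization:
  assumes "x \<in> carrier_vec N" "y \<in> carrier_vec N"
  shows "4 * defect \<Phi> x y = (\<Sum>c\<leftarrow>[1, \<i>, - 1, - \<i>]. c * defect \<Phi> (x + c \<cdot>\<^sub>v y) (x + c \<cdot>\<^sub>v y))"
  using assms by (simp add: defect_add_left defect_add_right defect_smult_left
    defect_smult_right algebra_simps)

text \<open>Each of the four polarization terms is a diagonal value at a vector of norm at most 2,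
  hence at most 4 \<delta>, and averaging keeps this bound.\<close>

lemma defect_bound_normalized:
  assumes rip: "rip r \<delta> \<Phi>" and x: "x \<in> carrier_vec N" and y: "y \<in> carrier_vec N"
    and sparse: "l0_norm x + l0_norm y \<le> r" and norm: "l2_norm x = 1" "l2_norm y = 1" and "0 \<le> \<delta>"
  shows "cmod (defect \<Phi> x y) \<le> 4 * \<delta>"
proof -
  have *: "cmod (c * defect \<Phi> (x + c \<cdot>\<^sub>v y) (x + c \<cdot>\<^sub>v y)) \<le> 4 * \<delta>" if "cmod c = 1" for c
  proof -
    let ?v = "x + c \<cdot>\<^sub>v y"
    have v: "?v \<in> carrier_vec N" using x y by simp
    have "l0_norm ?v \<le> card (supp x \<union> supp y)"
      unfolding l0_norm_def using supp_add_smult[OF x y] by (intro card_mono) auto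
    also have "\<dots> \<le> r" using card_Un_le[of "supp x" "supp y"] sparse by (simp add: l0_norm_def)
    finally have "\<bar>(l2_norm (\<Phi> *\<^sub>v ?v))\<^sup>2 - (l2_norm ?v)\<^sup>2\<bar> \<le> \<delta> * (l2_norm ?v)\<^sup>2"
      using rip \<Phi> v by (auto simp: rip_def)
    moreover have "l2_norm ?v \<le> 2"
      using l2_norm_triangle[of x N "c \<cdot>\<^sub>v y"] x y norm that by (simp add: l2_norm_smult)
    then have "(l2_norm ?v)\<^sup>2 \<le> 2\<^sup>2" by (rule power_mono) simp
    then have "\<delta> * (l2_norm ?v)\<^sup>2 \<le> \<delta> * 4" using \<open>0 \<le> \<delta>\<close> by (intro mult_left_mono) auto
    moreover have "cmod (c * defect \<Phi> ?v ?v) = \<bar>(l2_norm (\<Phi> *\<^sub>v ?v))\<^sup>2 - (l2_norm ?v)\<^sup>2\<bar>"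
      using that by (simp only: norm_mult defect_self[OF v] norm_of_real) simp
    ultimately show ?thesis by linarith
  qed
  let ?t = "\<lambda>c. c * defect \<Phi> (x + c \<cdot>\<^sub>v y) (x + c \<cdot>\<^sub>v y)"
  have "4 * cmod (defect \<Phi> x y) = cmod (4 * defect \<Phi> x y)" by (simp add: norm_mult)
  also have "\<dots> = cmod (?t 1 + (?t \<i> + (?t (- 1) + ?t (- \<i>))))"
    unfolding defect_polarization[OF x y] by simp
  also have "\<dots> \<le> cmod (?t 1) + (cmod (?t \<i>) + (cmod (?t (- 1)) + cmod (?t (- \<i>))))"
    by (intro norm_triangle_le add_left_mono) (simp_all only: order_refl)
  also have "\<dots> \<le> 4 * \<delta> + (4 * \<delta> + (4 * \<delta> + 4 * \<delta>))"
    by (intro add_mono *) simp_all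
  finally show ?thesis by simp
qed

text \<open>Two sparsity levels, so that one argument can be enlarged while the other is held
  fixed.\<close>

definition sparse_defect :: "nat \<Rightarrow> nat \<Rightarrow> real \<Rightarrow> bool" where
  "sparse_defect p q D \<longleftrightarrow> (\<forall>x\<in>carrier_vec N. \<forall>y\<in>carrier_vec N. l0_norm x \<le> p \<longrightarrow> l0_norm y \<le> q \<longrightarrow>
      cmod (defect \<Phi> x y) \<le> D * l2_norm x * l2_norm y)"

lemma sparse_defect_of_rip:
  assumes rip: "rip (p + q) \<delta> \<Phi>" and "0 \<le> \<delta>"
  shows "sparse_defect p q (4 * \<delta>)"
  unfolding sparse_defect_def
proof (intro ballI impI)
  fix x y :: "complex vec"
  assume xy: "x \<in> carrier_vec N" "y \<in> carrier_vec N" "l0_norm x \<le> p" "l0_norm y \<le> q"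
  show "cmod (defect \<Phi> x y) \<le> 4 * \<delta> * l2_norm x * l2_norm y"
  proof (cases "l2_norm x = 0 \<or> l2_norm y = 0")
    case True
    have "(0::complex) \<cdot>\<^sub>v x = 0\<^sub>v N" "(0::complex) \<cdot>\<^sub>v y = 0\<^sub>v N" using xy by auto
    then have "defect \<Phi> x y = 0"
      using True xy defect_smult_left[of x y 0] defect_smult_right[of y x 0]
      by (auto simp: l2_norm_eq_0[where n = N])
    then show ?thesis using True by auto
  next
    case False
    let ?n = "\<lambda>x. complex_of_real (1 / l2_norm x) \<cdot>\<^sub>v x"
    have "l0_norm (?n x) + l0_norm (?n y) \<le> p + q"
      using xy card_mono[OF finite_supp supp_smult, of "complex_of_real (1 / l2_norm x)" x]
        card_mono[OF finite_supp supp_smult, of "complex_of_real (1 / l2_norm y)" y]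
      by (simp add: l0_norm_def)
    then have "cmod (defect \<Phi> (?n x) (?n y)) \<le> 4 * \<delta>"
      using False xy \<open>0 \<le> \<delta>\<close> by (intro defect_bound_normalized[OF rip])
        (auto simp: l2_norm_smult norm_divide)
    then show ?thesis
      using False xy
      by (simp add: defect_smult_left defect_smult_right norm_mult norm_divide divide_le_eq
          l2_norm_nonneg less_le mult_ac)
  qed
qed

lemma sparse_defect_commute:
  assumes "sparse_defect p q D"
  shows "sparse_defect q p D"
  unfolding sparse_defect_def
proof (intro ballI impI)
  fix x y :: "complex vec"
  assume xy: "x \<in> carrier_vec N" "y \<in> carrier_vec N" "l0_norm x \<le> q" "l0_norm y \<le> p"
  then have "cmod (defect \<Phi> y x) \<le> D * l2_norm y * l2_norm x"
    using assms by (simp add: sparse_defect_def)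
  then show "cmod (defect \<Phi> x y) \<le> D * l2_norm x * l2_norm y"
    unfolding defect_commute[OF xy(2,1)] complex_mod_cnj by (simp add: mult_ac)
qed

text \<open>A vector with at most 2p nonzero entries splits into two p-sparse pieces, each of norm
  at most that of the whole; this costs a factor 2 and raises the order beyond the one that the
  hypothesis controls.\<close>

lemma sparse_defect_double:
  assumes "sparse_defect p q D" and "0 \<le> D"
  shows "sparse_defect (2 * p) q (2 * D)"
  unfolding sparse_defect_def
proof (intro ballI impI)
  fix x y :: "complex vec"
  assume xy: "x \<in> carrier_vec N" "y \<in> carrier_vec N" "l0_norm x \<le> 2 * p" "l0_norm y \<le> q"
  \<comment> \<open>The minimum covers a vector that is p-sparse already; the second piece is then
    zero.\<close>
  obtain S where S: "S \<subseteq> supp x" "card S = min p (l0_norm x)"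
    using obtain_subset_with_card_n[of "min p (l0_norm x)" "supp x"] by (auto simp: l0_norm_def)
  have fin: "finite S" using S(1) finite_subset[OF _ finite_supp] by blast
  have *: "cmod (defect \<Phi> (mask_vec R x) y) \<le> D * l2_norm x * l2_norm y"
      if "card (supp x \<inter> R) \<le> p" for R
  proof -
    have "cmod (defect \<Phi> (mask_vec R x) y) \<le> D * l2_norm (mask_vec R x) * l2_norm y"
      using assms(1) xy that by (auto simp: sparse_defect_def l0_norm_def)
    also have "\<dots> \<le> D * l2_norm x * l2_norm y"
      using l2_norm_mask_le[OF xy(1)] \<open>0 \<le> D\<close> by (intro mult_right_mono mult_left_mono) auto
    finally show ?thesis .
  qed
  have "supp x \<inter> S = S" "supp x \<inter> - S = supp x - S" using S(1) by auto
  then have "card (supp x \<inter> S) \<le> p" "card (supp x \<inter> - S) \<le> p"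
    using S xy(3) fin by (auto simp: card_Diff_subset l0_norm_def)
  note this[THEN *]
  moreover have "defect \<Phi> x y = defect \<Phi> (mask_vec S x) y + defect \<Phi> (mask_vec (- S) x) y"
    using xy by (subst mask_vec_split[OF xy(1), of S]) (simp add: defect_add_left)
  ultimately show "cmod (defect \<Phi> x y) \<le> 2 * D * l2_norm x * l2_norm y"
    using norm_triangle_ineq[of "defect \<Phi> (mask_vec S x) y" "defect \<Phi> (mask_vec (- S) x) y"] by simp
qed

text \<open>Polarization contributes 4 and three doublings in each argument contribute 8 each: 4 * 8
  * 8 = 256.\<close>

lemma sparse_defect_scale:
  assumes "rip (2 * s) \<delta> \<Phi>" "0 \<le> \<delta>"
  shows "sparse_defect (8 * s) (8 * s) (256 * \<delta>)"
proof -
  have up: "sparse_defect (8 * p) q (8 * D)" if "sparse_defect p q D" "0 \<le> D" for p q D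
    using sparse_defect_double[OF sparse_defect_double[OF sparse_defect_double[OF that]]] that by simp
  have "sparse_defect s s (4 * \<delta>)" using sparse_defect_of_rip[of s s] assms by (simp add: mult_2)
  from up[OF this] have "sparse_defect (8 * s) s (8 * (4 * \<delta>))" using assms by simp
  from up[OF sparse_defect_commute[OF this]]
  have "sparse_defect (8 * s) (8 * s) (8 * (8 * (4 * \<delta>)))" using assms by simp
  then show ?thesis by simp
qed

context
  fixes K :: nat and D :: real
  assumes defect: "sparse_defect K K D" and D: "0 \<le> D" "D \<le> 3 / 4"
begin

lemma defect_le: 
  "x \<in> carrier_vec N \<Longrightarrow> y \<in> carrier_vec N \<Longrightarrow> l0_norm x \<le> K \<Longrightarrow> l0_norm y \<le> K \<Longrightarrow>
    cmod (defect \<Phi> x y) \<le> D * l2_norm x * l2_norm y"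
  using defect by (auto simp: sparse_defect_def)

text \<open>With \<open>D \<le> 3 / 4\<close> the squared norm of the image lies between 1/4 and 7/4
  of the squared norm, which yields the factor 2 in both directions.\<close>

lemma l2_norm_mult_sparse:
  assumes "x \<in> carrier_vec N" "l0_norm x \<le> K"
  shows "l2_norm (\<Phi> *\<^sub>v x) \<le> 2 * l2_norm x" "l2_norm x \<le> 2 * l2_norm (\<Phi> *\<^sub>v x)"
proof -
  have "\<bar>(l2_norm (\<Phi> *\<^sub>v x))\<^sup>2 - (l2_norm x)\<^sup>2\<bar> \<le> D * (l2_norm x)\<^sup>2"
    using defect_le[OF assms(1,1,2,2)] unfolding defect_self[OF assms(1)] norm_of_real
    by (simp add: power2_eq_square)
  also have "\<dots> \<le> 3 / 4 * (l2_norm x)\<^sup>2" using D by (intro mult_right_mono) auto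
  finally have "(l2_norm (\<Phi> *\<^sub>v x))\<^sup>2 \<le> (2 * l2_norm x)\<^sup>2" "(l2_norm x)\<^sup>2 \<le> (2 * l2_norm (\<Phi> *\<^sub>v x))\<^sup>2"
    unfolding abs_le_iff power_mult_distrib by auto
  then show "l2_norm (\<Phi> *\<^sub>v x) \<le> 2 * l2_norm x" "l2_norm x \<le> 2 * l2_norm (\<Phi> *\<^sub>v x)"
    by (auto intro: power2_le_imp_le)
qed

text \<open>By duality: the squared norm of the restricted vector \<open>?g\<close> equals
  \<open>defect \<Phi> x ?g\<close>, and the bound on the latter contains the norm of
  \<open>?g\<close> once, which cancels.\<close>

lemma mask_gram_minus_id:
  assumes x: "x \<in> carrier_vec N" "l0_norm x \<le> K" and S: "finite S" "card S \<le> K"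
  shows "l2_norm (mask_vec S (mat_adjoint \<Phi> *\<^sub>v (\<Phi> *\<^sub>v x) - x)) \<le> D * l2_norm x"
proof -
  let ?h = "mat_adjoint \<Phi> *\<^sub>v (\<Phi> *\<^sub>v x) - x"
  let ?g = "mask_vec S ?h"
  have A: "mat_adjoint \<Phi> *\<^sub>v (\<Phi> *\<^sub>v x) \<in> carrier_vec N"
    using mat_adjoint_carrier[OF \<Phi>] mult_carrier[OF x(1)] by auto
  have h: "?h \<in> carrier_vec N" and g: "?g \<in> carrier_vec N" using A x by auto
  have "l0_norm ?g \<le> K"
    unfolding l0_norm_def supp_mask using S card_mono[of S "supp ?h \<inter> S"] by auto
  have "complex_of_real ((l2_norm ?g)\<^sup>2) = ?h \<bullet>c ?g" by (rule cscalar_prod_mask[OF h, symmetric])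
  also have "\<dots> = defect \<Phi> x ?g"
    using A g x mult_carrier[OF x(1)]
    by (simp add: cscalar_prod_minus_left[where n = N] defect_def adjoint_cscalar_prod[OF \<Phi>])
  finally have "(l2_norm ?g)\<^sup>2 = cmod (defect \<Phi> x ?g)"
    by (metis norm_of_real abs_of_nonneg zero_le_power2)
  also have "\<dots> \<le> D * l2_norm x * l2_norm ?g" by (rule defect_le) fact+
  finally show ?thesis using D
    by (cases "l2_norm ?g = 0") (auto simp: power2_eq_square less_le)
qed

text \<open>Again by duality: the adjoint restricted to \<open>S\<close> inherits the bound 2 that
  holds for the matrix on vectors supported in \<open>S\<close>.\<close>

lemma mask_adjoint_sparse:
  assumes e: "e \<in> carrier_vec m" and S: "finite S" "card S \<le> K"
  shows "l2_norm (mask_vec S (mat_adjoint \<Phi> *\<^sub>v e)) \<le> 2 * l2_norm e"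
proof -
  let ?h = "mat_adjoint \<Phi> *\<^sub>v e"
  let ?g = "mask_vec S ?h"
  have h: "?h \<in> carrier_vec N" using mat_adjoint_carrier[OF \<Phi>] e by auto
  then have g: "?g \<in> carrier_vec N" by simp
  have sp: "l0_norm ?g \<le> K"
    unfolding l0_norm_def supp_mask using S card_mono[of S "supp ?h \<inter> S"] by auto
  have "complex_of_real ((l2_norm ?g)\<^sup>2) = e \<bullet>c (\<Phi> *\<^sub>v ?g)"
    using cscalar_prod_mask[OF h, of S] adjoint_cscalar_prod[OF \<Phi> e g] by simp
  then have "(l2_norm ?g)\<^sup>2 = cmod (e \<bullet>c (\<Phi> *\<^sub>v ?g))"
    by (metis norm_of_real abs_of_nonneg zero_le_power2)
  also have "\<dots> \<le> l2_norm e * l2_norm (\<Phi> *\<^sub>v ?g)" by (rule cauchy_schwarz[OF e mult_carrier[OF g]])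
  also have "\<dots> \<le> l2_norm e * (2 * l2_norm ?g)"
    by (intro mult_left_mono l2_norm_mult_sparse g sp) simp
  finally show ?thesis
    by (cases "l2_norm ?g = 0") (auto simp: power2_eq_square less_le)
qed

end
end

section \<open>Best sparse approximation\<close>

lemma ranks_before_trans: "ranks_before x i j \<Longrightarrow> ranks_before x j k \<Longrightarrow> ranks_before x i k"
  by (auto simp: ranks_before_def)

lemma entry_rank_strict_mono:
  assumes "i < dim_vec x" "ranks_before x i j"
  shows "entry_rank x i < entry_rank x j"
proof -
  let ?P = "\<lambda>i. {k. k < dim_vec x \<and> ranks_before x k i}"
  have "?P i \<subseteq> ?P j" using assms(2) ranks_before_trans by blast
  moreover have "i \<in> ?P j" "i \<notin> ?P i" using assms by (auto simp: ranks_before_def)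
  ultimately have "?P i \<subset> ?P j" by blast
  then show ?thesis unfolding entry_rank_def by (rule psubset_card_mono[rotated]) simp
qed

lemma entry_rank_cmod:
  assumes "i < dim_vec x" "j < dim_vec x" "entry_rank x i < entry_rank x j"
  shows "cmod (x $ j) \<le> cmod (x $ i)"
  using entry_rank_strict_mono[of j x i] assms by (force simp: ranks_before_def)

lemma entry_rank_inj: "inj_on (entry_rank x) {..<dim_vec x}"
proof (rule linorder_inj_onI')
  fix i j assume "i \<in> {..<dim_vec x}" "j \<in> {..<dim_vec x}" "i < j"
  moreover from this have "ranks_before x i j \<or> ranks_before x j i" by (auto simp: ranks_before_def)
  ultimately show "entry_rank x i \<noteq> entry_rank x j" using entry_rank_strict_mono by fastforce
qed

text \<open>Ranks permute the index set, so a block of consecutive ranks within the dimension has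
  exactly its nominal size. The averaging over blocks depends on this.\<close>

lemma entry_rank_image: "entry_rank x ` {..<dim_vec x} = {..<dim_vec x}"
  by (rule endo_inj_surj) (auto simp: entry_rank_inj intro: entry_rank_less)

definition rank_block :: "complex vec \<Rightarrow> nat \<Rightarrow> nat \<Rightarrow> nat set" where
  "rank_block x p q = {i. i < dim_vec x \<and> p \<le> entry_rank x i \<and> entry_rank x i < q}"

lemma rank_block_finite [simp]: "finite (rank_block x p q)"
  by (simp add: rank_block_def)

lemma card_rank_block_le: "card (rank_block x p q) \<le> q - p"
proof -
  have "inj_on (entry_rank x) (rank_block x p q)"
    by (rule inj_on_subset[OF entry_rank_inj]) (auto simp: rank_block_def)
  moreover have "entry_rank x ` rank_block x p q \<subseteq> {p..<q}" by (auto simp: rank_block_def)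
  ultimately have "card (rank_block x p q) \<le> card {p..<q}" by (rule card_inj_on_le) simp
  then show ?thesis by simp
qed

lemma card_rank_block:
  assumes "q \<le> dim_vec x"
  shows "card (rank_block x p q) = q - p"
proof -
  have "inj_on (entry_rank x) (rank_block x p q)"
    by (rule inj_on_subset[OF entry_rank_inj]) (auto simp: rank_block_def)
  moreover have "entry_rank x ` rank_block x p q = {p..<q}"
  proof (intro equalityI subsetI)
    fix k assume "k \<in> {p..<q}"
    moreover from this have "k \<in> entry_rank x ` {..<dim_vec x}" using assms
        by (simp add: entry_rank_image)
    ultimately show "k \<in> entry_rank x ` rank_block x p q" by (auto simp: rank_block_def)
  qed (auto simp: rank_block_def)
  ultimately show ?thesis using card_image by fastforce
qed

lemma largest_mask: "largest r x = mask_vec (rank_block x 0 r) x"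
  by (intro eq_vecI) (auto simp: rank_block_def)

lemma l0_norm_mask_le: "finite S \<Longrightarrow> card S \<le> r \<Longrightarrow> l0_norm (mask_vec S x) \<le> r"
  unfolding l0_norm_def supp_mask by (meson card_mono inf_le2 le_trans)

lemma l0_norm_largest: "l0_norm (largest r x) \<le> r"
  unfolding largest_mask using card_rank_block_le[of x 0 r] by (intro l0_norm_mask_le) auto

lemma l1_norm_sum: "x \<in> carrier_vec n \<Longrightarrow> l1_norm x = (\<Sum>i<n. cmod (x $ i))"
  by (auto simp: l1_norm_def)

lemma l1_norm_minus_largest:
  assumes "x \<in> carrier_vec N"
  shows "l1_norm (x - largest r x) = (\<Sum>i\<in>rank_block x r N. cmod (x $ i))"
proof -
  have "l1_norm (x - largest r x) = (\<Sum>i<N. cmod ((x - largest r x) $ i))"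
    using assms by (intro l1_norm_sum) auto
  also have "\<dots> = (\<Sum>i\<in>rank_block x r N. cmod ((x - largest r x) $ i))"
    using assms entry_rank_less[of _ x] by (intro sum.mono_neutral_right) (auto simp: rank_block_def)
  also have "\<dots> = (\<Sum>i\<in>rank_block x r N. cmod (x $ i))"
    using assms by (intro sum.cong) (auto simp: rank_block_def)
  finally show ?thesis .
qed

text \<open>Every entry of a block is at most the average of the preceding block.\<close>

lemma l2_norm_block_le:
  assumes x: "x \<in> carrier_vec N" and s: "0 < s" and N: "r + s \<le> N"
  shows "l2_norm (mask_vec (rank_block x (r + s) (r + s + s)) x) \<le>
    (\<Sum>i\<in>rank_block x r (r + s). cmod (x $ i)) / sqrt s"
proof -
  let ?B = "rank_block x (r + s) (r + s + s)" and ?A = "rank_block x r (r + s)"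
  define \<alpha> where "\<alpha> = (\<Sum>i\<in>?A. cmod (x $ i))"
  have \<alpha>: "0 \<le> \<alpha>" unfolding \<alpha>_def by (intro sum_nonneg) simp
  have le: "cmod (x $ i) \<le> \<alpha> / s" if "i \<in> ?B" for i
  proof -
    have "card ?A * cmod (x $ i) \<le> \<alpha>"
      unfolding \<alpha>_def using that
      by (intro sum_bounded_below) (auto simp: rank_block_def intro: entry_rank_cmod)
    then show ?thesis using s N x by (simp add: card_rank_block field_simps)
  qed
  have "(l2_norm (mask_vec ?B x))\<^sup>2 = (\<Sum>i\<in>?B. (cmod (x $ i))\<^sup>2)"
    using x by (subst l2_norm_mask_sq[where n = N]) (auto simp: rank_block_def intro!: sum.cong)
  also have "\<dots> \<le> (\<Sum>i\<in>?B. (\<alpha> / s)\<^sup>2)" by (intro sum_mono power_mono le) auto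
  also have "\<dots> \<le> s * (\<alpha> / s)\<^sup>2"
    using card_rank_block_le[of x "r + s" "r + s + s"] by (auto intro!: mult_right_mono)
  also have "\<dots> = (\<alpha> / sqrt s)\<^sup>2" using s by (simp add: power_divide power2_eq_square)
  finally show ?thesis
    unfolding \<alpha>_def[symmetric] by (rule power2_le_imp_le) (use \<alpha> in simp)
qed

text \<open>The tail is not sparse, so \<open>sparse\<close> applies only to its blocks of s entries
  and subadditivity assembles them. The block of ranks from r + s on is charged to the l1 mass of
  the ranks from r to r + s, and the induction continues with r + s. The function \<open>f\<close>
  is a parameter because both the tail and its image under the matrix must be bounded.\<close>

lemma tail_bound:
  fixes f :: "complex vec \<Rightarrow> real"
  assumes x: "x \<in> carrier_vec N" and s: "0 < s"
    and f0: "f (0\<^sub>v N) = 0"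
    and add: "\<And>y z. y \<in> carrier_vec N \<Longrightarrow> z \<in> carrier_vec N \<Longrightarrow> f (y + z) \<le> f y + f z"
    and sparse: "\<And>y. y \<in> carrier_vec N \<Longrightarrow> l0_norm y \<le> s \<Longrightarrow> f y \<le> M * l2_norm y" and M: "0 \<le> M"
  shows "f (x - largest (r + s) x) \<le> M * (l1_norm (x - largest r x) / sqrt s)"
proof (induction "N - r" arbitrary: r rule: less_induct)
  case less
  show ?case
  proof (cases "r + s < N")
    case False
    then have "x - largest (r + s) x = 0\<^sub>v N" using x by (subst largest_id) auto
    moreover have "0 \<le> l1_norm (x - largest r x)" by (simp add: l1_norm_def sum_nonneg)
    ultimately show ?thesis using f0 M by simp
  next
    case True
    let ?b = "mask_vec (rank_block x (r + s) (r + s + s)) x"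
    let ?z = "x - largest (r + s + s) x"
    have "x - largest (r + s) x = ?b + ?z"
      using x by (intro eq_vecI) (auto simp: rank_block_def)
    then have "f (x - largest (r + s) x) \<le> f ?b + f ?z" using x by (simp add: add)
    moreover have "f ?z \<le> M * (l1_norm (x - largest (r + s) x) / sqrt s)"
      using less[of "r + s"] True s by simp
    moreover have "f ?b \<le> M * l2_norm ?b"
      using x card_rank_block_le[of x "r + s" "r + s + s"] by (intro sparse l0_norm_mask_le) auto
    moreover have "M * l2_norm ?b \<le> M * ((\<Sum>i\<in>rank_block x r (r + s). cmod (x $ i)) / sqrt s)"
      using l2_norm_block_le[OF x s, of r] True M by (intro mult_left_mono) auto
    moreover have "l1_norm (x - largest r x) =
        (\<Sum>i\<in>rank_block x r (r + s). cmod (x $ i)) + l1_norm (x - largest (r + s) x)"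
    proof -
      have "rank_block x r N = rank_block x r (r + s) \<union> rank_block x (r + s) N"
        using True by (auto simp: rank_block_def)
      then show ?thesis unfolding l1_norm_minus_largest[OF x]
        by (simp add: sum.union_disjoint rank_block_def Int_def disjoint_iff)
    qed
    ultimately show ?thesis by (simp add: add_divide_distrib distrib_left)
  qed
qed

section \<open>Optimality of keeping the largest entries\<close>

lemma sum_le_of_card:
  fixes f :: "'a \<Rightarrow> real"
  assumes "finite A" "finite B" "card A \<le> card B" "\<And>a b. a \<in> A \<Longrightarrow> b \<in> B \<Longrightarrow> f a \<le> f b"
    and "\<And>b. b \<in> B \<Longrightarrow> 0 \<le> f b"
  shows "sum f A \<le> sum f B"
proof -
  obtain g where g: "g ` A \<subseteq> B" "inj_on g A" using card_le_inj[OF assms(1-3)] by blast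
  have "sum f A \<le> (\<Sum>a\<in>A. f (g a))" using g(1) assms(4) by (intro sum_mono) auto
  also have "\<dots> = sum f (g ` A)" using g(2) by (simp add: sum.reindex)
  also have "\<dots> \<le> sum f B" using g(1) assms(2,5) by (intro sum_mono2) auto
  finally show ?thesis .
qed

text \<open>Once the common part is removed, the competitor \<open>R\<close> has no more indices
  left than the block of largest entries, and each of its entries is at most each entry of the
  block.\<close>

lemma largest_dominates:
  assumes y: "y \<in> carrier_vec N" and R: "R \<subseteq> {..<N}" "card R \<le> r"
  shows "l2_norm (mask_vec (R - rank_block y 0 r) y) \<le> l2_norm (mask_vec (rank_block y 0 r - R) y)"
proof -
  let ?S = "rank_block y 0 r"
  have S: "?S \<subseteq> {..<N}" using y by (auto simp: rank_block_def)
  have R': "finite R" using R(1) finite_subset by blast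
  have card: "card (R - ?S) \<le> card (?S - R)"
  proof (cases "r \<le> N")
    case True
    then have "card R \<le> card ?S" using R(2) y by (simp add: card_rank_block)
    then show ?thesis using R' by (intro card_le_sym_Diff) auto
  next
    case False
    \<comment> \<open>For \<open>r > N\<close> the block has fewer than \<open>r\<close> elements
      and cannot be counted by \<open>card_rank_block\<close>, but then it contains every
      index.\<close>
    then have "{..<N} \<subseteq> ?S" using y entry_rank_less[of _ y] by (fastforce simp: rank_block_def)
    then have "R - ?S = {}" using R(1) by blast
    then show ?thesis by (simp only: card.empty le0)
  qed
  have "(\<Sum>i\<in>R - ?S. (cmod (y $ i))\<^sup>2) \<le> (\<Sum>i\<in>?S - R. (cmod (y $ i))\<^sup>2)"
  proof (rule sum_le_of_card[OF _ _ card])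
    fix i j assume "i \<in> R - ?S" "j \<in> ?S - R"
    then have "i < dim_vec y" "j < dim_vec y" "entry_rank y j < entry_rank y i"
      using R(1) y by (auto simp: rank_block_def)
    then show "(cmod (y $ i))\<^sup>2 \<le> (cmod (y $ j))\<^sup>2" by (intro power_mono entry_rank_cmod) auto
  qed (use R' in auto)
  moreover have "{..<N} \<inter> (R - ?S) = R - ?S" "{..<N} \<inter> (?S - R) = ?S - R" using R(1) S by auto
  ultimately have "(l2_norm (mask_vec (R - ?S) y))\<^sup>2 \<le> (l2_norm (mask_vec (?S - R) y))\<^sup>2"
    using y by (simp add: l2_norm_mask_sq[where n = N])
  then show ?thesis by (rule power2_le_imp_le) simp
qed

text \<open>Off the support of \<open>x\<close> the vectors \<open>b - x\<close> and
  \<open>b\<close> agree, so the error is at least the mass of \<open>b\<close> off that support,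
  and by domination no \<open>r\<close> indices leave less mass uncovered than the largest
  ones.\<close>

lemma largest_best_approx:
  assumes b: "b \<in> carrier_vec N" and x: "x \<in> carrier_vec N" "l0_norm x \<le> r"
  shows "l2_norm (b - largest r b) \<le> l2_norm (b - x)"
proof -
  let ?S = "rank_block b 0 r" and ?R = "supp x"
  let ?f = "\<lambda>i. (cmod (b $ i))\<^sup>2"
  have S: "?S \<subseteq> {..<N}" using b by (auto simp: rank_block_def)
  have R: "?R \<subseteq> {..<N}" by (rule supp_subset[OF x(1)])
  have dom: "(l2_norm (mask_vec (?R - ?S) b))\<^sup>2 \<le> (l2_norm (mask_vec (?S - ?R) b))\<^sup>2"
    using largest_dominates[OF b R] x(2) by (intro power_mono) (auto simp: l0_norm_def)
  \<comment> \<open>Applied in both orders to the kept set and the support of \<open>x\<close>: the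
    parts outside the union agree, so only the two set differences are compared.\<close>
  have sq: "(l2_norm (mask_vec (- A) b))\<^sup>2 =
      (l2_norm (mask_vec (- (A \<union> B)) b))\<^sup>2 + (l2_norm (mask_vec (B - A) b))\<^sup>2" for A B
    unfolding l2_norm_mask_sq[OF b]
    by (subst sum.union_disjoint[symmetric]) (auto intro!: sum.cong)
  have "(l2_norm (b - largest r b))\<^sup>2 = (l2_norm (mask_vec (- ?S) b))\<^sup>2"
    using b by (intro arg_cong[where f = "\<lambda>v. (l2_norm v)\<^sup>2"] eq_vecI) (auto simp: rank_block_def)
  also have "\<dots> \<le> (l2_norm (mask_vec (- ?R) b))\<^sup>2"
    using sq[of ?S ?R] sq[of ?R ?S] dom by (simp add: Un_commute)
  also have "\<dots> = (l2_norm (mask_vec (- ?R) (b - x)))\<^sup>2"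
    using b x(1) by (intro arg_cong[where f = "\<lambda>v. (l2_norm v)\<^sup>2"] eq_vecI) (auto simp: supp_def)
  also have "\<dots> \<le> (l2_norm (b - x))\<^sup>2"
    using b x(1) l2_norm_mask_le[of "b - x" N] by (intro power_mono) auto
  finally show ?thesis by (rule power2_le_imp_le) simp
qed

text \<open>The sparse \<open>x\<close> competes for the best approximation of \<open>b\<close>, so
  pruning \<open>b\<close> moves it by at most its distance to \<open>x\<close>; the triangle
  inequality then doubles.\<close>

lemma l2_norm_prune:
  assumes b: "b \<in> carrier_vec N" and x: "x \<in> carrier_vec N" "l0_norm x \<le> r"
  shows "l2_norm (x - largest r b) \<le> 2 * l2_norm (x - b)"
  using l2_norm_triangle_diff[of x N b "largest r b"] largest_best_approx[OF b x]
    l2_norm_minus_commute[of x N b] b x by simp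

section \<open>Least squares\<close>

context
  fixes A :: "complex mat" and m n :: nat and u :: "complex vec" and D :: real
  assumes A: "A \<in> carrier_mat m n" and u: "u \<in> carrier_vec m"
    and AD: "sparse_defect A n n n D" and D: "0 \<le> D" "D \<le> 3 / 4"
begin

private abbreviation (input) "G \<equiv> mat_adjoint A * A"

text \<open>On vectors of length \<open>n\<close> the order \<open>n\<close> is no restriction, so
  the assumption on \<open>A\<close> applies to all of them.\<close>

lemma l0_norm_le_dim: "x \<in> carrier_vec n \<Longrightarrow> l0_norm x \<le> n"
  unfolding l0_norm_def using card_mono[OF _ supp_subset] by fastforce

lemma G_carrier: "G \<in> carrier_mat n n"
  using A mat_adjoint_carrier by auto

lemma G_mult: "x \<in> carrier_vec n \<Longrightarrow> G *\<^sub>v x = mat_adjoint A *\<^sub>v (A *\<^sub>v x)"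
  by (rule assoc_mult_mat_vec[OF mat_adjoint_carrier[OF A] A])

lemma G_mult_carrier: "x \<in> carrier_vec n \<Longrightarrow> G *\<^sub>v x \<in> carrier_vec n"
  by (rule mult_mat_vec_carrier[OF G_carrier])

lemma A_mult_carrier: "x \<in> carrier_vec n \<Longrightarrow> A *\<^sub>v x \<in> carrier_vec m"
  by (rule mult_mat_vec_carrier[OF A])

lemma G_cscalar_prod:
  "x \<in> carrier_vec n \<Longrightarrow> y \<in> carrier_vec n \<Longrightarrow> (G *\<^sub>v x) \<bullet>c y = (A *\<^sub>v x) \<bullet>c (A *\<^sub>v y)"
  by (simp add: G_mult adjoint_cscalar_prod[OF A A_mult_carrier])

lemma A_norm:
  assumes "x \<in> carrier_vec n"
  shows "l2_norm (A *\<^sub>v x) \<le> 2 * l2_norm x" "l2_norm x \<le> 2 * l2_norm (A *\<^sub>v x)"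
  using l2_norm_mult_sparse[OF A AD D assms l0_norm_le_dim[OF assms]] by auto

lemma G_minus_id:
  assumes x: "x \<in> carrier_vec n"
  shows "l2_norm (x - G *\<^sub>v x) \<le> D * l2_norm x"
proof -
  have c: "G *\<^sub>v x - x \<in> carrier_vec n" using G_mult_carrier[OF x] x by simp
  have "l2_norm (mask_vec {..<n} (G *\<^sub>v x - x)) \<le> D * l2_norm x"
    using mask_gram_minus_id[OF A AD D x l0_norm_le_dim[OF x], of "{..<n}"] by (simp add: G_mult x)
  moreover have "mask_vec {..<n} (G *\<^sub>v x - x) = G *\<^sub>v x - x" using c supp_subset[OF c]
      by (rule mask_vec_id)
  ultimately show ?thesis using l2_norm_minus_commute[OF x G_mult_carrier[OF x]] by simp
qed

lemma G_injective:
  assumes "x \<in> carrier_vec n" "G *\<^sub>v x = 0\<^sub>v n"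
  shows "x = 0\<^sub>v n"
proof -
  have "x - 0\<^sub>v n = x" using assms(1) by auto
  then have "l2_norm x \<le> D * l2_norm x" using G_minus_id[OF assms(1)] assms(2) by simp
  also have "\<dots> \<le> 3 / 4 * l2_norm x" using D by (intro mult_right_mono) auto
  finally have "l2_norm x = 0" using l2_norm_nonneg[of x] by linarith
  then show ?thesis using assms(1) by (simp add: l2_norm_eq_0)
qed

text \<open>The \<open>the\<close> in \<open>pseudo_inverse\<close> has a meaning only if the Gram
  matrix is invertible; its trivial kernel gives a nonzero determinant, hence
  \<open>mat_inverse\<close> returns an inverse.\<close>

lemma exact_ls_normal_equations:
  shows "exact_ls A u z0 \<in> carrier_vec n" and "G *\<^sub>v exact_ls A u z0 = mat_adjoint A *\<^sub>v u"
proof -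
  have "det G \<noteq> 0" using det_0_iff_vec_prod_zero[OF G_carrier] G_injective by blast
  then have "G \<in> Units (ring_mat TYPE(complex) n ())" by (rule det_non_zero_imp_unit[OF G_carrier])
  then have "mat_inverse G \<noteq> None" using mat_inverse(1)[OF G_carrier, where b = "()"] by blast
  then obtain B where B: "mat_inverse G = Some B" by blast
  have GB: "G * B = 1\<^sub>m n" and Bc: "B \<in> carrier_mat n n" using mat_inverse(2)[OF G_carrier B] by auto
  have h: "mat_adjoint A *\<^sub>v u \<in> carrier_vec n"
      by (rule mult_mat_vec_carrier[OF mat_adjoint_carrier[OF A] u])
  have eq: "exact_ls A u z0 = B *\<^sub>v (mat_adjoint A *\<^sub>v u)"
    unfolding exact_ls_def pseudo_inverse_def B option.sel
    by (rule assoc_mult_mat_vec[OF Bc mat_adjoint_carrier[OF A] u])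
  then show c: "exact_ls A u z0 \<in> carrier_vec n" using mult_mat_vec_carrier[OF Bc h] by simp
  have "G *\<^sub>v exact_ls A u z0 = (G * B) *\<^sub>v (mat_adjoint A *\<^sub>v u)"
    unfolding eq by (rule assoc_mult_mat_vec[OF G_carrier Bc h, symmetric])
  then show "G *\<^sub>v exact_ls A u z0 = mat_adjoint A *\<^sub>v u" using h by (simp add: GB)
qed

context
  fixes zs z0 :: "complex vec"
  assumes zs: "zs \<in> carrier_vec n" and normal: "G *\<^sub>v zs =
      mat_adjoint A *\<^sub>v u" and z0: "z0 \<in> carrier_vec n"
begin

lemma exact_ls_unique: "exact_ls A u z0 = zs"
proof -
  define z where "z = exact_ls A u z0"
  have z: "z \<in> carrier_vec n" "G *\<^sub>v z = mat_adjoint A *\<^sub>v u"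
    unfolding z_def by (rule exact_ls_normal_equations)+
  have d: "z - zs \<in> carrier_vec n" using z(1) zs by simp
  have "G *\<^sub>v (z - zs) = G *\<^sub>v z - G *\<^sub>v zs" by (rule mult_minus_distrib_mat_vec[OF G_carrier z(1) zs])
  also have "\<dots> = 0\<^sub>v n"
    unfolding z(2) normal using mult_mat_vec_carrier[OF mat_adjoint_carrier[OF A] u]
      by (rule minus_cancel_vec)
  finally have 0: "z - zs = 0\<^sub>v n" by (rule G_injective[OF d])
  have "z = (z - zs) + zs" using z(1) zs by (intro eq_vecI) auto
  also have "\<dots> = zs" unfolding 0 using zs by simp
  finally show ?thesis by (simp only: z_def)
qed

text \<open>Writing the right-hand side as \<open>G *\<^sub>v zs\<close> shows that one iteration
  maps the error d to d - G d, whose norm is at most D times that of d.\<close>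

lemma richardson_error:
  "richardson l A u z0 \<in> carrier_vec n \<and> l2_norm (zs - richardson l A u z0) \<le> D ^ l * l2_norm (zs - z0)"
proof (induction l)
  case 0
  then show ?case using z0 by (simp add: richardson_def)
next
  case (Suc l)
  define z where "z = richardson l A u z0"
  have z: "z \<in> carrier_vec n" and IH: "l2_norm (zs - z) \<le> D ^ l * l2_norm (zs - z0)"
    using Suc by (auto simp: z_def)
  have I: "1\<^sub>m (dim_col A) \<in> carrier_mat n n" using A by auto
  have "richardson (Suc l) A u z0 = G *\<^sub>v zs - (G - 1\<^sub>m (dim_col A)) *\<^sub>v z"
    by (simp add: richardson_def z_def normal)
  also have "(G - 1\<^sub>m (dim_col A)) *\<^sub>v z = G *\<^sub>v z - z"
    using z A by (subst minus_mult_distrib_mat_vec[OF G_carrier I z]) simp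
  finally have step: "richardson (Suc l) A u z0 = G *\<^sub>v zs - (G *\<^sub>v z - z)" .
  have d: "zs - z \<in> carrier_vec n" using zs z by simp
  have regroup: "a - (b - (c - d)) = (a - d) - (b - c)" if "a \<in> carrier_vec n" "b \<in> carrier_vec n"
    "c \<in> carrier_vec n" "d \<in> carrier_vec n" for a b c d :: "complex vec"
    using that by (intro eq_vecI) auto
  have "zs - richardson (Suc l) A u z0 = (zs - z) - G *\<^sub>v (zs - z)"
    unfolding step mult_minus_distrib_mat_vec[OF G_carrier zs z]
    by (rule regroup) (intro zs z G_mult_carrier)+
  then have "l2_norm (zs - richardson (Suc l) A u z0) \<le> D * l2_norm (zs - z)"
      using G_minus_id[OF d] by simp
  also have "\<dots> \<le> D * (D ^ l * l2_norm (zs - z0))" using IH D by (intro mult_left_mono) auto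
  finally show ?case using step z G_mult_carrier[OF zs] G_mult_carrier[OF z] by simp
qed

text \<open>The residual is \<open>G e\<close> for the error \<open>e\<close>. The invariant \<open>r \<bullet>c p = r \<bullet>c r\<close> makes every
  step an exact line search for \<open>\<parallel>A e\<parallel>\<close>, which is all that is needed: no conjugacy enters.\<close>

definition cg_inv :: "complex vec \<times> complex vec \<times> complex vec \<Rightarrow> bool" where
  "cg_inv = (\<lambda>(z, r, p). z \<in> carrier_vec n \<and> r \<in> carrier_vec n \<and> p \<in> carrier_vec n \<and>
     r = G *\<^sub>v (zs - z) \<and> r \<bullet>c p = r \<bullet>c r)"

text \<open>The new residual is orthogonal to \<open>p\<close>; equivalently, the images under
  \<open>A\<close> of the new error and of \<open>p\<close> are orthogonal. By Pythagoras no other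
  step length \<open>t\<close> along \<open>p\<close> does better. The choice t = 0 gives
  monotonicity, t = 1 along the residual compares with a Richardson step.\<close>

lemma cg_step_line_search:
  assumes inv: "cg_inv (z, r, p)" and step: "cg_step G (z, r, p) = (z', r', p')"
  shows "cg_inv (z', r', p')"
    and "l2_norm (A *\<^sub>v (zs - z')) \<le> l2_norm (A *\<^sub>v ((zs - z) - t \<cdot>\<^sub>v p))"
proof -
  have c: "z \<in> carrier_vec n" "r \<in> carrier_vec n" "p \<in> carrier_vec n"
    and r: "r = G *\<^sub>v (zs - z)" and rp: "r \<bullet>c p = r \<bullet>c r" using inv by (auto simp: cg_inv_def)
  define \<alpha> where "\<alpha> = (r \<bullet>c r) / ((G *\<^sub>v p) \<bullet>c p)"
  define \<beta> where "\<beta> = (r' \<bullet>c r') / (r \<bullet>c r)"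
  have st: "z' = z + \<alpha> \<cdot>\<^sub>v p" "r' = r - \<alpha> \<cdot>\<^sub>v (G *\<^sub>v p)" "p' = r' + \<beta> \<cdot>\<^sub>v p"
    using step by (auto simp: cg_step_def Let_def \<alpha>_def \<beta>_def)
  note Gp = G_mult_carrier[OF c(3)]
  have c': "z' \<in> carrier_vec n" "r' \<in> carrier_vec n" "p' \<in> carrier_vec n"
    using c Gp by (auto simp: st)
  have e: "zs - z \<in> carrier_vec n" "zs - z' \<in> carrier_vec n" using zs c c' by auto
  have "zs - z' = (zs - z) - \<alpha> \<cdot>\<^sub>v p" using zs c by (intro eq_vecI) (auto simp: st)
  then have r': "r' = G *\<^sub>v (zs - z')"
    using e c by (simp add: st(2) r mult_minus_distrib_mat_vec[OF G_carrier] mult_mat_vec[OF G_carrier])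
  have orth: "r' \<bullet>c p = 0"
  \<comment> \<open>A vanishing denominator makes \<alpha> zero by convention; since
    \<open>A\<close> is injective it occurs only for \<open>p = 0\<close>, where orthogonality is
    trivial.\<close>
  proof (cases "(G *\<^sub>v p) \<bullet>c p = 0")
    case True
    then have "l2_norm (A *\<^sub>v p) = 0"
      using c by (simp add: G_cscalar_prod cscalar_prod_self[OF A_mult_carrier])
    then have "l2_norm p = 0" using A_norm(2)[OF c(3)] l2_norm_nonneg[of p] by simp
    then have "p = 0\<^sub>v n" using c by (simp add: l2_norm_eq_0)
    then show ?thesis using c' by simp
  next
    case False
    have "r' \<bullet>c p = r \<bullet>c p - \<alpha> * ((G *\<^sub>v p) \<bullet>c p)"
      unfolding st(2) using c Gp
      by (simp add: cscalar_prod_minus_left[where n = n] cscalar_prod_smult_left[where n = n])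
    then show ?thesis using False rp by (simp add: \<alpha>_def)
  qed
  have "r' \<bullet>c p' = r' \<bullet>c r'"
    unfolding st(3) using c c' orth
    by (simp add: cscalar_prod_add_right[where n = n] cscalar_prod_smult_right[where n = n])
  then show "cg_inv (z', r', p')" using c' r' by (simp add: cg_inv_def)
  let ?a = "A *\<^sub>v (zs - z')" and ?b = "A *\<^sub>v ((\<alpha> - t) \<cdot>\<^sub>v p)"
  have ab: "?a \<in> carrier_vec m" "?b \<in> carrier_vec m" using e c by (auto intro!: A_mult_carrier)
  have "?a \<bullet>c ?b = r' \<bullet>c ((\<alpha> - t) \<cdot>\<^sub>v p)" unfolding r' using e c by (simp add: G_cscalar_prod)
  also have "\<dots> = 0" using c c' orth by (simp add: cscalar_prod_smult_right[where n = n])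
  finally have "(l2_norm (?a + ?b))\<^sup>2 = (l2_norm ?a)\<^sup>2 + (l2_norm ?b)\<^sup>2" by (rule pythagoras[OF ab])
  then have "(l2_norm ?a)\<^sup>2 \<le> (l2_norm (?a + ?b))\<^sup>2" by simp
  then have "l2_norm ?a \<le> l2_norm (?a + ?b)" by (rule power2_le_imp_le) simp
  also have "?a + ?b = A *\<^sub>v ((zs - z') + (\<alpha> - t) \<cdot>\<^sub>v p)"
    using e c by (simp add: mult_add_distrib_mat_vec[OF A])
  also have "(zs - z') + (\<alpha> - t) \<cdot>\<^sub>v p = (zs - z) - t \<cdot>\<^sub>v p"
    using zs c by (intro eq_vecI) (auto simp: st algebra_simps)
  finally show "l2_norm ?a \<le> l2_norm (A *\<^sub>v ((zs - z) - t \<cdot>\<^sub>v p))" .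
qed

text \<open>The line search controls the norm of the image under \<open>A\<close>. Passing to that
  norm and back costs 2 each time, hence the factor 4; the contraction D comes from the first step,
  whose direction is the residual G(zs - z0).\<close>

lemma conjugate_gradient_error:
  "conjugate_gradient 3 A u z0 \<in> carrier_vec n \<and>
    l2_norm (zs - conjugate_gradient 3 A u z0) \<le> 4 * D * l2_norm (zs - z0)"
proof -
  define r0 where "r0 = mat_adjoint A *\<^sub>v u - G *\<^sub>v z0"
  have e0: "zs - z0 \<in> carrier_vec n" using zs z0 by simp
  have r0: "r0 = G *\<^sub>v (zs - z0)" unfolding r0_def normal[symmetric]
    by (rule mult_minus_distrib_mat_vec[OF G_carrier zs z0, symmetric])
  have c: "r0 \<in> carrier_vec n" unfolding r0 by (rule G_mult_carrier[OF e0])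
  have inv0: "cg_inv (z0, r0, r0)" using z0 c r0 by (simp add: cg_inv_def)
  obtain z1 r1 p1 where s1: "cg_step G (z0, r0, r0) = (z1, r1, p1)" by (metis prod_cases3)
  obtain z2 r2 p2 where s2: "cg_step G (z1, r1, p1) = (z2, r2, p2)" by (metis prod_cases3)
  obtain z3 r3 p3 where s3: "cg_step G (z2, r2, p2) = (z3, r3, p3)" by (metis prod_cases3)
  note inv1 = cg_step_line_search(1)[OF inv0 s1]
  note inv2 = cg_step_line_search(1)[OF inv1 s2]
  note inv3 = cg_step_line_search(1)[OF inv2 s3]
  have cs: "z1 \<in> carrier_vec n" "p1 \<in> carrier_vec n" "z2 \<in> carrier_vec n" "p2 \<in> carrier_vec n"
      "z3 \<in> carrier_vec n"
    using inv1 inv2 inv3 by (auto simp: cg_inv_def)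
  have cg: "conjugate_gradient 3 A u z0 = z3"
    by (simp add: conjugate_gradient_def Let_def r0_def[symmetric] numeral_3_eq_3 s1 s2 s3)
  have triv: "(zs - z) - 0 \<cdot>\<^sub>v p = zs - z" if "z \<in> carrier_vec n" "p \<in> carrier_vec n" for z p
    using zs that by (intro eq_vecI) auto
  have one: "(zs - z0) - 1 \<cdot>\<^sub>v r0 = (zs - z0) - G *\<^sub>v (zs - z0)" by (simp add: r0)
  have d: "(zs - z0) - G *\<^sub>v (zs - z0) \<in> carrier_vec n" using e0 G_mult_carrier[OF e0] by simp
  have "l2_norm (zs - z3) \<le> 2 * l2_norm (A *\<^sub>v (zs - z3))" using zs cs by (intro A_norm) simp
  also have "l2_norm (A *\<^sub>v (zs - z3)) \<le> l2_norm (A *\<^sub>v (zs - z2))"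
    using cg_step_line_search(2)[OF inv2 s3, of 0] cs by (simp add: triv)
  also have "l2_norm (A *\<^sub>v (zs - z2)) \<le> l2_norm (A *\<^sub>v (zs - z1))"
    using cg_step_line_search(2)[OF inv1 s2, of 0] cs by (simp add: triv)
  also have "l2_norm (A *\<^sub>v (zs - z1)) \<le> l2_norm (A *\<^sub>v ((zs - z0) - G *\<^sub>v (zs - z0)))"
    using cg_step_line_search(2)[OF inv0 s1, of 1] unfolding one .
  also have "\<dots> \<le> 2 * l2_norm ((zs - z0) - G *\<^sub>v (zs - z0))" by (rule A_norm[OF d])
  also have "l2_norm ((zs - z0) - G *\<^sub>v (zs - z0)) \<le> D * l2_norm (zs - z0)" by (rule G_minus_id[OF e0])
  finally show ?thesis using cs cg by simp
qed

text \<open>One bound for all solvers, dictated by conjugate gradient. The exact solver has error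
  zero and Richardson's method does better; at D = 1/64 the factor is 1/16.\<close>

lemma least_squares_error:
  assumes "ls \<in> {exact_ls, richardson 3, conjugate_gradient 3}"
  shows "ls A u z0 \<in> carrier_vec n \<and> l2_norm (zs - ls A u z0) \<le> 4 * D * l2_norm (zs - z0)"
proof -
  have "D ^ 3 \<le> D ^ 1" using D by (intro power_decreasing) auto
  then have "D ^ 3 * l2_norm (zs - z0) \<le> 4 * D * l2_norm (zs - z0)"
    using D by (intro mult_right_mono) auto
  moreover have "zs - zs = 0\<^sub>v n" using zs by auto
  moreover have "0 \<le> 4 * D * l2_norm (zs - z0)" using D by simp
  ultimately show ?thesis
    using assms richardson_error[of 3] conjugate_gradient_error exact_ls_unique zs by auto
qed

end
end

section \<open>Convergence of CoSaMP\<close>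

lemma mask_vec_add:
  "x \<in> carrier_vec n \<Longrightarrow> y \<in> carrier_vec n \<Longrightarrow> mask_vec S (x + y) = mask_vec S x + mask_vec S y"
  by (intro eq_vecI) auto

lemma mask_vec_minus:
  "x \<in> carrier_vec n \<Longrightarrow> y \<in> carrier_vec n \<Longrightarrow> mask_vec S (x - y) = mask_vec S x - mask_vec S y"
  by (intro eq_vecI) auto

lemma mask_vec_cong:
  "x \<in> carrier_vec n \<Longrightarrow> y \<in> carrier_vec n \<Longrightarrow> (\<And>i. i < n \<Longrightarrow> i \<in> S \<Longrightarrow> x $ i = y $ i) \<Longrightarrow>
    mask_vec S x = mask_vec S y"
  by (intro eq_vecI) auto

lemma add_minus_swap_vec:
  fixes a :: "complex vec"
  assumes "a \<in> carrier_vec n" "b \<in> carrier_vec n" "c \<in> carrier_vec n"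
  shows "a + b - c = (a - c) + b"
  using assms by (intro eq_vecI) auto

lemma supp_minus:
  assumes "x \<in> carrier_vec n" "y \<in> carrier_vec n"
  shows "supp (x - y) \<subseteq> supp x \<union> supp y"
  using assms by (auto simp: supp_def)

lemma l0_norm_le_card: "supp x \<subseteq> S \<Longrightarrow> finite S \<Longrightarrow> card S \<le> r \<Longrightarrow> l0_norm x \<le> r"
  unfolding l0_norm_def by (meson card_mono le_trans)

lemma supp_extend_vec: "supp (extend_vec N T z) \<subseteq> T"
  by (auto simp: supp_def extend_vec_index split: if_splits)

lemma l2_norm_extend_vec:
  assumes "T \<subseteq> {..<N}" "z \<in> carrier_vec (card T)"
  shows "l2_norm (extend_vec N T z) = l2_norm z"
proof -
  have "complex_of_real ((l2_norm (extend_vec N T z))\<^sup>2) = of_real ((l2_norm z)\<^sup>2)"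
    using extend_vec_cscalar_prod[OF assms(1,2,2)] assms(2)
    by (simp only: cscalar_prod_self[OF extend_vec_carrier] cscalar_prod_self)
  then have "(l2_norm (extend_vec N T z))\<^sup>2 = (l2_norm z)\<^sup>2" by (simp only: of_real_eq_iff)
  then show ?thesis by (simp add: power2_eq_iff_nonneg)
qed

text \<open>Padding preserves norms, inner products and images, so the submatrix inherits the bound
  that holds for vectors supported on \<open>T\<close>.\<close>

lemma columns_sparse_defect:
  assumes \<Phi>: "\<Phi> \<in> carrier_mat m N" and "sparse_defect \<Phi> N K K D" and T: "T \<subseteq> {..<N}" "card T \<le> K"
  shows "sparse_defect (columns \<Phi> T) (card T) (card T) (card T) D"
proof -
  have fin: "finite T" using T(1) finite_subset by blast
  have sp: "l0_norm (extend_vec N T z) \<le> K" for z by (rule l0_norm_le_card[OF supp_extend_vec fin T(2)])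
  have "defect (columns \<Phi> T) z z' = defect \<Phi> (extend_vec N T z) (extend_vec N T z')"
    if "z \<in> carrier_vec (card T)" "z' \<in> carrier_vec (card T)" for z z'
    using that T(1) by (simp add: defect_def columns_mult_vec[OF T(1) \<Phi>] extend_vec_cscalar_prod)
  moreover have "cmod (defect \<Phi> (extend_vec N T z) (extend_vec N T z')) \<le>
      D * l2_norm (extend_vec N T z) * l2_norm (extend_vec N T z')" for z z'
    using assms(2) sp by (auto simp: sparse_defect_def[OF \<Phi>])
  ultimately show ?thesis
    unfolding sparse_defect_def[OF columns_carrier[OF T(1) \<Phi>]]
    by (metis l2_norm_extend_vec[OF T(1)])
qed

context
  fixes \<Phi> :: "complex mat" and m N \<sigma> :: nat and x e u :: "complex vec" and ls :: ls_step
  assumes \<Phi>: "\<Phi> \<in> carrier_mat m N" and \<sigma>: "0 < \<sigma>"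
    and sd: "sparse_defect \<Phi> N (4 * \<sigma>) (4 * \<sigma>) (1 / 64)"
    and x: "x \<in> carrier_vec N" "l0_norm x \<le> \<sigma>" and e: "e \<in> carrier_vec m" and u: "u = \<Phi> *\<^sub>v x + e"
    and ls: "ls \<in> {exact_ls, richardson 3, conjugate_gradient 3}"
begin

text \<open>The vector obtained by applying the adjoint to the samples of \<open>r\<close> is a
  proxy for \<open>r\<close> on every small index set: the Gram matrix contributes D = 1/64, the
  noise at most twice its norm.\<close>

lemma proxy_error:
  assumes r: "r \<in> carrier_vec N" "l0_norm r \<le> 4 * \<sigma>" and S: "finite S" "card S \<le> 4 * \<sigma>"
  shows "l2_norm (mask_vec S (mat_adjoint \<Phi> *\<^sub>v (\<Phi> *\<^sub>v r + e) - r)) \<le>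
      1 / 64 * l2_norm r + 2 * l2_norm e"
proof -
  note A = mat_adjoint_carrier[OF \<Phi>]
  have Pr: "\<Phi> *\<^sub>v r \<in> carrier_vec m" by (rule mult_mat_vec_carrier[OF \<Phi> r(1)])
  have c: "mat_adjoint \<Phi> *\<^sub>v (\<Phi> *\<^sub>v r) \<in> carrier_vec N" "mat_adjoint \<Phi> *\<^sub>v e \<in> carrier_vec N"
    by (rule mult_mat_vec_carrier[OF A Pr], rule mult_mat_vec_carrier[OF A e])
  have "mat_adjoint \<Phi> *\<^sub>v (\<Phi> *\<^sub>v r + e) - r =
      (mat_adjoint \<Phi> *\<^sub>v (\<Phi> *\<^sub>v r) - r) + mat_adjoint \<Phi> *\<^sub>v e"
    unfolding mult_add_distrib_mat_vec[OF A Pr e] by (rule add_minus_swap_vec[OF c r(1)])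
  then have "mask_vec S (mat_adjoint \<Phi> *\<^sub>v (\<Phi> *\<^sub>v r + e) - r) =
      mask_vec S (mat_adjoint \<Phi> *\<^sub>v (\<Phi> *\<^sub>v r) - r) + mask_vec S (mat_adjoint \<Phi> *\<^sub>v e)"
    using c r(1) by (simp add: mask_vec_add[where n = N])
  then have "l2_norm (mask_vec S (mat_adjoint \<Phi> *\<^sub>v (\<Phi> *\<^sub>v r + e) - r)) \<le>
      l2_norm (mask_vec S (mat_adjoint \<Phi> *\<^sub>v (\<Phi> *\<^sub>v r) - r)) +
          l2_norm (mask_vec S (mat_adjoint \<Phi> *\<^sub>v e))"
    using l2_norm_triangle[of "mask_vec S (mat_adjoint \<Phi> *\<^sub>v (\<Phi> *\<^sub>v r) - r)" N "mask_vec S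
      (mat_adjoint \<Phi> *\<^sub>v e)"]
      c r(1) by simp
  also have "\<dots> \<le> 1 / 64 * l2_norm r + 2 * l2_norm e"
    using mask_gram_minus_id[OF \<Phi> sd _ _ r S] mask_adjoint_sparse[OF \<Phi> sd _ _ e S] by simp
  finally show ?thesis .
qed

text \<open>What \<Omega> misses of the support of \<open>r\<close> is outweighed, in the proxy, by
  what \<Omega> contains outside that support; there \<open>r\<close> vanishes, so the proxy is
  nothing but error. Replacing the proxy by \<open>r\<close> on the missed indices adds the error a
  second time, which doubles both constants of \<open>proxy_error\<close>.\<close>

lemma identification_error:
  assumes r: "r \<in> carrier_vec N" "l0_norm r \<le> 2 * \<sigma>"
    and \<Omega>: "\<Omega> = supp (largest (2 * \<sigma>) (mat_adjoint \<Phi> *\<^sub>v (\<Phi> *\<^sub>v r + e)))"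
  shows "l2_norm (mask_vec (- \<Omega>) r) \<le> 1 / 32 * l2_norm r + 4 * l2_norm e"
proof -
  define y where "y = mat_adjoint \<Phi> *\<^sub>v (\<Phi> *\<^sub>v r + e)"
  have y: "y \<in> carrier_vec N"
    unfolding y_def using mult_mat_vec_carrier[OF \<Phi> r(1)] e
    by (intro mult_mat_vec_carrier[OF mat_adjoint_carrier[OF \<Phi>]]) simp
  define R where "R = supp r"
  define S where "S = rank_block y 0 (2 * \<sigma>)"
  have R: "R \<subseteq> {..<N}" "card R \<le> 2 * \<sigma>" using supp_subset[OF r(1)] r(2)
      by (auto simp: R_def l0_norm_def)
  \<comment> \<open>The algorithm uses the support of the pruned proxy, domination speaks of the
    block of largest ranks; they differ only where the proxy is zero.\<close>
  have \<Omega>S: "\<Omega> = supp y \<inter> S" unfolding \<Omega> y_def[symmetric] S_def largest_mask by simp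
  have y0: "y $ i = 0" if "i \<in> S" "i \<notin> \<Omega>" for i
    using that by (auto simp: \<Omega>S supp_def S_def rank_block_def)
  have "card \<Omega> \<le> card S" unfolding \<Omega>S by (rule card_mono) (auto simp: S_def)
  then have \<Omega>c: "card \<Omega> \<le> 2 * \<sigma>" using card_rank_block_le[of y 0 "2 * \<sigma>"] by (simp add: S_def)
  have fin: "finite R" "finite \<Omega>" by (simp_all add: R_def \<Omega>S)
  have err: "l2_norm (mask_vec W (y - r)) \<le> 1 / 64 * l2_norm r + 2 * l2_norm e"
    if "W \<subseteq> R \<or> W \<subseteq> \<Omega>" for W
  proof -
    have "finite W" "card W \<le> 4 * \<sigma>"
      using that fin R(2) \<Omega>c card_mono[of R W] card_mono[of \<Omega> W] by (auto intro: finite_subset)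
    then show ?thesis unfolding y_def using r by (intro proxy_error) auto
  qed
  have "l2_norm (mask_vec (R - \<Omega>) y) \<le> l2_norm (mask_vec (R - S) y)"
    using y y0 by (intro l2_norm_mask_mono) auto
  also have "\<dots> \<le> l2_norm (mask_vec (S - R) y)" unfolding S_def by (rule largest_dominates[OF y R])
  also have "\<dots> \<le> l2_norm (mask_vec (\<Omega> - R) y)" using y y0 by (intro l2_norm_mask_mono) auto
  also have "mask_vec (\<Omega> - R) y = mask_vec (\<Omega> - R) (y - r)"
    using y r(1) by (intro mask_vec_cong) (auto simp: R_def supp_def)
  finally have 1: "l2_norm (mask_vec (R - \<Omega>) y) \<le> 1 / 64 * l2_norm r + 2 * l2_norm e"
    using err[of "\<Omega> - R"] by auto
  have "mask_vec (- \<Omega>) r = mask_vec (R - \<Omega>) r" using r(1) by (intro eq_vecI) (auto simp: R_def supp_def)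
  also have "\<dots> = mask_vec (R - \<Omega>) y - mask_vec (R - \<Omega>) (y - r)" using y r(1) by (intro eq_vecI) auto
  finally have "l2_norm (mask_vec (- \<Omega>) r) \<le> l2_norm (mask_vec (R - \<Omega>) y) +
      l2_norm (mask_vec (R - \<Omega>) (y - r))"
    using l2_norm_triangle_minus[of "mask_vec (R - \<Omega>) y" N "mask_vec (R - \<Omega>) (y - r)"] y r(1) by simp
  then show ?thesis using 1 err[of "R - \<Omega>"] by auto
qed

text \<open>In its application \<open>h\<close> is the error of the exact least-squares solution,
  and \<open>normal\<close> restates the normal equations: the proxy of \<open>h\<close> vanishes on
  \<open>T\<close>. So \<open>h\<close> on \<open>T\<close> is proxy error only, and its 1/64 is
  absorbed on the left.\<close>

lemma estimation_error:
  assumes h: "h \<in> carrier_vec N" "l0_norm h \<le> 4 * \<sigma>" and T: "finite T" "card T \<le> 4 * \<sigma>"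
    and normal: "mask_vec T (mat_adjoint \<Phi> *\<^sub>v (\<Phi> *\<^sub>v h + e)) = 0\<^sub>v N"
  shows "63 / 64 * l2_norm h \<le> l2_norm (mask_vec (- T) h) + 2 * l2_norm e"
proof -
  let ?y = "mat_adjoint \<Phi> *\<^sub>v (\<Phi> *\<^sub>v h + e)"
  have y: "?y \<in> carrier_vec N"
    using mult_mat_vec_carrier[OF \<Phi> h(1)] e by
      (intro mult_mat_vec_carrier[OF mat_adjoint_carrier[OF \<Phi>]]) simp
  have "mask_vec T h = mask_vec T ?y - mask_vec T (?y - h)"
    unfolding mask_vec_minus[OF y h(1)] using y h(1)
      by (intro eq_vecI) (auto simp del: index_mult_mat_vec)
  also have "\<dots> = 0\<^sub>v N - mask_vec T (?y - h)" by (simp only: normal)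
  finally have "l2_norm (mask_vec T h) \<le> l2_norm (mask_vec T (?y - h))"
    using l2_norm_triangle_minus[of "0\<^sub>v N" N "mask_vec T (?y - h)"] y h(1) by simp
  also have "\<dots> \<le> 1 / 64 * l2_norm h + 2 * l2_norm e" by (rule proxy_error[OF h T])
  finally have "l2_norm (mask_vec T h) \<le> 1 / 64 * l2_norm h + 2 * l2_norm e" .
  moreover have "l2_norm h \<le> l2_norm (mask_vec T h) + l2_norm (mask_vec (- T) h)"
    using l2_norm_triangle[of "mask_vec T h" N "mask_vec (- T) h"] h(1)
      mask_vec_split[OF h(1), of T] by simp
  ultimately show ?thesis by linarith
qed

text \<open>With \<open>r\<close> the old error and \<open>h\<close> that of the exact solution, h
  \<le> 64/63 (r/32 + 6 e) in norm, the solver adds at most (h + r)/16, and pruning doubles the sum.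
  This is about 0.2 r + 13 e, rounded up to 1/2 and 14.\<close>

lemma cosamp_step_error:
  assumes a: "a \<in> carrier_vec N" "l0_norm a \<le> \<sigma>"
    and step: "cosamp_step ls \<Phi> u \<sigma> (a, u - \<Phi> *\<^sub>v a) = (a', v')"
  shows "a' \<in> carrier_vec N" "l0_norm a' \<le> \<sigma>" "v' = u - \<Phi> *\<^sub>v a'"
    and "l2_norm (x - a') \<le> 1 / 2 * l2_norm (x - a) + 14 * l2_norm e"
proof -
  define r where "r = x - a"
  define \<Omega> where "\<Omega> = supp (largest (2 * \<sigma>) (mat_adjoint \<Phi> *\<^sub>v (u - \<Phi> *\<^sub>v a)))"
  define T where "T = \<Omega> \<union> supp a"
  define A where "A = columns \<Phi> T"
  define z0 where "z0 = restrict_vec T a"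
  define zs where "zs = exact_ls A u z0"
  define w where "w = extend_vec N T zs"
  define b where "b = extend_vec N T (ls A u z0)"
  have um: "u \<in> carrier_vec m" unfolding u using mult_mat_vec_carrier[OF \<Phi> x(1)] e by simp
  have r: "r \<in> carrier_vec N" using x a by (simp add: r_def)
  have N': "dim_col \<Phi> = N" using \<Phi> by simp
  have a'_eq: "a' = largest \<sigma> b" and v'_eq: "v' = u - \<Phi> *\<^sub>v a'"
    using step by (auto simp: cosamp_step_def Let_def b_def A_def z0_def T_def \<Omega>_def N')
  have b: "b \<in> carrier_vec N" and w: "w \<in> carrier_vec N" by (simp_all add: b_def w_def)
  show "a' \<in> carrier_vec N" "l0_norm a' \<le> \<sigma>" "v' = u - \<Phi> *\<^sub>v a'"
    using b by (auto simp: a'_eq v'_eq l0_norm_largest)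
  have residual: "u - \<Phi> *\<^sub>v y = \<Phi> *\<^sub>v (x - y) + e" if "y \<in> carrier_vec N" for y
    unfolding u mult_minus_distrib_mat_vec[OF \<Phi> x(1) that]
    by (rule add_minus_swap_vec[OF mult_mat_vec_carrier[OF \<Phi> x(1)] e mult_mat_vec_carrier[OF \<Phi> that]])
  have "supp r \<subseteq> supp x \<union> supp a" unfolding r_def by (rule supp_minus[OF x(1) a(1)])
  moreover have "card (supp x \<union> supp a) \<le> 2 * \<sigma>"
    using card_Un_le[of "supp x" "supp a"] x(2) a(2) by (simp add: l0_norm_def)
  ultimately have r0: "l0_norm r \<le> 2 * \<sigma>" by (intro l0_norm_le_card) auto
  have id: "l2_norm (mask_vec (- \<Omega>) r) \<le> 1 / 32 * l2_norm r + 4 * l2_norm e"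
    by (rule identification_error[OF r r0]) (simp add: \<Omega>_def residual[OF a(1)] r_def)
  have "card \<Omega> \<le> 2 * \<sigma>" unfolding \<Omega>_def using l0_norm_largest by (simp add: l0_norm_def)
  then have Tc: "card T \<le> 3 * \<sigma>"
    unfolding T_def using card_Un_le[of \<Omega> "supp a"] a(2) by (simp add: l0_norm_def)
  have "mat_adjoint \<Phi> *\<^sub>v (u - \<Phi> *\<^sub>v a) \<in> carrier_vec N"
    using um mult_mat_vec_carrier[OF \<Phi> a(1)] by
      (intro mult_mat_vec_carrier[OF mat_adjoint_carrier[OF \<Phi>]]) simp
  then have "\<Omega> \<subseteq> {..<N}" unfolding \<Omega>_def by (intro supp_subset) simp
  then have T: "T \<subseteq> {..<N}" using supp_subset[OF a(1)] by (simp add: T_def)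
  have fin: "finite T" using T finite_subset by blast
  have A: "A \<in> carrier_mat m (card T)" unfolding A_def by (rule columns_carrier[OF T \<Phi>])
  have AD: "sparse_defect A (card T) (card T) (card T) (1 / 64)"
    unfolding A_def using Tc by (intro columns_sparse_defect[OF \<Phi> sd T]) simp
  have z0: "z0 \<in> carrier_vec (card T)" by (simp add: z0_def)
  have zs: "zs \<in> carrier_vec (card T)" "mat_adjoint A * A *\<^sub>v zs = mat_adjoint A *\<^sub>v u"
    unfolding zs_def by (rule exact_ls_normal_equations[OF A um AD]; simp)+
  have ls_err: "ls A u z0 \<in> carrier_vec (card T)"
      "l2_norm (zs - ls A u z0) \<le> 4 * (1 / 64) * l2_norm (zs - z0)"
    using least_squares_error[OF A um AD _ _ zs z0 ls] by auto
  have Ez0: "extend_vec N T z0 = a"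
    unfolding z0_def extend_restrict_vec[OF T a(1)] by (rule mask_vec_id[OF a(1)]) (simp add: T_def)
  have "l2_norm (w - b) = l2_norm (zs - ls A u z0)"
    unfolding w_def b_def using zs ls_err T
    by (simp add: extend_vec_minus[symmetric] l2_norm_extend_vec)
  moreover have "l2_norm (zs - z0) = l2_norm (w - a)"
    unfolding w_def Ez0[symmetric] using zs z0 T
      by (simp add: extend_vec_minus[symmetric] l2_norm_extend_vec)
  ultimately have wb: "l2_norm (w - b) \<le> 1 / 16 * l2_norm (w - a)" using ls_err by simp
  define h where "h = x - w"
  have h: "h \<in> carrier_vec N" using x w by (simp add: h_def)
  have "supp h \<subseteq> supp x \<union> T"
    using supp_minus[OF x(1) w] supp_extend_vec[of N T zs] by (auto simp: h_def w_def)
  moreover have "card (supp x \<union> T) \<le> 4 * \<sigma>"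
    using card_Un_le[of "supp x" T] x(2) Tc by (simp add: l0_norm_def)
  ultimately have h0: "l0_norm h \<le> 4 * \<sigma>" using fin by (intro l0_norm_le_card) auto
  have "mask_vec T (mat_adjoint \<Phi> *\<^sub>v (\<Phi> *\<^sub>v h + e)) = 0\<^sub>v N"
  proof -
    have Az: "A *\<^sub>v zs = \<Phi> *\<^sub>v w" unfolding A_def w_def by (rule columns_mult_vec[OF T \<Phi> zs(1)])
    have Azc: "A *\<^sub>v zs \<in> carrier_vec m" by (rule mult_mat_vec_carrier[OF A zs(1)])
    have c: "u - A *\<^sub>v zs \<in> carrier_vec m" using um Azc by simp
    have "mat_adjoint A *\<^sub>v (u - A *\<^sub>v zs) = mat_adjoint A *\<^sub>v u - mat_adjoint A *\<^sub>v (A *\<^sub>v zs)"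
      by (rule mult_minus_distrib_mat_vec[OF mat_adjoint_carrier[OF A] um Azc])
    also have "\<dots> = 0\<^sub>v (card T)"
      using zs(2) assoc_mult_mat_vec[OF mat_adjoint_carrier[OF A] A zs(1)]
        mult_mat_vec_carrier[OF mat_adjoint_carrier[OF A] um] by simp
    finally have "mat_adjoint A *\<^sub>v (u - A *\<^sub>v zs) = 0\<^sub>v (card T)" .
    then have "mask_vec T (mat_adjoint \<Phi> *\<^sub>v (u - A *\<^sub>v zs)) = extend_vec N T (0\<^sub>v (card T))"
      using extend_adjoint[OF T \<Phi> c] by (simp add: A_def)
    also have "\<dots> = 0\<^sub>v N"
      using card_below_less[OF fin] by (intro eq_vecI) (auto simp: extend_vec_index)
    finally show ?thesis by (simp add: Az residual[OF w] h_def)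
  qed
  from estimation_error[OF h h0 fin _ this] Tc
  have "63 / 64 * l2_norm h \<le> l2_norm (mask_vec (- T) h) + 2 * l2_norm e" by simp
  \<comment> \<open>Off \<open>T\<close> both \<open>w\<close> and \<open>a\<close> vanish, so both
    errors coincide with \<open>x\<close>; the identification bound for the old error thus controls
    the new one.\<close>
  also have "mask_vec (- T) h = mask_vec (- T) r"
    using h r x(1) a(1) by (intro mask_vec_cong) (auto simp: h_def r_def w_def T_def
      extend_vec_index supp_def)
  also have "l2_norm (mask_vec (- T) r) \<le> l2_norm (mask_vec (- \<Omega>) r)"
    using r by (intro l2_norm_mask_mono) (auto simp: T_def)
  finally have hb: "63 / 64 * l2_norm h \<le> 1 / 32 * l2_norm r + 6 * l2_norm e" using id by linarith
  have "l2_norm (w - a) \<le> l2_norm h + l2_norm r"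
    using l2_norm_triangle_diff[OF w x(1) a(1)] l2_norm_minus_commute[OF w x(1)]
      by (simp add: h_def r_def)
  moreover have "l2_norm (x - b) \<le> l2_norm h + l2_norm (w - b)"
    using l2_norm_triangle_diff[OF x(1) w b] by (simp add: h_def)
  moreover have "l2_norm (x - a') \<le> 2 * l2_norm (x - b)" unfolding a'_eq by (rule l2_norm_prune[OF b x])
  ultimately have "l2_norm (x - a') \<le> 1 / 2 * l2_norm r + 14 * l2_norm e"
    using hb wb l2_norm_nonneg[of r] l2_norm_nonneg[of e] by linarith
  then show "l2_norm (x - a') \<le> 1 / 2 * l2_norm (x - a) + 14 * l2_norm e" by (simp add: r_def)
qed

text \<open>28 is the fixed point of c = c/2 + 14. The initial pair of zero and \<open>u\<close>
  satisfies the invariant that the second component is the current residual.\<close>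

lemma cosamp_error:
  "cosamp ls \<Phi> u \<sigma> k \<in> carrier_vec N \<and> l0_norm (cosamp ls \<Phi> u \<sigma> k) \<le> \<sigma> \<and>
    l2_norm (x - cosamp ls \<Phi> u \<sigma> k) \<le> (1 / 2) ^ k * l2_norm x + 28 * l2_norm e"
proof -
  define st where "st k = (cosamp_step ls \<Phi> u \<sigma> ^^ k) (0\<^sub>v N, u)" for k
  have um: "u \<in> carrier_vec m" unfolding u using mult_mat_vec_carrier[OF \<Phi> x(1)] e by simp
  have "snd (st k) = u - \<Phi> *\<^sub>v fst (st k) \<and> fst (st k) \<in> carrier_vec N \<and> l0_norm (fst (st k)) \<le> \<sigma> \<and>
    l2_norm (x - fst (st k)) \<le> (1 / 2) ^ k * l2_norm x + 28 * l2_norm e"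
  proof (induction k)
    case 0
    have "u - \<Phi> *\<^sub>v 0\<^sub>v N = u" "x - 0\<^sub>v N = x" using um x(1) \<Phi> by (auto intro!: eq_vecI)
    moreover have "l0_norm (0\<^sub>v N) = 0" by (simp add: l0_norm_def supp_def)
    ultimately show ?case by (simp add: st_def)
  next
    case (Suc k)
    let ?a = "fst (st k)"
    obtain a' v' where s: "cosamp_step ls \<Phi> u \<sigma> (?a, u - \<Phi> *\<^sub>v ?a) = (a', v')" by fastforce
    have "st (Suc k) = cosamp_step ls \<Phi> u \<sigma> (fst (st k), snd (st k))" by (simp add: st_def)
    then have "st (Suc k) = (a', v')" using Suc s by simp
    moreover have "l2_norm (x - a') \<le> (1 / 2) ^ Suc k * l2_norm x + 28 * l2_norm e"
      using cosamp_step_error(4)[OF _ _ s] Suc by simp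
    ultimately show ?case using cosamp_step_error(1-3)[OF _ _ s] Suc by simp
  qed
  moreover have "cosamp ls \<Phi> u \<sigma> k = fst (st k)" using \<Phi> by (simp add: cosamp_def st_def)
  ultimately show ?thesis by simp
qed

end

text \<open>The bound 1/16384 is 1/64 divided by 256. With \<tau> the scaled l1 tail, the part of
  \<open>x\<close> cut off contributes \<tau> directly, and its image, of norm at most 2 \<tau>,
  enters as noise with the factor 28; hence 1 + 2 * 28 = 57.\<close>

lemma cosamp_recovery:
  fixes k :: nat
  assumes \<Phi>: "\<Phi> \<in> carrier_mat m N" and N: "0 < N" and s: "0 < s" and ric: "ric (2 * s) \<Phi> \<le> 1 / 16384"
    and x: "x \<in> carrier_vec N" and e: "e \<in> carrier_vec m" and u: "u = \<Phi> *\<^sub>v x + e"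
    and ls: "ls \<in> {exact_ls, richardson 3, conjugate_gradient 3}"
  defines "a \<equiv> cosamp ls \<Phi> u (2 * s) k"
  shows "a \<in> carrier_vec N \<and> l0_norm a \<le> 2 * s \<and>
    l2_norm (x - a) \<le> (1 / 2) ^ k * l2_norm x +
        57 * (1 / sqrt s * l1_norm (x - largest s x) + l2_norm e)"
proof -
  have rip: "rip (2 * s) (1 / 16384) \<Phi>" using rip_of_ric[OF \<Phi> N _ ric] s by simp
  have sd: "sparse_defect \<Phi> N (8 * s) (8 * s) (1 / 64)" using sparse_defect_scale[OF \<Phi> rip] by simp
  define x' where "x' = largest (s + s) x"
  define e' where "e' = \<Phi> *\<^sub>v (x - x') + e"
  define \<tau> where "\<tau> = l1_norm (x - largest s x) / sqrt s"
  have x': "x' \<in> carrier_vec N" "l0_norm x' \<le> 2 * s"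
    using x l0_norm_largest[of "s + s" x] by (simp_all add: x'_def mult_2)
  have d: "x - x' \<in> carrier_vec N" using x x' by simp
  note Pd = mult_mat_vec_carrier[OF \<Phi> d]
  have e': "e' \<in> carrier_vec m" using Pd e by (simp add: e'_def)
  have regroup: "a + b = c + ((a - c) + b)" if "a \<in> carrier_vec m" "c \<in> carrier_vec m"
      "b \<in> carrier_vec m"
    for a b c :: "complex vec" using that by (intro eq_vecI) auto
  have "u = \<Phi> *\<^sub>v x' + e'"
    unfolding u e'_def mult_minus_distrib_mat_vec[OF \<Phi> x x'(1)]
    using mult_mat_vec_carrier[OF \<Phi> x] mult_mat_vec_carrier[OF \<Phi> x'(1)] e by (rule regroup)
  from cosamp_error[OF \<Phi> _ _ x' e' this ls, of k] sd s
  have a: "a \<in> carrier_vec N" "l0_norm a \<le> 2 * s"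
      "l2_norm (x' - a) \<le> (1 / 2) ^ k * l2_norm x' + 28 * l2_norm e'"
    by (simp_all add: a_def)
  have "l2_norm x' \<le> l2_norm x" unfolding x'_def largest_mask by (rule l2_norm_mask_le[OF x])
  then have x'x: "(1 / 2) ^ k * l2_norm x' \<le> (1 / 2) ^ k * l2_norm x" by (intro mult_left_mono) auto
  have t1: "l2_norm (x - x') \<le> 1 * \<tau>"
    unfolding x'_def \<tau>_def by (rule tail_bound[OF x s]) (auto intro: l2_norm_triangle)
  have t2: "l2_norm (\<Phi> *\<^sub>v (x - x')) \<le> 2 * \<tau>"
    unfolding x'_def \<tau>_def
  proof (rule tail_bound[OF x s, where f = "\<lambda>y. l2_norm (\<Phi> *\<^sub>v y)"])
    have "\<Phi> *\<^sub>v 0\<^sub>v N = 0\<^sub>v m" using \<Phi> by (intro eq_vecI) auto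
    then show "l2_norm (\<Phi> *\<^sub>v 0\<^sub>v N) = 0" by simp
    show "l2_norm (\<Phi> *\<^sub>v (y + z)) \<le> l2_norm (\<Phi> *\<^sub>v y) + l2_norm (\<Phi> *\<^sub>v z)"
      if "y \<in> carrier_vec N" "z \<in> carrier_vec N" for y z
      unfolding mult_add_distrib_mat_vec[OF \<Phi> that]
      by (rule l2_norm_triangle[OF mult_mat_vec_carrier[OF \<Phi> that(1)]
        mult_mat_vec_carrier[OF \<Phi> that(2)]])
    show "l2_norm (\<Phi> *\<^sub>v y) \<le> 2 * l2_norm y" if "y \<in> carrier_vec N" "l0_norm y \<le> s" for y
      using that by (intro l2_norm_mult_sparse(1)[OF \<Phi> sd]) auto
  qed simp
  have "l2_norm e' \<le> l2_norm (\<Phi> *\<^sub>v (x - x')) + l2_norm e" unfolding e'_def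
      by (rule l2_norm_triangle[OF Pd e])
  moreover have "l2_norm (x - a) \<le> l2_norm (x - x') + l2_norm (x' - a)"
    by (rule l2_norm_triangle_diff[OF x x'(1) a(1)])
  ultimately have "l2_norm (x - a) \<le> (1 / 2) ^ k * l2_norm x + 57 * (\<tau> + l2_norm e)"
    using a(3) x'x t1 t2 l2_norm_nonneg[of e] by (simp only: distrib_left)
  then show ?thesis using a by (simp add: \<tau>_def)
qed

text \<open>At least log2 t halvings bring \<open>t\<close> below 1, and for \<open>t = 0\<close>
  any number does. Since ln 2 \<ge> 1/2, the logarithm to base 2 is at most twice
  \<open>max 1 (ln t)\<close>; rounding up costs at most one more, whence the factor 3.\<close>

lemma iteration_count:
  fixes t :: real
  assumes "0 \<le> t"
  defines "k \<equiv> nat \<lceil>log 2 t\<rceil>"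
  shows "(1 / 2) ^ k * t \<le> 1" and "real k \<le> 3 * max 1 (ln t)"
proof -
  have k: "log 2 t \<le> real k" unfolding k_def by linarith
  show "(1 / 2) ^ k * t \<le> 1"
  proof (cases "t = 0")
    case False
    then have "t = 2 powr (log 2 t)" using assms(1) by simp
    also have "\<dots> \<le> 2 powr (real k)" using k by (intro powr_mono) auto
    finally have "t \<le> 2 ^ k" by (simp add: powr_realpow)
    then show ?thesis by (simp add: power_one_over field_simps)
  qed simp
  \<comment> \<open>This is ln y \<le> y - 1 at y = 1/2.\<close>
  have "1 / 2 \<le> ln (2::real)" using ln_le_minus_one[of "1 / 2 :: real"] by (simp add: ln_div)
  have "log 2 t \<le> max 1 (ln t) / ln 2" unfolding log_def by (intro divide_right_mono) auto
  also have "\<dots> \<le> max 1 (ln t) / (1 / 2)"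
    by (intro divide_left_mono \<open>1 / 2 \<le> ln 2\<close>) auto
  finally have "log 2 t \<le> 2 * max 1 (ln t)" by simp
  then show "real k \<le> 3 * max 1 (ln t)" unfolding k_def by linarith
qed

theorem theoremA:
  shows "\<exists>c > (0::real). \<exists>C > (0::real). \<exists>C\<^sub>t > (0::real). \<exists>C\<^sub>s > (0::real). \<exists>iters :: real \<Rightarrow> nat.
    \<forall>(m::nat) (N::nat) (s::nat) (\<Phi>::complex mat) (x::complex vec) (e::complex vec)
      (u::complex vec) (\<eta>::real).
      0 < N \<longrightarrow> 0 < s \<longrightarrow> 0 < \<eta> \<longrightarrow>
      \<Phi> \<in> carrier_mat m N \<longrightarrow> x \<in> carrier_vec N \<longrightarrow> e \<in> carrier_vec m \<longrightarrow>
      ric (2 * s) \<Phi> \<le> c \<longrightarrow> u = \<Phi> *\<^sub>v x + e \<longrightarrow>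
      (let k = iters (l2_norm x / \<eta>) in
        (\<forall>ls \<in> {exact_ls, richardson 3, conjugate_gradient 3}.
          let a = cosamp ls \<Phi> u (2 * s) k in
            a \<in> carrier_vec N \<and> l0_norm a \<le> 2 * s \<and>
            l2_norm (x - a) \<le> C * max \<eta> (1 / sqrt (real s) * l1_norm (x - largest s x) + l2_norm e)) \<and>
        (\<forall>(L::nat) (w::complex vec \<Rightarrow> nat) (w'::complex vec \<Rightarrow> nat).
          m \<le> N \<longrightarrow> N \<le> L \<longrightarrow>
          (\<forall>z \<in> carrier_vec N. w z \<le> L) \<longrightarrow> (\<forall>z \<in> carrier_vec m. w' z \<le> L) \<longrightarrow>
          (\<forall>(ls, ls') \<in> {(richardson 3, richardson_run 3),
                         (conjugate_gradient 3, conjugate_gradient_run 3)}.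
            let R = cosamp_run ls' N (mult_run \<Phi> w) (mult_run (mat_adjoint \<Phi>) w')
                      (list_of_vec u) (2 * s) k in
              vec_of_list (val R) = cosamp ls \<Phi> u (2 * s) k \<and>
              real (ops R) \<le> C\<^sub>t * (real L * max 1 (ln (l2_norm x / \<eta>))) \<and>
              real (peak R) \<le> C\<^sub>s * real N)))"
proof (rule exI[of _ "1 / 16384"], rule conjI, simp, rule exI[of _ 58], rule conjI, simp,
    rule exI[of _ 500000], rule conjI, simp, rule exI[of _ 500], rule conjI, simp,
    rule exI[of _ "\<lambda>t. nat \<lceil>log 2 t\<rceil>"], intro allI impI)
  \<comment> \<open>The witnesses: 1/16384 makes D equal to 1/64; 58 is 57 plus 1 for the initial
    error, reduced to \<eta>; 500000 exceeds 3 * 161000 + 5; and 500 is the storage constant of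
    \<open>runs_cosamp\<close>. The number of iterations depends only on the ratio of the norm of
    \<open>x\<close> to \<eta>.\<close>
  fix m N s :: nat and \<Phi> :: "complex mat" and x e u :: "complex vec" and \<eta> :: real
  assume N: "0 < N" and s: "0 < s" and \<eta>: "0 < \<eta>" and \<Phi>: "\<Phi> \<in> carrier_mat m N"
    and x: "x \<in> carrier_vec N" and e: "e \<in> carrier_vec m"
    and ric: "ric (2 * s) \<Phi> \<le> 1 / 16384" and u: "u = \<Phi> *\<^sub>v x + e"
  define t where "t = l2_norm x / \<eta>"
  define k where "k = nat \<lceil>log 2 t\<rceil>"
  define \<epsilon> where "\<epsilon> = 1 / sqrt (real s) * l1_norm (x - largest s x) + l2_norm e"
  have t: "0 \<le> t" using \<eta> by (simp add: t_def)
  have small: "(1 / 2) ^ k * l2_norm x \<le> \<eta>"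
    using iteration_count(1)[OF t] \<eta> by (simp add: k_def t_def field_simps)
  have um: "u \<in> carrier_vec m" unfolding u using mult_mat_vec_carrier[OF \<Phi> x] e by simp
  have accuracy: "let a = cosamp ls \<Phi> u (2 * s) k in
      a \<in> carrier_vec N \<and> l0_norm a \<le> 2 * s \<and> l2_norm (x - a) \<le> 58 * max \<eta> \<epsilon>"
    if "ls \<in> {exact_ls, richardson 3, conjugate_gradient 3}" for ls
    using cosamp_recovery[OF \<Phi> N s ric x e u that, of k, folded \<epsilon>_def] small
    by (auto simp: Let_def max_def)
  have cost: "let R = cosamp_run ls' N (mult_run \<Phi> w) (mult_run (mat_adjoint \<Phi>) w')
      (list_of_vec u) (2 * s) k in
      vec_of_list (val R) = cosamp ls \<Phi> u (2 * s) k \<and>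
      real (ops R) \<le> 500000 * (real L * max 1 (ln t)) \<and> real (peak R) \<le> 500 * real N"
    if "m \<le> N" "N \<le> L" "\<forall>z \<in> carrier_vec N. w z \<le> L" "\<forall>z \<in> carrier_vec m. w' z \<le> L"
      "(ls, ls') \<in> {(richardson 3, richardson_run 3), (conjugate_gradient 3, conjugate_gradient_run 3)}"
    for L w w' ls ls'
  proof -
    let ?R = "cosamp_run ls' N (mult_run \<Phi> w) (mult_run (mat_adjoint \<Phi>) w') (list_of_vec u) (2 * s) k"
    have R: "runs ?R (list_of_vec (cosamp ls \<Phi> u (2 * s) k)) (161000 * L * k + 5 * L) (500 * N)"
      using that s by (intro runs_cosamp_richardson_cg[OF \<Phi> um _ _ _ _ N]) auto
    have "real (ops ?R) \<le> real (161000 * L * k + 5 * L)"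
      using R unfolding runs_def by (intro of_nat_mono) auto
    also have "\<dots> = real L * (161000 * real k + 5)" by (simp add: algebra_simps)
    also have "\<dots> \<le> real L * (500000 * max 1 (ln t))"
      using iteration_count(2)[OF t] by (intro mult_left_mono) (auto simp: k_def)
    finally have "real (ops ?R) \<le> 500000 * (real L * max 1 (ln t))" by (simp add: mult_ac)
    moreover have "real (peak ?R) \<le> real (500 * N)" using R unfolding runs_def
        by (intro of_nat_mono) auto
    moreover have "vec_of_list (val ?R) = cosamp ls \<Phi> u (2 * s) k"
      using R by (simp add: runs_def vec_list)
    ultimately show ?thesis by (simp add: Let_def)
  qed
  show "let k = nat \<lceil>log 2 (l2_norm x / \<eta>)\<rceil> in
        (\<forall>ls \<in> {exact_ls, richardson 3, conjugate_gradient 3}.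
          let a = cosamp ls \<Phi> u (2 * s) k in
            a \<in> carrier_vec N \<and> l0_norm a \<le> 2 * s \<and>
            l2_norm (x - a) \<le> 58 * max \<eta> (1 / sqrt (real s) * l1_norm (x - largest s x) + l2_norm e)) \<and>
        (\<forall>(L::nat) (w::complex vec \<Rightarrow> nat) (w'::complex vec \<Rightarrow> nat).
          m \<le> N \<longrightarrow> N \<le> L \<longrightarrow>
          (\<forall>z \<in> carrier_vec N. w z \<le> L) \<longrightarrow> (\<forall>z \<in> carrier_vec m. w' z \<le> L) \<longrightarrow>
          (\<forall>(ls, ls') \<in> {(richardson 3, richardson_run 3),
                         (conjugate_gradient 3, conjugate_gradient_run 3)}.
            let R = cosamp_run ls' N (mult_run \<Phi> w) (mult_run (mat_adjoint \<Phi>) w')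
                      (list_of_vec u) (2 * s) k in
              vec_of_list (val R) = cosamp ls \<Phi> u (2 * s) k \<and>
              real (ops R) \<le> 500000 * (real L * max 1 (ln (l2_norm x / \<eta>))) \<and>
              real (peak R) \<le> 500 * real N))"
    unfolding t_def[symmetric] \<epsilon>_def[symmetric] k_def[symmetric] Let_def[of k]
  proof (intro conjI ballI allI impI)
    fix L :: nat and w w' :: "complex vec \<Rightarrow> nat" and p :: "ls_step \<times> ls_run"
    assume "m \<le> N" "N \<le> L" "\<forall>z \<in> carrier_vec N. w z \<le> L" "\<forall>z \<in> carrier_vec m. w' z \<le> L"
      "p \<in> {(richardson 3, richardson_run 3), (conjugate_gradient 3, conjugate_gradient_run 3)}"
    then show "case p of (ls, ls') \<Rightarrow>
        let R = cosamp_run ls' N (mult_run \<Phi> w) (mult_run (mat_adjoint \<Phi>) w')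
            (list_of_vec u) (2 * s) k in
          vec_of_list (val R) = cosamp ls \<Phi> u (2 * s) k \<and>
          real (ops R) \<le> 500000 * (real L * max 1 (ln t)) \<and> real (peak R) \<le> 500 * real N"
      by (cases p, simp only: prod.case) (rule cost)
  qed (rule accuracy)
qed

end
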